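(* Let $d\ge2$, let $h$ be a fixed positive integer, and let the edge weights be i.i.d. with a nondegenerate distribution $F$ on $[0,\infty)$. Assume that $\mathbb{E}[\omega^p]<\infty$ for some $p>2$, where $\omega\sim F$. Then the scaled process $\{(n\sigma^2(h))^{-1/2}X(nt)\}_{t\ge0}$ converges in distribution to standard Brownian motion as $n\to\infty$.
   Context: Consider the nearest-neighbor graph on $\mathbb{Z}^d$ with i.i.d. edge weights $\omega_e\sim F$. The weight of a finite nearest-neighbor path $\mathcal{P}$ is $\omega(\mathcal{P})=\sum_{e\in\mathcal{P}}\omega_e$. Let $e_1=(1,0,\ldots,0)$; intervals denote sets of integers. Define $$a_n(h)=\inf\{\omega(\mathcal{P}):\mathcal{P}\text{ a path from }0\text{ to }ne_1\text{ in }\mathbb{Z}\times[-h,h]^{d-1}\},$$ $$t_n(h)=\inf\{\omega(\mathcal{P}):\mathcal{P}\text{ a path from }0\text{ to }ne_1\text{ in }[0,n]\times[-h,h]^{d-1}\}.$$ Let $\mu(h)=\lim_{n\to\infty}\mathbb{E}[a_n(h)]/n$ and $\sigma^2(h)=\lim_{n\to\infty}\operatorname{Var}(a_n(h))/n$; these limits exist and are positive. The continuous process $X(\cdot)$ on $[0,\infty)$ is defined by $X(n)=t_n(h)-n\mu(h)$ for $n\in\{0,1,2,\ldots\}$ and extended by linear interpolation. Convergence in distribution is as random elements of $C[0,\infty)$ with the topology of uniform convergence on compact sets. *)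

theory Defs
  imports "HOL-Probability.Probability"
begin

section \<open>First-passage percolation on thin cylinders\<close>

text \<open>
  Points of $\mathbf{Z}^d$ are functions on the naturals that vanish off the coordinates
  \<open>0, \<dots>, d - 1\<close>; the direction of $e_1$ is coordinate \<open>0\<close>.
\<close>

definition lattice_points :: "nat \<Rightarrow> (nat \<Rightarrow> int) set" where
  "lattice_points d = {x. \<forall>i\<ge>d. x i = 0}"

definition axis_point :: "nat \<Rightarrow> nat \<Rightarrow> int" where
  "axis_point n = (\<lambda>i. if i = 0 then int n else 0)"

definition lattice_adj :: "nat \<Rightarrow> (nat \<Rightarrow> int) \<Rightarrow> (nat \<Rightarrow> int) \<Rightarrow> bool" where
  "lattice_adj d x y \<longleftrightarrow>
     x \<in> lattice_points d \<and> y \<in> lattice_points d \<and> (\<Sum>i<d. \<bar>x i - y i\<bar>) = 1"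

definition lattice_edges :: "nat \<Rightarrow> (nat \<Rightarrow> int) set set" where
  "lattice_edges d = {{x, y} | x y. lattice_adj d x y}"

definition lattice_path ::
    "nat \<Rightarrow> (nat \<Rightarrow> int) set \<Rightarrow> (nat \<Rightarrow> int) \<Rightarrow> (nat \<Rightarrow> int) \<Rightarrow> (nat \<Rightarrow> int) list \<Rightarrow> bool" where
  "lattice_path d S x y P \<longleftrightarrow>
     P \<noteq> [] \<and> hd P = x \<and> last P = y \<and> set P \<subseteq> S \<and> successively (lattice_adj d) P"

text \<open>
  A path may revisit edges, and its weight counts each edge with multiplicity; for nonnegative
  weights the infimum is the same as over self-avoiding paths.
\<close>

definition path_weight :: "((nat \<Rightarrow> int) set \<Rightarrow> real) \<Rightarrow> (nat \<Rightarrow> int) list \<Rightarrow> real" where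
  "path_weight w P = (\<Sum>k<length P - 1. w {P ! k, P ! Suc k})"

definition passage_time ::
    "nat \<Rightarrow> (nat \<Rightarrow> int) set \<Rightarrow> ((nat \<Rightarrow> int) set \<Rightarrow> real) \<Rightarrow> (nat \<Rightarrow> int) \<Rightarrow> (nat \<Rightarrow> int) \<Rightarrow> real" where
  "passage_time d S w x y = Inf {path_weight w P | P. lattice_path d S x y P}"

definition cylinder :: "nat \<Rightarrow> nat \<Rightarrow> (nat \<Rightarrow> int) set" where
  "cylinder d h = {x \<in> lattice_points d. \<forall>i\<in>{1..<d}. x i \<in> {- int h..int h}}"

definition box :: "nat \<Rightarrow> nat \<Rightarrow> nat \<Rightarrow> (nat \<Rightarrow> int) set" where
  "box d n h = {x \<in> cylinder d h. x 0 \<in> {0..int n}}"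

text \<open>A weight field is a family of random variables indexed by the edges; \<open>\<xi>\<close> is a sample point.\<close>

definition a_time ::
    "nat \<Rightarrow> ((nat \<Rightarrow> int) set \<Rightarrow> 'a \<Rightarrow> real) \<Rightarrow> nat \<Rightarrow> nat \<Rightarrow> 'a \<Rightarrow> real" where
  "a_time d \<omega> h n \<xi> = passage_time d (cylinder d h) (\<lambda>e. \<omega> e \<xi>) (axis_point 0) (axis_point n)"

definition t_time ::
    "nat \<Rightarrow> ((nat \<Rightarrow> int) set \<Rightarrow> 'a \<Rightarrow> real) \<Rightarrow> nat \<Rightarrow> nat \<Rightarrow> 'a \<Rightarrow> real" where
  "t_time d \<omega> h n \<xi> = passage_time d (box d n h) (\<lambda>e. \<omega> e \<xi>) (axis_point 0) (axis_point n)"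

definition time_const ::
    "'a measure \<Rightarrow> nat \<Rightarrow> ((nat \<Rightarrow> int) set \<Rightarrow> 'a \<Rightarrow> real) \<Rightarrow> nat \<Rightarrow> real" where
  "time_const M d \<omega> h = lim (\<lambda>n. prob_space.expectation M (a_time d \<omega> h n) / real n)"

definition var_const ::
    "'a measure \<Rightarrow> nat \<Rightarrow> ((nat \<Rightarrow> int) set \<Rightarrow> 'a \<Rightarrow> real) \<Rightarrow> nat \<Rightarrow> real" where
  "var_const M d \<omega> h = lim (\<lambda>n. prob_space.variance M (a_time d \<omega> h n) / real n)"

definition linear_interpolation :: "(nat \<Rightarrow> real) \<Rightarrow> real \<Rightarrow> real" where
  "linear_interpolation f t = (1 - frac t) * f (nat \<lfloor>t\<rfloor>) + frac t * f (Suc (nat \<lfloor>t\<rfloor>))"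

definition X_process ::
    "'a measure \<Rightarrow> nat \<Rightarrow> ((nat \<Rightarrow> int) set \<Rightarrow> 'a \<Rightarrow> real) \<Rightarrow> nat \<Rightarrow> 'a \<Rightarrow> real \<Rightarrow> real" where
  "X_process M d \<omega> h \<xi> =
     linear_interpolation (\<lambda>n. t_time d \<omega> h n \<xi> - real n * time_const M d \<omega> h)"


section \<open>Random elements of $C[0,\infty)$\<close>

definition C_half_line :: "(real \<Rightarrow> real) set" where
  "C_half_line = {f \<in> extensional {0..}. continuous_on {0..} f}"

definition compact_nbhd :: "(real \<Rightarrow> real) \<Rightarrow> real set \<Rightarrow> real \<Rightarrow> (real \<Rightarrow> real) set" where
  "compact_nbhd f K \<epsilon> = {g \<in> C_half_line. \<forall>t\<in>K. \<bar>g t - f t\<bar> < \<epsilon>}"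

definition ucc_open :: "(real \<Rightarrow> real) set \<Rightarrow> bool" where
  "ucc_open U \<longleftrightarrow> U \<subseteq> C_half_line \<and>
     (\<forall>f\<in>U. \<exists>K \<epsilon>. compact K \<and> K \<subseteq> {0..} \<and> \<epsilon> > 0 \<and> compact_nbhd f K \<epsilon> \<subseteq> U)"

definition ucc_topology :: "(real \<Rightarrow> real) topology" where
  "ucc_topology = topology ucc_open"

lemma istopology_ucc_open: "istopology ucc_open"
  unfolding istopology_def
proof (intro conjI allI impI)
  fix U V assume U: "ucc_open U" and V: "ucc_open V"
  show "ucc_open (U \<inter> V)"
    unfolding ucc_open_def
  proof (intro conjI ballI)
    show "U \<inter> V \<subseteq> C_half_line" using U by (auto simp: ucc_open_def)
    fix f assume f: "f \<in> U \<inter> V"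
    obtain K \<epsilon> where 1: "compact K" "K \<subseteq> {0..}" "\<epsilon> > 0" "compact_nbhd f K \<epsilon> \<subseteq> U"
      using U f unfolding ucc_open_def by blast
    obtain L \<delta> where 2: "compact L" "L \<subseteq> {0..}" "\<delta> > 0" "compact_nbhd f L \<delta> \<subseteq> V"
      using V f unfolding ucc_open_def by blast
    have "compact_nbhd f (K \<union> L) (min \<epsilon> \<delta>) \<subseteq> compact_nbhd f K \<epsilon> \<inter> compact_nbhd f L \<delta>"
      by (auto simp: compact_nbhd_def)
    then have "compact_nbhd f (K \<union> L) (min \<epsilon> \<delta>) \<subseteq> U \<inter> V"
      using 1(4) 2(4) by blast
    moreover have "compact (K \<union> L)" "K \<union> L \<subseteq> {0..}" "min \<epsilon> \<delta> > 0"
      using 1 2 by (simp_all add: compact_Un)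
    ultimately show "\<exists>K \<epsilon>. compact K \<and> K \<subseteq> {0..} \<and> \<epsilon> > 0 \<and> compact_nbhd f K \<epsilon> \<subseteq> U \<inter> V"
      by (intro exI[of _ "K \<union> L"] exI[of _ "min \<epsilon> \<delta>"] conjI)
  qed
next
  fix \<U> assume *: "\<forall>U\<in>\<U>. ucc_open U"
  show "ucc_open (\<Union>\<U>)"
    unfolding ucc_open_def
  proof (intro conjI ballI)
    show "\<Union>\<U> \<subseteq> C_half_line" using * by (auto simp: ucc_open_def)
    fix f assume "f \<in> \<Union>\<U>"
    then obtain U where U: "U \<in> \<U>" "f \<in> U" by blast
    then have "ucc_open U" using * by simp
    then have "\<exists>K \<epsilon>. compact K \<and> K \<subseteq> {0..} \<and> \<epsilon> > 0 \<and> compact_nbhd f K \<epsilon> \<subseteq> U"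
      using U(2) unfolding ucc_open_def by simp
    moreover have "U \<subseteq> \<Union>\<U>" using U by blast
    ultimately show "\<exists>K \<epsilon>. compact K \<and> K \<subseteq> {0..} \<and> \<epsilon> > 0 \<and> compact_nbhd f K \<epsilon> \<subseteq> \<Union>\<U>"
      by (meson subset_trans)
  qed
qed

lemma openin_ucc_topology: "openin ucc_topology = ucc_open"
  unfolding ucc_topology_def using istopology_ucc_open by (rule topology_inverse')

lemma topspace_ucc_topology: "topspace ucc_topology = C_half_line"
proof -
  have "compact_nbhd f {} 1 \<subseteq> C_half_line" for f
    by (simp add: compact_nbhd_def)
  then have "ucc_open C_half_line"
    unfolding ucc_open_def by (metis compact_empty empty_subsetI subset_refl zero_less_one)
  moreover have "U \<subseteq> C_half_line" if "ucc_open U" for U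
    using that by (simp add: ucc_open_def)
  ultimately show ?thesis
    unfolding topspace_def openin_ucc_topology by blast
qed

definition borel_of_topology :: "'c topology \<Rightarrow> 'c measure" where
  "borel_of_topology T = sigma (topspace T) {U. openin T U}"

definition converges_in_distribution ::
    "'c topology \<Rightarrow> 'a measure \<Rightarrow> (nat \<Rightarrow> 'a \<Rightarrow> 'c) \<Rightarrow> 'b measure \<Rightarrow> ('b \<Rightarrow> 'c) \<Rightarrow> bool" where
  "converges_in_distribution T M Y N Z \<longleftrightarrow>
     (\<forall>n. Y n \<in> measurable M (borel_of_topology T)) \<and>
     Z \<in> measurable N (borel_of_topology T) \<and>
     (\<forall>g. continuous_map T euclideanreal g \<and> bounded (g ` topspace T) \<longrightarrow>
        (\<lambda>n. \<integral>\<xi>. g (Y n \<xi>) \<partial>M) \<longlonglongrightarrow> (\<integral>\<zeta>. g (Z \<zeta>) \<partial>N))"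


section \<open>Standard Brownian motion\<close>

definition standard_brownian_motion :: "'b measure \<Rightarrow> (real \<Rightarrow> 'b \<Rightarrow> real) \<Rightarrow> bool" where
  "standard_brownian_motion N B \<longleftrightarrow>
     prob_space N \<and>
     (\<forall>t\<ge>0. B t \<in> borel_measurable N) \<and>
     (AE \<zeta> in N. B 0 \<zeta> = 0) \<and>
     (\<forall>s t. 0 \<le> s \<and> s < t \<longrightarrow>
        distributed N lborel (\<lambda>\<zeta>. B t \<zeta> - B s \<zeta>) (normal_density 0 (sqrt (t - s)))) \<and>
     (\<forall>k \<tau>. 0 \<le> \<tau> 0 \<and> (\<forall>i<k. \<tau> i \<le> \<tau> (Suc i)) \<longrightarrow>
        prob_space.indep_vars N (\<lambda>_. borel) (\<lambda>i \<zeta>. B (\<tau> (Suc i)) \<zeta> - B (\<tau> i) \<zeta>) {..<k::nat}) \<and>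
     (\<forall>\<zeta>\<in>space N. continuous_on {0..} (\<lambda>t. B t \<zeta>))"

end

theory Submission
  imports Defs
begin

text \<open>
  Let \<open>T a b\<close> be the passage time between the axis points in columns \<open>a\<close> and \<open>b - 1\<close> inside the
  slab of columns \<open>a, \<dots>, b - 1\<close>. Slabs over disjoint intervals share no edge, and cutting a slab
  at \<open>b\<close> changes the passage time by at most the cost \<open>C b\<close> of walking through the two columns
  next to the cut. So \<open>T\<close> is a stationary, nearly additive array with independent blocks.

  Splitting in halves recursively, the errors on each level being independent, shows that
  \<open>T 0 (k L)\<close> differs from the sum of its \<open>k\<close> independent blocks of length \<open>L\<close> by a random
  variable of standard deviation \<open>O(\<surd>k)\<close>, with a constant that does not depend on \<open>L\<close>. After
  division by \<open>\<surd>(k L)\<close> this error is \<open>O(1/\<surd>L)\<close>, which yields the limit of the variances and,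
  through characteristic functions, the central limit theorem. The limiting variance is positive
  because \<open>T 0 n\<close> has covariance bounded below with each of \<open>n - 1\<close> independent bounded variables,
  the \<open>i\<close>-th one comparing the events that all edges between columns \<open>i\<close> and \<open>i + 1\<close> are heavy
  or light.

  For the process, an inequality of Ottaviani type reduces the oscillation on a mesh interval to
  the central limit theorem and a fourth moment bound for the Gaussian limit. The values on a fixed
  mesh are a function of independent increments, whose joint convergence follows from Skorohod's
  theorem in each coordinate. Bounded continuous functions on $C[0,\infty)$ are suprema of
  Lipschitz functions, so Lipschitz test functions suffice.
\<close>

section \<open>A metric for the compact-open topology\<close>

text \<open>The cut errors are bounded only in mean square, by \<kappa> each. Adding
  \<open>k\<close> of them by the triangle inequality costs \<open>k * \<kappa>\<close>, and
  \<open>k / sqrt (k * L)\<close> is unbounded when \<open>k\<close> grows with \<open>L\<close>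
  fixed. The gain from \<open>k\<close> to \<open>sqrt k\<close> by halving is therefore decisive,
  and it is available for centred errors only. Hence the argument runs on standard deviations and
  treats means separately, where near additivity alone already gives
  \<open>m n = n * \<mu> + O(1)\<close>.

  On a mesh of width \<open>1 / K\<close> over the horizon \<open>H\<close> there are
  \<open>K * H\<close> intervals, so the oscillation bound on one of them must be
  \<open>o(1 / K)\<close>. Second moments give only \<open>O(1 / K)\<close>, and the weights may
  have no fourth moment. The fourth moment is therefore taken of the Gaussian limit, after the
  passage to the limit in \<open>n\<close>; this gives \<open>O(1 / K^2)\<close>, and with
  \<open>K = H^2\<close> all intervals together contribute \<open>O(1 / H)\<close>.

  In the maximal inequality one cut error per column has to be small on the scale
  \<open>sqrt n\<close>, all at once. This is why the tail of a cut error has to be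
  \<open>o(1 / n)\<close>, which square integrability yields.\<close>

text \<open>The weights \<open>1 / (1 + t)\<close> make this a metric for uniform convergence on compact sets
  that takes values in \<open>{0..1}\<close> on all functions, continuous or not.\<close>

definition ucc_dist :: "(real \<Rightarrow> real) \<Rightarrow> (real \<Rightarrow> real) \<Rightarrow> real" where
  "ucc_dist f g = (SUP t\<in>{0..}. min \<bar>f t - g t\<bar> (1 / (1 + t)))"

lemma ucc_dist_term_le_1: "t \<ge> 0 \<Longrightarrow> min \<bar>f t - g t\<bar> (1 / (1 + t)) \<le> (1::real)"
  by (rule min.coboundedI2) simp

lemma ucc_dist_ge: "t \<ge> 0 \<Longrightarrow> min \<bar>f t - g t\<bar> (1 / (1 + t)) \<le> ucc_dist f g"
  unfolding ucc_dist_def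
  by (rule cSUP_upper) (auto intro!: bdd_aboveI2[where M=1] ucc_dist_term_le_1)

lemma ucc_dist_le: "(\<And>t. t \<ge> 0 \<Longrightarrow> min \<bar>f t - g t\<bar> (1 / (1 + t)) \<le> c) \<Longrightarrow> ucc_dist f g \<le> c"
  unfolding ucc_dist_def by (rule cSUP_least) auto

lemma ucc_dist_nonneg: "0 \<le> ucc_dist f g"
  using ucc_dist_ge[of 0 f g] by (smt (verit) divide_nonneg_nonneg min_def)

lemma ucc_dist_le_1: "ucc_dist f g \<le> 1"
  by (rule ucc_dist_le) (rule ucc_dist_term_le_1)

lemma ucc_dist_commute: "ucc_dist f g = ucc_dist g f"
  unfolding ucc_dist_def by (simp add: abs_minus_commute)

lemma ucc_dist_self: "ucc_dist f f = 0"
  by (intro antisym ucc_dist_nonneg ucc_dist_le) (auto simp: min_def)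

lemma ucc_dist_triangle: "ucc_dist f k \<le> ucc_dist f g + ucc_dist g k"
proof (rule ucc_dist_le)
  fix t :: real assume "t \<ge> 0"
  then show "min \<bar>f t - k t\<bar> (1 / (1 + t)) \<le> ucc_dist f g + ucc_dist g k"
    using ucc_dist_ge[of t f g] ucc_dist_ge[of t g k]
      divide_nonneg_nonneg[of 1 "1 + t"] by linarith
qed

text \<open>Past \<open>H\<close> the cap \<open>1 / (1 + t)\<close> is already below
  \<open>1 / (1 + H)\<close>, so only the values before \<open>H\<close> need to be close.\<close>

lemma ucc_dist_le_max:
  assumes "\<And>t. 0 \<le> t \<Longrightarrow> t < H \<Longrightarrow> \<bar>f t - g t\<bar> \<le> \<epsilon>" "\<epsilon> \<ge> 0" "H \<ge> 0"
  shows "ucc_dist f g \<le> \<epsilon> + 1 / (1 + H)"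
proof (rule ucc_dist_le)
  fix t :: real assume t: "t \<ge> 0"
  show "min \<bar>f t - g t\<bar> (1 / (1 + t)) \<le> \<epsilon> + 1 / (1 + H)"
  proof (cases "t < H")
    case True
    have "0 \<le> 1 / (1 + H)" using assms by simp
    with assms(1)[OF t True] show ?thesis by linarith
  next
    case False
    then have "1 / (1 + t) \<le> 1 / (1 + H)" using assms by (intro divide_left_mono) auto
    then show ?thesis using assms by linarith
  qed
qed

text \<open>If \<delta> does not exceed the cap at \<open>t\<close>, a minimum below \<delta> can
  only come from the difference of the values.\<close>

lemma ucc_dist_less_imp:
  assumes "ucc_dist f g < \<delta>" "\<delta> \<le> 1 / (1 + t)" "t \<ge> 0"
  shows "\<bar>f t - g t\<bar> < \<delta>"
  using ucc_dist_ge[of t f g] assms by linarith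

lemma compact_nbhd_ucc_dist:
  assumes "compact K" "K \<subseteq> {0..}" "\<epsilon> > 0"
  obtains \<delta> where "\<delta> > 0" "\<And>g. g \<in> C_half_line \<Longrightarrow> ucc_dist f g < \<delta> \<Longrightarrow> g \<in> compact_nbhd f K \<epsilon>"
proof -
  have "bounded K" using assms compact_imp_bounded by blast
  then obtain b where b: "\<And>t. t \<in> K \<Longrightarrow> norm t \<le> b" and b0: "b > 0"
    unfolding bounded_pos by auto
  \<comment> \<open>The second entry keeps \<delta> below the cap at every point of
    \<open>K\<close>.\<close>
  define \<delta> where "\<delta> = min \<epsilon> (1 / (1 + b))"
  have "\<delta> > 0" using assms b0 by (auto simp: \<delta>_def)
  moreover have "g \<in> compact_nbhd f K \<epsilon>" if "g \<in> C_half_line" "ucc_dist f g < \<delta>" for g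
    unfolding compact_nbhd_def
  proof (intro CollectI conjI ballI that)
    fix t assume t: "t \<in> K"
    then have t0: "0 \<le> t" "t \<le> b" using assms b[OF t] by auto
    then have "1 / (1 + b) \<le> 1 / (1 + t)" using b0 by (intro divide_left_mono) auto
    then have "\<bar>f t - g t\<bar> < \<delta>"
      using that t0 by (intro ucc_dist_less_imp) (auto simp: \<delta>_def)
    then show "\<bar>g t - f t\<bar> < \<epsilon>" by (auto simp: \<delta>_def)
  qed
  ultimately show ?thesis using that by blast
qed

text \<open>The compact-open topology is the metric one; later arguments about open sets can use
  balls.\<close>

lemma ucc_open_iff_ucc_dist:
  "ucc_open U \<longleftrightarrow> U \<subseteq> C_half_line \<and>
     (\<forall>f\<in>U. \<exists>\<delta>>0. \<forall>g\<in>C_half_line. ucc_dist f g < \<delta> \<longrightarrow> g \<in> U)"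
  (is "_ \<longleftrightarrow> _ \<and> ?R")
proof (intro iffI conjI)
  assume U: "ucc_open U"
  then show "U \<subseteq> C_half_line" by (simp add: ucc_open_def)
  show ?R
  proof
    fix f assume "f \<in> U"
    then obtain K \<epsilon> where K: "compact K" "K \<subseteq> {0..}" "\<epsilon> > 0" "compact_nbhd f K \<epsilon> \<subseteq> U"
      using U by (auto simp: ucc_open_def)
    obtain \<delta> where "\<delta> > 0" "\<And>g. g \<in> C_half_line \<Longrightarrow> ucc_dist f g < \<delta> \<Longrightarrow> g \<in> compact_nbhd f K \<epsilon>"
      using compact_nbhd_ucc_dist[OF K(1-3)] by blast
    then show "\<exists>\<delta>>0. \<forall>g\<in>C_half_line. ucc_dist f g < \<delta> \<longrightarrow> g \<in> U" using K by blast
  qed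
next
  assume R: "U \<subseteq> C_half_line \<and> ?R"
  show "ucc_open U"
    unfolding ucc_open_def
  proof (intro conjI ballI)
    show "U \<subseteq> C_half_line" using R by simp
    fix f assume "f \<in> U"
    then obtain \<delta> where \<delta>: "\<delta> > 0" "\<And>g. g \<in> C_half_line \<Longrightarrow> ucc_dist f g < \<delta> \<Longrightarrow> g \<in> U"
      using R by blast
    \<comment> \<open>Horizon and radius are chosen so that both terms of
      \<open>ucc_dist_le_max\<close> are at most \<delta>/4.\<close>
    have "compact_nbhd f {0..4/\<delta>} (\<delta>/4) \<subseteq> U"
    proof
      fix g assume g: "g \<in> compact_nbhd f {0..4/\<delta>} (\<delta>/4)"
      have "ucc_dist f g \<le> \<delta>/4 + 1 / (1 + 4/\<delta>)"
      proof (rule ucc_dist_le_max)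
        fix t assume "0 \<le> t" "t < 4/\<delta>"
        then have "\<bar>g t - f t\<bar> < \<delta>/4" using g by (simp add: compact_nbhd_def)
        then show "\<bar>f t - g t\<bar> \<le> \<delta>/4" by linarith
      qed (use \<delta> in auto)
      also have "1 / (1 + 4/\<delta>) \<le> 1 / (4/\<delta>)"
        using \<delta>(1) by (intro divide_left_mono mult_pos_pos add_pos_pos) auto
      also have "\<delta>/4 + 1 / (4/\<delta>) < \<delta>" using \<delta>(1) by simp
      finally show "g \<in> U" using \<delta>(2) g by (simp add: compact_nbhd_def)
    qed
    then show "\<exists>K \<epsilon>. compact K \<and> K \<subseteq> {0..} \<and> \<epsilon> > 0 \<and> compact_nbhd f K \<epsilon> \<subseteq> U"
      using \<delta>(1) by (intro exI[of _ "{0..4/\<delta>}"] exI[of _ "\<delta>/4"]) auto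
  qed
qed

lemma continuous_map_ucc_imp:
  assumes g: "continuous_map ucc_topology euclideanreal g" and f: "f \<in> C_half_line" and "\<eta> > 0"
  obtains \<delta> where "\<delta> > 0" "\<And>f'. f' \<in> C_half_line \<Longrightarrow> ucc_dist f f' < \<delta> \<Longrightarrow> \<bar>g f' - g f\<bar> < \<eta>"
proof -
  have "openin ucc_topology {x \<in> topspace ucc_topology. g x \<in> ball (g f) \<eta>}"
    using g by (rule openin_continuous_map_preimage) auto
  then have "ucc_open {x \<in> C_half_line. g x \<in> ball (g f) \<eta>}"
    by (simp add: openin_ucc_topology topspace_ucc_topology)
  moreover have "f \<in> {x \<in> C_half_line. g x \<in> ball (g f) \<eta>}" using assms by auto
  ultimately obtain \<delta> where "\<delta> > 0"
    "\<forall>f'\<in>C_half_line. ucc_dist f f' < \<delta> \<longrightarrow> f' \<in> {x \<in> C_half_line. g x \<in> ball (g f) \<eta>}"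
    unfolding ucc_open_iff_ucc_dist by blast
  then show ?thesis using that by (auto simp: dist_real_def abs_minus_commute)
qed

definition ucc_lipschitz :: "real \<Rightarrow> ((real \<Rightarrow> real) \<Rightarrow> real) \<Rightarrow> bool" where
  "ucc_lipschitz L g \<longleftrightarrow>
     L \<ge> 0 \<and> (\<forall>f\<in>C_half_line. \<forall>f'\<in>C_half_line. \<bar>g f - g f'\<bar> \<le> L * ucc_dist f f')"

lemma ucc_lipschitz_continuous_map:
  assumes "ucc_lipschitz L g"
  shows "continuous_map ucc_topology euclideanreal g"
  unfolding continuous_map_def
proof (intro conjI allI impI)
  fix V :: "real set" assume V: "openin euclideanreal V"
  then have V: "open V" by simp
  show "openin ucc_topology {x \<in> topspace ucc_topology. g x \<in> V}"
    unfolding openin_ucc_topology topspace_ucc_topology ucc_open_iff_ucc_dist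
  proof (intro conjI ballI)
    fix f assume f: "f \<in> {x \<in> C_half_line. g x \<in> V}"
    then obtain e where e: "e > 0" "ball (g f) e \<subseteq> V" using V openE by blast
    have L: "L \<ge> 0" using assms by (simp add: ucc_lipschitz_def)
    \<comment> \<open>Division by \<open>L + 1\<close>, since \<open>L\<close> may be zero.\<close>
    have "g f' \<in> V" if "f' \<in> C_half_line" "ucc_dist f f' < e / (L + 1)" for f'
    proof -
      have "\<bar>g f - g f'\<bar> \<le> L * ucc_dist f f'"
        using assms f that by (auto simp: ucc_lipschitz_def)
      also have "\<dots> \<le> (L + 1) * ucc_dist f f'"
        by (intro mult_right_mono ucc_dist_nonneg) auto
      also have "\<dots> < e" using that L by (simp add: field_simps)
      finally show ?thesis using e by (auto simp: dist_real_def)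
    qed
    moreover have "e / (L + 1) > 0" using e L by simp
    ultimately show "\<exists>\<delta>>0. \<forall>g'\<in>C_half_line. ucc_dist f g' < \<delta> \<longrightarrow> g' \<in> {x \<in> C_half_line. g x \<in> V}"
      by (intro exI[of _ "e / (L + 1)"]) simp
  qed auto
qed auto

lemma continuous_map_measurable:
  assumes "continuous_map T euclidean g"
  shows "g \<in> borel_measurable (borel_of_topology T)"
proof (rule borel_measurableI)
  fix S :: "'b set" assume "open S"
  then have "openin T {x \<in> topspace T. g x \<in> S}"
    using assms by (intro openin_continuous_map_preimage) auto
  moreover have "g -` S \<inter> space (borel_of_topology T) = {x \<in> topspace T. g x \<in> S}"
    by (auto simp: borel_of_topology_def space_measure_of_conv)
  moreover have "{U. openin T U} \<subseteq> Pow (topspace T)" using openin_subset by blast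
  ultimately show "g -` S \<inter> space (borel_of_topology T) \<in> sets (borel_of_topology T)"
    by (simp add: borel_of_topology_def)
qed

lemma measurable_borel_of_topologyI:
  assumes "\<And>x. x \<in> space M \<Longrightarrow> f x \<in> topspace T"
    and "\<And>U. openin T U \<Longrightarrow> {x \<in> space M. f x \<in> U} \<in> sets M"
  shows "f \<in> measurable M (borel_of_topology T)"
  unfolding borel_of_topology_def
proof (rule measurable_measure_of)
  show "{U. openin T U} \<subseteq> Pow (topspace T)" using openin_subset[of T] by blast
  show "f \<in> space M \<rightarrow> topspace T" using assms(1) by (rule Pi_I)
  fix U assume "U \<in> {U. openin T U}"
  moreover have "f -` U \<inter> space M = {x \<in> space M. f x \<in> U}" by blast
  ultimately show "f -` U \<inter> space M \<in> sets M"
    using assms(2)[of U] by simp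
qed

section \<open>Reduction to Lipschitz test functions\<close>

text \<open>The Pasch-Hausdorff envelope: for bounded \<open>g\<close> and \<open>L \<ge> 0\<close>
  it is the largest \<open>L\<close>-Lipschitz minorant of \<open>g\<close> on
  \<open>C_half_line\<close>.\<close>

definition inf_convolution :: "((real \<Rightarrow> real) \<Rightarrow> real) \<Rightarrow> real \<Rightarrow> (real \<Rightarrow> real) \<Rightarrow> real" where
  "inf_convolution g L f = (INF f'\<in>C_half_line. g f' + L * ucc_dist f f')"

lemma C_half_line_nonempty: "C_half_line \<noteq> {}"
proof -
  have "(\<lambda>t\<in>{0..}. 0) \<in> C_half_line"
    by (simp add: C_half_line_def cong: continuous_on_cong_simp)
  then show ?thesis by blast
qed

context
  fixes g :: "(real \<Rightarrow> real) \<Rightarrow> real" and b :: real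
  assumes bound: "\<And>f. f \<in> C_half_line \<Longrightarrow> \<bar>g f\<bar> \<le> b"
begin

lemma inf_convolution_le:
  assumes "L \<ge> 0" "f' \<in> C_half_line"
  shows "inf_convolution g L f \<le> g f' + L * ucc_dist f f'"
  unfolding inf_convolution_def
proof (rule cINF_lower[OF _ assms(2)], rule bdd_belowI2)
  fix f' assume "f' \<in> C_half_line"
  then show "- b \<le> g f' + L * ucc_dist f f'"
    using bound[of f'] mult_nonneg_nonneg[OF assms(1) ucc_dist_nonneg[of f f']] by linarith
qed

lemma inf_convolution_ge:
  "(\<And>f'. f' \<in> C_half_line \<Longrightarrow> c \<le> g f' + L * ucc_dist f f') \<Longrightarrow> c \<le> inf_convolution g L f"
  unfolding inf_convolution_def by (rule cINF_greatest[OF C_half_line_nonempty])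

lemma inf_convolution_bounds:
  assumes "L \<ge> 0" "f \<in> C_half_line"
  shows "- b \<le> inf_convolution g L f" "inf_convolution g L f \<le> g f"
    "\<bar>inf_convolution g L f\<bar> \<le> b"
proof -
  show *: "- b \<le> inf_convolution g L f"
  proof (rule inf_convolution_ge)
    fix f' assume "f' \<in> C_half_line"
    then show "- b \<le> g f' + L * ucc_dist f f'"
      using bound[of f'] mult_nonneg_nonneg[OF assms(1) ucc_dist_nonneg[of f f']] by linarith
  qed
  show "inf_convolution g L f \<le> g f"
    using inf_convolution_le[OF assms, of f] by (simp add: ucc_dist_self)
  then show "\<bar>inf_convolution g L f\<bar> \<le> b" using * bound[OF assms(2)] by linarith
qed

lemma inf_convolution_lipschitz:
  assumes "L \<ge> 0"
  shows "ucc_lipschitz L (inf_convolution g L)"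
proof -
  have *: "inf_convolution g L f \<le> inf_convolution g L f' + L * ucc_dist f f'" for f f'
  proof -
    have "inf_convolution g L f - L * ucc_dist f f' \<le> inf_convolution g L f'"
    proof (rule inf_convolution_ge)
      fix f'' assume "f'' \<in> C_half_line"
      then have "inf_convolution g L f \<le> g f'' + L * ucc_dist f f''"
        using inf_convolution_le assms by blast
      also have "\<dots> \<le> g f'' + L * (ucc_dist f f' + ucc_dist f' f'')"
        using assms by (intro add_left_mono mult_left_mono ucc_dist_triangle)
      finally show "inf_convolution g L f - L * ucc_dist f f' \<le> g f'' + L * ucc_dist f' f''"
        by (simp add: algebra_simps)
    qed
    then show ?thesis by simp
  qed
  have "\<bar>inf_convolution g L f - inf_convolution g L f'\<bar> \<le> L * ucc_dist f f'" for f f'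
    using *[of f f'] *[of f' f] ucc_dist_commute[of f f'] by (simp add: abs_le_iff)
  then show ?thesis
    using assms by (simp add: ucc_lipschitz_def)
qed

text \<open>A competitor closer than \<delta> has nearly the value \<open>g f\<close> by continuity
  at \<open>f\<close>. Any other one pays at least \<open>k * \<delta>\<close>, and once this
  exceeds \<open>2 * b\<close>, the largest possible oscillation of \<open>g\<close>, moving away is
  no gain. Only continuity at the single point \<open>f\<close> enters, no uniformity.\<close>

lemma inf_convolution_tendsto:
  assumes g: "continuous_map ucc_topology euclideanreal g" and f: "f \<in> C_half_line"
  shows "(\<lambda>k. inf_convolution g (real k) f) \<longlonglongrightarrow> g f"
proof (rule LIMSEQ_I)
  fix r :: real assume "r > 0"
  then obtain \<delta> where \<delta>: "\<delta> > 0"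
    "\<And>f'. f' \<in> C_half_line \<Longrightarrow> ucc_dist f f' < \<delta> \<Longrightarrow> \<bar>g f' - g f\<bar> < r / 2"
    using continuous_map_ucc_imp[OF g f, of "r/2"] by auto
  obtain k0 :: nat where k0: "2 * b / \<delta> \<le> k0" using real_arch_simple by blast
  show "\<exists>no. \<forall>n\<ge>no. norm (inf_convolution g (real n) f - g f) < r"
  proof (intro exI[of _ k0] allI impI)
    fix n assume n: "n \<ge> k0"
    have "2 * b / \<delta> \<le> real n" using k0 n by linarith
    then have bd: "2 * b \<le> real n * \<delta>" using \<delta>(1) by (simp add: pos_divide_le_eq)
    have "g f - r / 2 \<le> inf_convolution g n f"
    proof (rule inf_convolution_ge)
      fix f' assume f': "f' \<in> C_half_line"
      show "g f - r / 2 \<le> g f' + real n * ucc_dist f f'"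
      proof (cases "ucc_dist f f' < \<delta>")
        case True
        then show ?thesis using \<delta>(2)[OF f'] mult_nonneg_nonneg[OF of_nat_0_le_iff[of n] ucc_dist_nonneg[of f f']]
          by linarith
      next
        case False
        then have "real n * \<delta> \<le> real n * ucc_dist f f'" by (intro mult_left_mono) auto
        then show ?thesis using bd bound[OF f] bound[OF f'] \<open>r > 0\<close> by linarith
      qed
    qed
    then show "norm (inf_convolution g (real n) f - g f) < r"
      using inf_convolution_bounds(2)[of n f] f \<open>r > 0\<close> by simp
  qed
qed

end

lemma (in prob_space) integrable_bounded_ucc:
  assumes "Y \<in> measurable M (borel_of_topology ucc_topology)"
    and "continuous_map ucc_topology euclideanreal g"
    and "\<And>f. f \<in> C_half_line \<Longrightarrow> \<bar>g f\<bar> \<le> b"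
  shows "integrable M (\<lambda>x. g (Y x))"
proof (rule integrable_const_bound[where B=b])
  have "Y x \<in> C_half_line" if "x \<in> space M" for x
    using measurable_space[OF assms(1) that]
    by (simp add: borel_of_topology_def space_measure_of_conv topspace_ucc_topology)
  then show "AE x in M. norm (g (Y x)) \<le> b" using assms(3) by auto
  show "(\<lambda>x. g (Y x)) \<in> borel_measurable M"
    using assms(1) continuous_map_measurable[OF assms(2)] by (rule measurable_compose)
qed

lemma converges_in_distribution_uccI:
  assumes M: "prob_space M" and N: "prob_space N"
    and Y: "\<And>n. Y n \<in> measurable M (borel_of_topology ucc_topology)"
    and Z: "Z \<in> measurable N (borel_of_topology ucc_topology)"
    and lip: "\<And>g L b. ucc_lipschitz L g \<Longrightarrow> (\<And>f. f \<in> C_half_line \<Longrightarrow> \<bar>g f\<bar> \<le> b) \<Longrightarrow>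
        (\<lambda>n. \<integral>\<xi>. g (Y n \<xi>) \<partial>M) \<longlonglongrightarrow> (\<integral>\<zeta>. g (Z \<zeta>) \<partial>N)"
  shows "converges_in_distribution ucc_topology M Y N Z"
proof -
  interpret M: prob_space M by (rule M)
  interpret N: prob_space N by (rule N)
  have YC: "Y n \<xi> \<in> C_half_line" if "\<xi> \<in> space M" for n \<xi>
    using measurable_space[OF Y that]
    by (simp add: borel_of_topology_def space_measure_of_conv topspace_ucc_topology)
  have ZC: "Z \<zeta> \<in> C_half_line" if "\<zeta> \<in> space N" for \<zeta>
    using measurable_space[OF Z that]
    by (simp add: borel_of_topology_def space_measure_of_conv topspace_ucc_topology)
  \<comment> \<open>The envelopes lie below \<open>g\<close>, so they only yield the lower half of
    the convergence; the upper half is this statement for \<open>- g\<close>.\<close>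
  have lower: "eventually (\<lambda>n. (\<integral>\<zeta>. g (Z \<zeta>) \<partial>N) - \<eta> < (\<integral>\<xi>. g (Y n \<xi>) \<partial>M)) sequentially"
    if g: "continuous_map ucc_topology euclideanreal g"
      and b: "\<And>f. f \<in> C_half_line \<Longrightarrow> \<bar>g f\<bar> \<le> b" and "\<eta> > 0" for g b \<eta>
  proof -
    let ?G = "\<lambda>k. inf_convolution g (real k)"
    have cont: "continuous_map ucc_topology euclideanreal (?G k)" for k
      by (rule ucc_lipschitz_continuous_map[OF inf_convolution_lipschitz[OF b]]) auto
    have "(\<lambda>k. \<integral>\<zeta>. ?G k (Z \<zeta>) \<partial>N) \<longlonglongrightarrow> (\<integral>\<zeta>. g (Z \<zeta>) \<partial>N)"
    proof (rule integral_dominated_convergence[where w="\<lambda>_. b"])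
      show "AE x in N. (\<lambda>k. ?G k (Z x)) \<longlonglongrightarrow> g (Z x)"
        using inf_convolution_tendsto[OF b g] ZC by auto
      show "AE x in N. norm (?G k (Z x)) \<le> b" for k
        using inf_convolution_bounds(3)[OF b] ZC by auto
    qed (use measurable_compose[OF Z continuous_map_measurable] g cont in auto)
    then have "eventually (\<lambda>k. (\<integral>\<zeta>. g (Z \<zeta>) \<partial>N) - \<eta> < (\<integral>\<zeta>. ?G k (Z \<zeta>) \<partial>N)) sequentially"
      by (rule order_tendstoD(1)) (use \<open>\<eta> > 0\<close> in auto)
    then obtain k where k: "(\<integral>\<zeta>. g (Z \<zeta>) \<partial>N) - \<eta> < (\<integral>\<zeta>. ?G k (Z \<zeta>) \<partial>N)"
      unfolding eventually_sequentially by blast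
    have "(\<lambda>n. \<integral>\<xi>. ?G k (Y n \<xi>) \<partial>M) \<longlonglongrightarrow> (\<integral>\<zeta>. ?G k (Z \<zeta>) \<partial>N)"
      by (rule lip[of "real k" _ b]) (auto intro: inf_convolution_lipschitz[OF b] inf_convolution_bounds(3)[OF b])
    then have "eventually (\<lambda>n. (\<integral>\<zeta>. g (Z \<zeta>) \<partial>N) - \<eta> < (\<integral>\<xi>. ?G k (Y n \<xi>) \<partial>M)) sequentially"
      using k by (rule order_tendstoD(1))
    then show ?thesis
    proof (rule eventually_mono)
      fix n assume *: "(\<integral>\<zeta>. g (Z \<zeta>) \<partial>N) - \<eta> < (\<integral>\<xi>. ?G k (Y n \<xi>) \<partial>M)"
      have "(\<integral>\<xi>. ?G k (Y n \<xi>) \<partial>M) \<le> (\<integral>\<xi>. g (Y n \<xi>) \<partial>M)"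
      proof (rule integral_mono)
        show "integrable M (\<lambda>\<xi>. ?G k (Y n \<xi>))"
          using M.integrable_bounded_ucc[OF Y cont, where b=b] inf_convolution_bounds(3)[OF b] by simp
        show "integrable M (\<lambda>\<xi>. g (Y n \<xi>))" using M.integrable_bounded_ucc[OF Y g b] .
        show "?G k (Y n \<xi>) \<le> g (Y n \<xi>)" if "\<xi> \<in> space M" for \<xi>
          by (rule inf_convolution_bounds(2)[OF b]) (use YC that in auto)
      qed
      with * show "(\<integral>\<zeta>. g (Z \<zeta>) \<partial>N) - \<eta> < (\<integral>\<xi>. g (Y n \<xi>) \<partial>M)" by linarith
    qed
  qed
  have conv: "(\<lambda>n. \<integral>\<xi>. g (Y n \<xi>) \<partial>M) \<longlonglongrightarrow> (\<integral>\<zeta>. g (Z \<zeta>) \<partial>N)"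
    if *: "continuous_map ucc_topology euclideanreal g \<and> bounded (g ` topspace ucc_topology)" for g
  proof -
    obtain b where b: "\<And>f. f \<in> C_half_line \<Longrightarrow> \<bar>g f\<bar> \<le> b"
      using * by (auto simp: bounded_iff topspace_ucc_topology)
    have neg: "continuous_map ucc_topology euclideanreal (\<lambda>x. - g x)"
      using * by (auto intro: continuous_map_minus)
    show "(\<lambda>n. \<integral>\<xi>. g (Y n \<xi>) \<partial>M) \<longlonglongrightarrow> (\<integral>\<zeta>. g (Z \<zeta>) \<partial>N)"
    proof (rule order_tendstoI)
      fix a assume "a < (\<integral>\<zeta>. g (Z \<zeta>) \<partial>N)"
      then show "eventually (\<lambda>n. a < (\<integral>\<xi>. g (Y n \<xi>) \<partial>M)) sequentially"
        using lower[of g b "(\<integral>\<zeta>. g (Z \<zeta>) \<partial>N) - a"] * b by auto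
    next
      fix a assume "(\<integral>\<zeta>. g (Z \<zeta>) \<partial>N) < a"
      then show "eventually (\<lambda>n. (\<integral>\<xi>. g (Y n \<xi>) \<partial>M) < a) sequentially"
        using lower[OF neg, of b "a - (\<integral>\<zeta>. g (Z \<zeta>) \<partial>N)"] b by auto
    qed
  qed
  show ?thesis
    unfolding converges_in_distribution_def using Y Z conv by blast
qed

section \<open>Linear interpolation\<close>

lemma linear_interpolation_of_nat: "linear_interpolation f (real n) = f n"
  by (simp add: linear_interpolation_def frac_def)

text \<open>The right endpoint is included although the floor jumps there: gluing the pieces needs
  the affine formula on closed intervals.\<close>

lemma linear_interpolation_on_unit:
  assumes "real n \<le> t" "t \<le> real (Suc n)"
  shows "linear_interpolation f t = (1 - (t - real n)) * f n + (t - real n) * f (Suc n)"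
proof (cases "t = real (Suc n)")
  case True
  then show ?thesis using linear_interpolation_of_nat[of f "Suc n"] by simp
next
  case False
  then have "\<lfloor>t\<rfloor> = int n" using assms by (intro floor_unique) auto
  then show ?thesis by (simp add: linear_interpolation_def frac_def)
qed

lemma continuous_on_linear_interpolation: "continuous_on {0..} (linear_interpolation f)"
proof -
  have loc: "continuous_on {real n..real (Suc n)} (linear_interpolation f)" for n
    by (rule continuous_on_eq[of _ "\<lambda>t. (1 - (t - real n)) * f n + (t - real n) * f (Suc n)"])
       (auto intro!: continuous_intros simp: linear_interpolation_on_unit)
  have fin: "continuous_on {0..real n} (linear_interpolation f)" for n
  proof (induction n)
    case (Suc n)
    have "continuous_on ({0..real n} \<union> {real n..real (Suc n)}) (linear_interpolation f)"
      by (intro continuous_on_closed_Un Suc.IH loc closed_atLeastAtMost)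
    moreover have "{0..real n} \<union> {real n..real (Suc n)} = {0..real (Suc n)}" by auto
    ultimately show ?case by metis
  qed auto
  show ?thesis
    unfolding continuous_on_eq_continuous_within
  proof
    fix t :: real assume t: "t \<in> {0..}"
    obtain n where n: "t < real n" using reals_Archimedean2 by blast
    have "continuous (at t within {0..real n}) (linear_interpolation f)"
      using fin[of n] t n by (auto simp: continuous_on_eq_continuous_within)
    moreover have "at t within {0..real n} = at t within {0..}"
    proof (rule at_within_nhd[where S="{..<real n}"])
      show "{0..real n} \<inter> {..<real n} - {t} = {0..} \<inter> {..<real n} - {t}" by auto
    qed (use n in auto)
    ultimately show "continuous (at t within {0..}) (linear_interpolation f)" by simp
  qed
qed

lemma linear_interpolation_close:
  assumes "\<bar>f (nat \<lfloor>t\<rfloor>) - c\<bar> \<le> e" "\<bar>f (Suc (nat \<lfloor>t\<rfloor>)) - c\<bar> \<le> e"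
  shows "\<bar>linear_interpolation f t - c\<bar> \<le> e"
proof -
  let ?a = "frac t"
  have a: "0 \<le> ?a" "?a \<le> 1" using frac_ge_0 frac_lt_1[of t] by auto
  have "\<bar>linear_interpolation f t - c\<bar>
      = \<bar>(1 - ?a) * (f (nat \<lfloor>t\<rfloor>) - c) + ?a * (f (Suc (nat \<lfloor>t\<rfloor>)) - c)\<bar>"
    unfolding linear_interpolation_def by (simp add: algebra_simps)
  also have "\<dots> \<le> (1 - ?a) * \<bar>f (nat \<lfloor>t\<rfloor>) - c\<bar> + ?a * \<bar>f (Suc (nat \<lfloor>t\<rfloor>)) - c\<bar>"
    using a by (intro order_trans[OF abs_triangle_ineq]) (simp add: abs_mult)
  also have "\<dots> \<le> (1 - ?a) * e + ?a * e"
    using a assms by (intro add_mono mult_left_mono) auto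
  finally show ?thesis by (simp add: algebra_simps)
qed

lemma linear_interpolation_diff:
  "linear_interpolation f t - linear_interpolation g t = linear_interpolation (\<lambda>n. f n - g n) t"
  by (simp add: linear_interpolation_def algebra_simps)

lemma linear_interpolation_scale:
  "c * linear_interpolation f t = linear_interpolation (\<lambda>n. c * f n) t"
  by (simp add: linear_interpolation_def algebra_simps)

text \<open>The scaled process, the polygons and the samples of Brownian motion all have this form.
  The restriction to \<open>{0..}\<close> makes the path extensional, as \<open>C_half_line\<close>
  demands.\<close>

definition lin_path :: "real \<Rightarrow> (nat \<Rightarrow> real) \<Rightarrow> real \<Rightarrow> real" where
  "lin_path k y = (\<lambda>t\<in>{0..}. linear_interpolation y (k * t))"

lemma lin_path_in_C: "k \<ge> 0 \<Longrightarrow> lin_path k y \<in> C_half_line"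
  unfolding C_half_line_def lin_path_def
proof (intro CollectI conjI)
  assume "k \<ge> 0"
  then have "continuous_on {0..} (\<lambda>t. linear_interpolation y (k * t))"
    by (intro continuous_on_compose2[OF continuous_on_linear_interpolation]) (auto intro!: continuous_intros)
  then show "continuous_on {0..} (restrict (\<lambda>t. linear_interpolation y (k * t)) {0..})"
    by (rule continuous_on_eq) auto
qed auto

lemma lin_path_close:
  assumes "\<And>i. \<bar>y i - y' i\<bar> \<le> e"
  shows "ucc_dist (lin_path k y) (lin_path k y') \<le> e"
proof (rule ucc_dist_le)
  fix t :: real assume "t \<ge> 0"
  have "\<bar>linear_interpolation (\<lambda>n. y n - y' n) (k * t) - 0\<bar> \<le> e"
    by (rule linear_interpolation_close) (use assms in auto)
  then show "min \<bar>lin_path k y t - lin_path k y' t\<bar> (1 / (1 + t)) \<le> e"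
    using \<open>t \<ge> 0\<close> by (simp add: lin_path_def linear_interpolation_diff)
qed

text \<open>The values of the path on a compact set depend on finitely many coordinates of
  \<open>y\<close>, so the map from sequences to paths is continuous for the product topology.
  Measurability then reduces to that of the coordinates.\<close>

lemma lin_path_measurable:
  assumes [measurable]: "\<And>i. (\<lambda>x. y x i) \<in> borel_measurable M" and k: "k \<ge> 0"
  shows "(\<lambda>x. lin_path k (y x)) \<in> measurable M (borel_of_topology ucc_topology)"
proof -
  have op: "open {y. lin_path k y \<in> U}" if U: "openin ucc_topology U" for U
  proof (rule Topological_Spaces.openI)
    fix y assume "y \<in> {y. lin_path k y \<in> U}"
    then obtain K \<epsilon> where K: "compact K" "K \<subseteq> {0..}" "\<epsilon> > 0" "compact_nbhd (lin_path k y) K \<epsilon> \<subseteq> U"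
      using U by (auto simp: openin_ucc_topology ucc_open_def)
    obtain b where b: "\<And>t. t \<in> K \<Longrightarrow> norm t \<le> b" "b > 0"
      using compact_imp_bounded[OF K(1)] unfolding bounded_pos by auto
    \<comment> \<open>The mesh cells that meet \<open>K\<close> have both endpoints among the
      indices up to \<open>m\<close>.\<close>
    define m where "m = Suc (nat \<lfloor>k * b\<rfloor>)"
    let ?V = "\<Inter>i\<in>{..m}. (\<lambda>y'::nat\<Rightarrow>real. y' i) -` ball (y i) (\<epsilon>/2)"
    have "open ?V"
      by (intro open_INT ballI open_vimage[OF open_ball continuous_on_product_coordinates]) auto
    moreover have "y \<in> ?V" using K by auto
    moreover have "?V \<subseteq> {y. lin_path k y \<in> U}"
    proof
      fix y' assume y': "y' \<in> ?V"
      have "lin_path k y' \<in> compact_nbhd (lin_path k y) K \<epsilon>"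
        unfolding compact_nbhd_def
      proof (intro CollectI conjI ballI lin_path_in_C k)
        fix t assume t: "t \<in> K"
        have t0: "0 \<le> t" "t \<le> b" using K t b(1)[OF t] by auto
        have "k * t \<le> k * b" using t0 k by (intro mult_left_mono) auto
        then have "nat \<lfloor>k * t\<rfloor> \<le> nat \<lfloor>k * b\<rfloor>" by (intro nat_mono floor_mono)
        then have le: "nat \<lfloor>k * t\<rfloor> \<le> m" "Suc (nat \<lfloor>k * t\<rfloor>) \<le> m" by (auto simp: m_def)
        have cl: "\<bar>y' i - y i\<bar> \<le> \<epsilon>/2" if "i \<le> m" for i
          using y' that by (fastforce simp: dist_real_def abs_minus_commute intro: less_imp_le)
        have "\<bar>linear_interpolation (\<lambda>n. y' n - y n) (k * t) - 0\<bar> \<le> \<epsilon>/2"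
          by (rule linear_interpolation_close) (use cl le in auto)
        then show "\<bar>lin_path k y' t - lin_path k y t\<bar> < \<epsilon>"
          using t0 K(3) by (simp add: lin_path_def linear_interpolation_diff)
      qed
      then show "y' \<in> {y. lin_path k y \<in> U}" using K by blast
    qed
    ultimately show "\<exists>V. open V \<and> y \<in> V \<and> V \<subseteq> {y. lin_path k y \<in> U}" by blast
  qed
  have y: "y \<in> borel_measurable M" by (rule measurable_coordinatewise_then_product) measurable
  show ?thesis
  proof (rule measurable_borel_of_topologyI)
    show "lin_path k (y x) \<in> topspace ucc_topology" for x
      by (simp add: topspace_ucc_topology lin_path_in_C k)
    fix U assume "openin ucc_topology U"
    from op[OF this] have "{y. lin_path k y \<in> U} \<in> sets borel" by simp
    moreover have "y -` {y. lin_path k y \<in> U} \<inter> space M = {x \<in> space M. lin_path k (y x) \<in> U}"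
      by blast
    ultimately show "{x \<in> space M. lin_path k (y x) \<in> U} \<in> sets M"
      using measurable_sets[OF y] by metis
  qed
qed

text \<open>The sequence \<open>y q\<close> has to sample \<open>f\<close> only up to a horizon that
  grows with \<open>q\<close>, because the samples used later are frozen after finitely many
  steps.\<close>

lemma lin_path_sample_tendsto:
  assumes f: "f \<in> C_half_line" and k: "filterlim k at_top sequentially"
    and ev: "\<And>H. eventually (\<lambda>q. \<forall>i. real i \<le> H * real (k q) \<longrightarrow> y q i = f (real i / real (k q))) sequentially"
  shows "(\<lambda>q. ucc_dist (lin_path (real (k q)) (y q)) f) \<longlonglongrightarrow> 0"
proof (rule LIMSEQ_I)
  fix r :: real assume r: "r > 0"
  obtain H where H: "H > 0" "1 / (1 + H) < r / 2"
  proof -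
    have "1 / (1 + 2/r) < 1 / (2/r)"
      using r by (intro divide_strict_left_mono mult_pos_pos add_pos_pos) auto
    then show ?thesis using that[of "2/r"] r by simp
  qed
  \<comment> \<open>The horizon is enlarged by one since the mesh point to the right of some
    \<open>t < H\<close> can lie beyond \<open>H\<close>.\<close>
  have "uniformly_continuous_on {0..H+1} f"
    using f by (intro compact_uniformly_continuous) (auto simp: C_half_line_def intro: continuous_on_subset)
  then obtain d where d: "d > 0" "\<And>s t. s \<in> {0..H+1} \<Longrightarrow> t \<in> {0..H+1} \<Longrightarrow> \<bar>s - t\<bar> < d \<Longrightarrow> \<bar>f s - f t\<bar> < r/4"
    using r unfolding uniformly_continuous_on_def dist_real_def
    by (elim allE[of _ "r/4"]) (auto simp: abs_minus_commute)
  have "eventually (\<lambda>q. k q > nat \<lceil>1 / d\<rceil> + 1) sequentially"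
    using eventually_compose_filterlim[OF eventually_gt_at_top k] by simp
  then have "eventually (\<lambda>q. norm (ucc_dist (lin_path (real (k q)) (y q)) f - 0) < r) sequentially"
    using ev[of "H + 1"]
  proof eventually_elim
    case (elim q)
    let ?k = "real (k q)"
    have k1: "?k > 1" "1 / ?k < d"
    proof -
      show "?k > 1" using elim by simp
      have "1 / d < ?k" using elim by linarith
      then show "1 / ?k < d" using d(1) \<open>?k > 1\<close> by (simp add: field_simps)
    qed
    have "ucc_dist (lin_path ?k (y q)) f \<le> r/4 + 1 / (1 + H)"
    proof (rule ucc_dist_le_max)
      fix t assume t: "0 \<le> t" "t < H"
      define i where "i = nat \<lfloor>?k * t\<rfloor>"
      have kt: "0 \<le> ?k * t" using t k1 by simp
      have i: "real i \<le> ?k * t" "?k * t < real i + 1" using kt by (auto simp: i_def)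
      have i1: "real (Suc i) \<le> (H + 1) * ?k"
      proof -
        have "?k * t \<le> ?k * H" using t k1 by (intro mult_left_mono) auto
        then have "real (Suc i) \<le> ?k * H + ?k" using i k1 unfolding of_nat_Suc by linarith
        then show ?thesis by (simp add: algebra_simps)
      qed
      moreover have "real i \<le> (H + 1) * ?k" using i1 by simp
      ultimately have y: "y q i = f (real i / ?k)" "y q (Suc i) = f (real (Suc i) / ?k)"
        using elim(2) by blast+
      have k0: "?k > 0" using k1 by simp
      have eq: "real i / ?k - t = (real i - ?k * t) / ?k" "real (Suc i) / ?k - t = (real (Suc i) - ?k * t) / ?k"
        using k0 by (simp_all add: diff_divide_distrib)
      have 1: "\<bar>real i / ?k - t\<bar> < d" "\<bar>real (Suc i) / ?k - t\<bar> < d"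
      proof -
        have "\<bar>real i / ?k - t\<bar> \<le> 1 / ?k" "\<bar>real (Suc i) / ?k - t\<bar> \<le> 1 / ?k"
          unfolding eq abs_divide using i k0 by (auto intro!: divide_right_mono)
        then show "\<bar>real i / ?k - t\<bar> < d" "\<bar>real (Suc i) / ?k - t\<bar> < d" using k1 by auto
      qed
      have 2: "real (Suc i) / ?k \<le> H + 1" "real i / ?k \<le> H + 1"
        using i1 k0 by (simp_all add: pos_divide_le_eq)
      have tI: "t \<in> {0..H+1}" "real i / ?k \<in> {0..H+1}" "real (Suc i) / ?k \<in> {0..H+1}"
        using 2 t k0 by simp_all
      have "\<bar>f (real i / ?k) - f t\<bar> \<le> r/4" "\<bar>f (real (Suc i) / ?k) - f t\<bar> \<le> r/4"
        by (rule less_imp_le[OF d(2)[OF tI(2) tI(1) 1(1)]], rule less_imp_le[OF d(2)[OF tI(3) tI(1) 1(2)]])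
      then have "\<bar>y q i - f t\<bar> \<le> r/4" "\<bar>y q (Suc i) - f t\<bar> \<le> r/4" by (simp_all only: y)
      then have "\<bar>linear_interpolation (y q) (?k * t) - f t\<bar> \<le> r/4"
        unfolding i_def by (rule linear_interpolation_close)
      then show "\<bar>lin_path ?k (y q) t - f t\<bar> \<le> r/4" using t by (simp add: lin_path_def)
    qed (use r H in auto)
    also have "\<dots> < r" using H r by linarith
    finally show ?case using ucc_dist_nonneg[of "lin_path ?k (y q)" f] by simp
  qed
  then show "\<exists>no. \<forall>n\<ge>no. norm (ucc_dist (lin_path (real (k n)) (y n)) f - 0) < r"
    by (simp add: eventually_sequentially)
qed

text \<open>Intended for Brownian motion, whose definition makes only the single values
  \<open>B t\<close> measurable. The limit lies in an open set iff, for some \<open>j\<close>, all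
  but finitely many approximations avoid the neighbourhood \<open>V j\<close> of the complement, and
  this is a countable combination of measurable events.\<close>

lemma measurable_ucc_limit:
  assumes Z: "\<And>q. Z q \<in> measurable N (borel_of_topology ucc_topology)"
    and C: "\<And>x. x \<in> space N \<Longrightarrow> Zlim x \<in> C_half_line"
    and lim: "\<And>x. x \<in> space N \<Longrightarrow> (\<lambda>q. ucc_dist (Z q x) (Zlim x)) \<longlonglongrightarrow> 0"
  shows "Zlim \<in> measurable N (borel_of_topology ucc_topology)"
proof (rule measurable_borel_of_topologyI)
  have ZC: "Z q x \<in> C_half_line" if "x \<in> space N" for q x
    using measurable_space[OF Z that]
    by (simp add: borel_of_topology_def space_measure_of_conv topspace_ucc_topology)
  show "Zlim x \<in> topspace ucc_topology" if "x \<in> space N" for x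
    using C that by (simp add: topspace_ucc_topology)
  fix U assume "openin ucc_topology U"
  then have U: "ucc_open U" by (simp add: openin_ucc_topology)
  \<comment> \<open>The open neighbourhood of radius \<open>1 / (j + 1)\<close> around the
    complement of \<open>U\<close>.\<close>
  define V where "V j = {f \<in> C_half_line. \<exists>g\<in>C_half_line. g \<notin> U \<and> ucc_dist f g < 1 / real (Suc j)}" for j
  have V: "{x \<in> space N. Z q x \<in> V j} \<in> sets N" for q j
  proof -
    have "ucc_open (V j)"
      unfolding ucc_open_iff_ucc_dist
    proof (intro conjI ballI)
      show "V j \<subseteq> C_half_line" by (auto simp: V_def)
      fix f assume "f \<in> V j"
      then obtain g where g: "g \<in> C_half_line" "g \<notin> U" "ucc_dist f g < 1 / real (Suc j)"
        by (auto simp: V_def)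
      have "f' \<in> V j" if "f' \<in> C_half_line" "ucc_dist f f' < 1 / real (Suc j) - ucc_dist f g" for f'
        using ucc_dist_triangle[of f' g f] ucc_dist_commute[of f f'] g that by (auto simp: V_def intro!: bexI[of _ g])
      moreover have "1 / real (Suc j) - ucc_dist f g > 0" using g by simp
      ultimately show "\<exists>\<delta>>0. \<forall>g\<in>C_half_line. ucc_dist f g < \<delta> \<longrightarrow> g \<in> V j" by blast
    qed
    then have "V j \<in> sets (borel_of_topology ucc_topology)"
      using openin_subset[of ucc_topology] unfolding borel_of_topology_def
      by (subst sets_measure_of) (auto simp: openin_ucc_topology)
    moreover have "Z q -` V j \<inter> space N = {x \<in> space N. Z q x \<in> V j}" by blast
    ultimately show ?thesis using measurable_sets[OF Z] by metis
  qed
  have "{x \<in> space N. Zlim x \<in> U} = (\<Union>j. \<Union>m. \<Inter>q\<in>{m..}. {x \<in> space N. Z q x \<notin> V j})"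
  proof (intro set_eqI iffI)
    fix x assume x: "x \<in> {x \<in> space N. Zlim x \<in> U}"
    then obtain \<delta> where \<delta>: "\<delta> > 0" "\<And>g. g \<in> C_half_line \<Longrightarrow> ucc_dist (Zlim x) g < \<delta> \<Longrightarrow> g \<in> U"
      using U unfolding ucc_open_iff_ucc_dist by blast
    obtain j where j: "1 / real (Suc j) < \<delta> / 2" using \<delta>(1) nat_approx_posE by (metis half_gt_zero)
    have "eventually (\<lambda>q. ucc_dist (Z q x) (Zlim x) < \<delta> / 2) sequentially"
      using x lim[of x] \<delta>(1) by (intro order_tendstoD(2)) auto
    then obtain m where m: "\<And>q. q \<ge> m \<Longrightarrow> ucc_dist (Z q x) (Zlim x) < \<delta> / 2"
      unfolding eventually_sequentially by blast
    have "Z q x \<notin> V j" if "q \<ge> m" for q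
    proof
      assume "Z q x \<in> V j"
      then obtain g where g: "g \<in> C_half_line" "g \<notin> U" "ucc_dist (Z q x) g < 1 / real (Suc j)"
        by (auto simp: V_def)
      have "ucc_dist (Zlim x) g < \<delta>"
        using ucc_dist_triangle[of "Zlim x" g "Z q x"] m[OF that] g(3) j ucc_dist_commute[of "Z q x" "Zlim x"]
        by linarith
      then show False using \<delta> g by blast
    qed
    then show "x \<in> (\<Union>j. \<Union>m. \<Inter>q\<in>{m..}. {x \<in> space N. Z q x \<notin> V j})" using x by auto
  next
    fix x assume "x \<in> (\<Union>j. \<Union>m. \<Inter>q\<in>{m..}. {x \<in> space N. Z q x \<notin> V j})"
    then obtain j m where x: "x \<in> space N" and *: "\<And>q. q \<ge> m \<Longrightarrow> Z q x \<notin> V j" by auto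
    have "eventually (\<lambda>q. ucc_dist (Z q x) (Zlim x) < 1 / real (Suc j)) sequentially"
      using x lim[of x] by (intro order_tendstoD(2)) auto
    then obtain m' where m': "\<And>q. q \<ge> m' \<Longrightarrow> ucc_dist (Z q x) (Zlim x) < 1 / real (Suc j)"
      unfolding eventually_sequentially by blast
    have "Zlim x \<in> U"
      using *[of "max m m'"] m'[of "max m m'"] ZC[OF x] C[OF x] by (auto simp: V_def)
    then show "x \<in> {x \<in> space N. Zlim x \<in> U}" using x by simp
  qed
  moreover have "{x \<in> space N. Z q x \<notin> V j} \<in> sets N" for q j
  proof -
    have "{x \<in> space N. Z q x \<notin> V j} = space N - {x \<in> space N. Z q x \<in> V j}" by auto
    then show ?thesis using V by auto
  qed
  ultimately show "{x \<in> space N. Zlim x \<in> U} \<in> sets N" by auto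
qed

section \<open>Square integrable random variables\<close>

lemma quadratic_nonneg_imp_discriminant:
  fixes a b c :: real
  assumes a: "a \<ge> 0" and q: "\<And>s. 0 \<le> a * s\<^sup>2 + 2 * b * s + c"
  shows "b\<^sup>2 \<le> a * c"
proof (cases "a = 0")
  case True
  have "b = 0"
  proof (rule ccontr)
    assume nz: "b \<noteq> 0"
    \<comment> \<open>At this argument an affine function with slope \<open>2 * b\<close> takes the
      value \<open>-1\<close>.\<close>
    then have "2 * b * (- (c + 1) / (2 * b)) = - (c + 1)" by (simp add: field_simps)
    then show False using q[of "- (c + 1) / (2 * b)"] unfolding True by linarith
  qed
  then show ?thesis using True by simp
next
  case False
  have "0 \<le> a * (- b / a)\<^sup>2 + 2 * b * (- b / a) + c" by (rule q)
  also have "\<dots> = c - b\<^sup>2 / a" using False by (simp add: field_simps power2_eq_square)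
  finally have *: "b\<^sup>2 / a \<le> c" by simp
  have "a > 0" using False a by simp
  then show ?thesis using * by (simp add: pos_divide_le_eq mult.commute)
qed

context prob_space
begin

definition L2 :: "('a \<Rightarrow> real) \<Rightarrow> bool" where
  "L2 X \<longleftrightarrow> X \<in> borel_measurable M \<and> integrable M (\<lambda>x. (X x)\<^sup>2)"

definition l2norm :: "('a \<Rightarrow> real) \<Rightarrow> real" where
  "l2norm X = sqrt (expectation (\<lambda>x. (X x)\<^sup>2))"

text \<open>On square integrable variables a seminorm that does not see constants, so errors can be
  added without knowing their means.\<close>

definition sd :: "('a \<Rightarrow> real) \<Rightarrow> real" where
  "sd X = sqrt (variance X)"

lemma L2_measurable: "L2 X \<Longrightarrow> X \<in> borel_measurable M"
  by (simp add: L2_def)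

lemma L2_integrable: "L2 X \<Longrightarrow> integrable M X"
  unfolding L2_def using square_integrable_imp_integrable by blast

lemma L2_mult_integrable:
  assumes "L2 X" "L2 Y"
  shows "integrable M (\<lambda>x. X x * Y x)"
proof (rule Bochner_Integration.integrable_bound)
  show "integrable M (\<lambda>x. (X x)\<^sup>2 + (Y x)\<^sup>2)" using assms by (simp add: L2_def)
  have "\<bar>a * b\<bar> \<le> a\<^sup>2 + b\<^sup>2" for a b :: real
  proof -
    have "2 * \<bar>a * b\<bar> \<le> a\<^sup>2 + b\<^sup>2"
      using sum_squares_bound[of "\<bar>a\<bar>" "\<bar>b\<bar>"] by (simp add: abs_mult mult.assoc)
    then show ?thesis using abs_ge_zero[of "a * b"] by linarith
  qed
  then show "AE x in M. norm (X x * Y x) \<le> norm ((X x)\<^sup>2 + (Y x)\<^sup>2)" by simp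
qed (use assms in \<open>auto simp: L2_def\<close>)

lemma L2_add: "L2 X \<Longrightarrow> L2 Y \<Longrightarrow> L2 (\<lambda>x. X x + Y x)"
  using L2_mult_integrable[of X Y] by (auto simp: L2_def power2_sum mult.assoc)

lemma L2_cmult: "L2 X \<Longrightarrow> L2 (\<lambda>x. c * X x)"
  by (auto simp: L2_def power_mult_distrib)

lemma L2_diff: "L2 X \<Longrightarrow> L2 Y \<Longrightarrow> L2 (\<lambda>x. X x - Y x)"
  using L2_add[of X "\<lambda>x. -1 * Y x"] L2_cmult[of Y "-1"] by simp

lemma L2_const: "L2 (\<lambda>x. c)"
  by (simp add: L2_def)

lemma L2_sum: "(\<And>i. i \<in> I \<Longrightarrow> L2 (X i)) \<Longrightarrow> L2 (\<lambda>x. \<Sum>i\<in>I. X i x)"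
  by (induction I rule: infinite_finite_induct) (auto intro: L2_add simp: L2_const)

lemma L2_bound:
  assumes "X \<in> borel_measurable M" "L2 Y" "\<And>x. x \<in> space M \<Longrightarrow> \<bar>X x\<bar> \<le> \<bar>Y x\<bar>"
  shows "L2 X"
proof -
  have "integrable M (\<lambda>x. (X x)\<^sup>2)"
    by (rule Bochner_Integration.integrable_bound[where f="\<lambda>x. (Y x)\<^sup>2"])
      (use assms in \<open>auto simp: L2_def abs_le_square_iff\<close>)
  then show ?thesis using assms by (simp add: L2_def)
qed

lemma l2norm_nonneg: "0 \<le> l2norm X"
  by (simp add: l2norm_def)

lemma l2norm_sq: "(l2norm X)\<^sup>2 = expectation (\<lambda>x. (X x)\<^sup>2)"
  by (simp add: l2norm_def)

lemma l2norm_mono: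
  assumes "X \<in> borel_measurable M" "L2 Y" "\<And>x. x \<in> space M \<Longrightarrow> \<bar>X x\<bar> \<le> \<bar>Y x\<bar>"
  shows "l2norm X \<le> l2norm Y"
  unfolding l2norm_def
  by (rule real_sqrt_le_mono, rule integral_mono)
    (use assms L2_bound[OF assms] in \<open>auto simp: L2_def abs_le_square_iff\<close>)

lemma l2norm_cmult: "l2norm (\<lambda>x. c * X x) = \<bar>c\<bar> * l2norm X"
  by (simp add: l2norm_def power_mult_distrib real_sqrt_mult)

lemma expectation_quadratic:
  fixes A B C :: "'a \<Rightarrow> real"
  assumes "integrable M A" "integrable M B" "integrable M C"
  shows "expectation (\<lambda>x. a * A x + b * B x + C x) = a * expectation A + b * expectation B + expectation C"
  using assms by simp

lemma Cauchy_Schwarz_expectation: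
  assumes "L2 X" "L2 Y"
  shows "\<bar>expectation (\<lambda>x. X x * Y x)\<bar> \<le> l2norm X * l2norm Y"
proof -
  let ?a = "expectation (\<lambda>x. (X x)\<^sup>2)" and ?b = "expectation (\<lambda>x. X x * Y x)"
    and ?c = "expectation (\<lambda>x. (Y x)\<^sup>2)"
  have q: "0 \<le> ?a * s\<^sup>2 + 2 * ?b * s + ?c" for s
  proof -
    have "0 \<le> expectation (\<lambda>x. (s * X x + Y x)\<^sup>2)" by simp
    also have "(\<lambda>x. (s * X x + Y x)\<^sup>2) = (\<lambda>x. s\<^sup>2 * (X x)\<^sup>2 + 2 * s * (X x * Y x) + (Y x)\<^sup>2)"
      by (auto simp: power2_eq_square algebra_simps)
    also have "expectation \<dots> = s\<^sup>2 * ?a + 2 * s * ?b + ?c"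
      using assms L2_mult_integrable[OF assms] by (intro expectation_quadratic) (simp_all add: L2_def)
    finally show ?thesis by (simp only: ac_simps)
  qed
  have "?b\<^sup>2 \<le> ?a * ?c" by (rule quadratic_nonneg_imp_discriminant[OF _ q]) simp
  then have "sqrt (?b\<^sup>2) \<le> sqrt (?a * ?c)" by (rule real_sqrt_le_mono)
  then show ?thesis by (simp add: l2norm_def real_sqrt_mult)
qed

lemma l2norm_triangle:
  assumes "L2 X" "L2 Y"
  shows "l2norm (\<lambda>x. X x + Y x) \<le> l2norm X + l2norm Y"
proof (rule power2_le_imp_le)
  have "(l2norm (\<lambda>x. X x + Y x))\<^sup>2 = (l2norm X)\<^sup>2 + 2 * expectation (\<lambda>x. X x * Y x) + (l2norm Y)\<^sup>2"
    unfolding l2norm_sq using assms L2_mult_integrable[OF assms]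
    by (simp add: L2_def power2_sum mult.assoc)
  also have "\<dots> \<le> (l2norm X)\<^sup>2 + 2 * (l2norm X * l2norm Y) + (l2norm Y)\<^sup>2"
    using Cauchy_Schwarz_expectation[OF assms] by simp
  finally show "(l2norm (\<lambda>x. X x + Y x))\<^sup>2 \<le> (l2norm X + l2norm Y)\<^sup>2"
    by (simp add: power2_sum)
qed (use l2norm_nonneg in auto)

lemma abs_expectation_le_l2norm:
  assumes "L2 X"
  shows "expectation (\<lambda>x. \<bar>X x\<bar>) \<le> l2norm X" "\<bar>expectation X\<bar> \<le> l2norm X"
proof -
  have "L2 (\<lambda>x. \<bar>X x\<bar>)" using assms by (auto simp: L2_def)
  from Cauchy_Schwarz_expectation[OF this L2_const[of 1]]
  show *: "expectation (\<lambda>x. \<bar>X x\<bar>) \<le> l2norm X" by (simp add: l2norm_def prob_space)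
  have "\<bar>expectation X\<bar> \<le> expectation (\<lambda>x. \<bar>X x\<bar>)" by (rule integral_abs_bound)
  with * show "\<bar>expectation X\<bar> \<le> l2norm X" by linarith
qed

lemma sd_nonneg: "0 \<le> sd X"
  by (simp add: sd_def)

lemma sd_sq: "(sd X)\<^sup>2 = variance X"
  by (simp add: sd_def)

lemma sd_eq_l2norm: "sd X = l2norm (\<lambda>x. X x - expectation X)"
  by (simp add: sd_def l2norm_def)

lemma sd_le_l2norm: "L2 X \<Longrightarrow> sd X \<le> l2norm X"
  unfolding sd_def l2norm_def
  by (rule real_sqrt_le_mono) (subst variance_eq, auto simp: L2_integrable L2_def)

lemma sd_add:
  assumes "L2 X" "L2 Y"
  shows "sd (\<lambda>x. X x + Y x) \<le> sd X + sd Y"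
proof -
  have "(\<lambda>x. X x + Y x - expectation (\<lambda>x. X x + Y x))
      = (\<lambda>x. (X x - expectation X) + (Y x - expectation Y))"
    using assms by (auto simp: L2_integrable)
  then show ?thesis
    unfolding sd_eq_l2norm using assms
    by (simp only:) (intro l2norm_triangle L2_diff L2_const)
qed

lemma sd_uminus: "sd (\<lambda>x. - X x) = sd X"
proof -
  have "expectation (\<lambda>x. - X x) = - expectation X" by simp
  moreover have "(- X x - - expectation X)\<^sup>2 = (X x - expectation X)\<^sup>2" for x
    by (simp add: power2_commute)
  ultimately show ?thesis by (simp add: sd_def)
qed

lemma sd_diff:
  assumes "L2 X" "L2 Y"
  shows "\<bar>sd X - sd Y\<bar> \<le> sd (\<lambda>x. X x - Y x)"
proof -
  have "sd X \<le> sd (\<lambda>x. X x - Y x) + sd Y"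
    using sd_add[OF L2_diff[OF assms] assms(2)] by simp
  moreover have "sd Y \<le> sd (\<lambda>x. Y x - X x) + sd X"
    using sd_add[OF L2_diff[OF assms(2,1)] assms(1)] by simp
  moreover have "sd (\<lambda>x. Y x - X x) = sd (\<lambda>x. X x - Y x)"
    using sd_uminus[of "\<lambda>x. X x - Y x"] by simp
  ultimately show ?thesis by linarith
qed

lemma sd_distr:
  assumes "X \<in> borel_measurable M" "Y \<in> borel_measurable M" "distr M borel X = distr M borel Y"
  shows "expectation X = expectation Y" "sd X = sd Y"
proof -
  have *: "expectation (\<lambda>x. f (X x)) = expectation (\<lambda>x. f (Y x))" if "f \<in> borel_measurable borel" for f :: "real \<Rightarrow> real"
    using integral_distr[OF assms(1) that] integral_distr[OF assms(2) that] assms(3) by metis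
  show "expectation X = expectation Y" using *[of "\<lambda>x. x"] by simp
  then show "sd X = sd Y"
    unfolding sd_def using *[of "\<lambda>x. (x - expectation X)\<^sup>2"] by simp
qed

lemma l2norm_distr:
  assumes "X \<in> borel_measurable M" "Y \<in> borel_measurable M" "distr M borel X = distr M borel Y"
  shows "l2norm X = l2norm Y"
proof -
  have "expectation (\<lambda>x. (X x)\<^sup>2) = (\<integral>y. y\<^sup>2 \<partial>distr M borel X)" by (rule integral_distr[symmetric]) (use assms in auto)
  also have "\<dots> = expectation (\<lambda>x. (Y x)\<^sup>2)" unfolding assms(3) by (rule integral_distr) (use assms in auto)
  finally show ?thesis by (simp add: l2norm_def)
qed

lemma indep_var_covariance:
  assumes "indep_var borel X borel Y" "L2 X" "L2 Y"
  shows "(sd (\<lambda>x. X x + Y x))\<^sup>2 = (sd X)\<^sup>2 + (sd Y)\<^sup>2"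
proof -
  have int: "integrable M X" "integrable M Y" using assms L2_integrable by auto
  have E: "expectation (\<lambda>x. X x * Y x) = expectation X * expectation Y"
    using indep_var_lebesgue_integral[OF assms(1) int] .
  have "variance (\<lambda>x. X x + Y x) = expectation (\<lambda>x. (X x + Y x)\<^sup>2) - (expectation (\<lambda>x. X x + Y x))\<^sup>2"
    using L2_add[OF assms(2,3)] by (intro variance_eq) (auto simp: L2_integrable L2_def)
  also have "expectation (\<lambda>x. (X x + Y x)\<^sup>2)
      = expectation (\<lambda>x. (X x)\<^sup>2) + 2 * expectation (\<lambda>x. X x * Y x) + expectation (\<lambda>x. (Y x)\<^sup>2)"
    using assms L2_mult_integrable[OF assms(2,3)] by (simp add: L2_def power2_sum mult.assoc)
  also have "expectation (\<lambda>x. X x + Y x) = expectation X + expectation Y" using int by simp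
  finally have "variance (\<lambda>x. X x + Y x) = variance X + variance Y"
    using E assms int by (subst (2 3) variance_eq) (auto simp: L2_def power2_sum)
  then show ?thesis by (simp add: sd_sq)
qed

lemma indep_vars_sd_sum:
  assumes "finite I" "indep_vars (\<lambda>_. borel) X I" "\<And>i. i \<in> I \<Longrightarrow> L2 (X i)"
  shows "(sd (\<lambda>x. \<Sum>i\<in>I. X i x))\<^sup>2 = (\<Sum>i\<in>I. (sd (X i))\<^sup>2)"
  using assms
proof (induction I)
  case empty
  then show ?case by (simp add: sd_def)
next
  case (insert i I)
  have "indep_var borel (X i) borel (\<lambda>x. \<Sum>i\<in>I. X i x)"
    using insert by (intro indep_vars_sum) auto
  then have "(sd (\<lambda>x. X i x + (\<Sum>i\<in>I. X i x)))\<^sup>2 = (sd (X i))\<^sup>2 + (sd (\<lambda>x. \<Sum>i\<in>I. X i x))\<^sup>2"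
    using insert by (intro indep_var_covariance L2_sum) auto
  moreover have "indep_vars (\<lambda>_. borel) X I"
    using insert.prems(1) by (rule indep_vars_subset) auto
  ultimately show ?case using insert by simp
qed

lemma prob_abs_gt_le:
  assumes "L2 X" "r > 0"
  shows "prob {x \<in> space M. \<bar>X x\<bar> > r} \<le> (l2norm X)\<^sup>2 / r\<^sup>2"
proof -
  have [measurable]: "X \<in> borel_measurable M" by (rule L2_measurable[OF assms(1)])
  have "prob {x \<in> space M. \<bar>X x\<bar> > r} \<le> prob {x \<in> space M. (X x)\<^sup>2 \<ge> r\<^sup>2}"
  proof (rule finite_measure_mono)
    show "{x \<in> space M. \<bar>X x\<bar> > r} \<subseteq> {x \<in> space M. (X x)\<^sup>2 \<ge> r\<^sup>2}"
      using assms(2) by (auto simp: abs_le_square_iff[symmetric])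
  qed measurable
  also have "\<dots> \<le> expectation (\<lambda>x. (X x)\<^sup>2) / r\<^sup>2"
    using assms by (intro integral_Markov_inequality_measure[where A="{}"]) (auto simp: L2_def)
  finally show ?thesis by (simp add: l2norm_sq)
qed

text \<open>The map \<open>iexp\<close> is 1-Lipschitz, so closeness in mean square passes directly
  to characteristic functions. This is how the block approximation enters the central limit
  theorem.\<close>

lemma iexp_expectation_diff:
  assumes "L2 X" "L2 Y"
  shows "norm ((CLINT x|M. iexp (t * X x)) - (CLINT x|M. iexp (t * Y x))) \<le> \<bar>t\<bar> * l2norm (\<lambda>x. X x - Y x)"
proof -
  have [measurable]: "X \<in> borel_measurable M" "Y \<in> borel_measurable M" using assms L2_measurable by auto
  have int: "integrable M (\<lambda>x. iexp (t * X x))" "integrable M (\<lambda>x. iexp (t * Y x))"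
    by (rule integrable_iexp; simp)+
  have lip: "norm (iexp u - iexp v) \<le> \<bar>u - v\<bar>" for u v :: real
  proof -
    have "iexp u - iexp v = iexp v * (iexp (u - v) - 1)"
      by (simp add: exp_add[symmetric] algebra_simps)
    then have "norm (iexp u - iexp v) = norm (iexp (u - v) - 1)" by (simp add: norm_mult)
    also have "\<dots> \<le> \<bar>u - v\<bar>" using iexp_approx1[of "u - v" 0] by simp
    finally show ?thesis .
  qed
  have "norm ((CLINT x|M. iexp (t * X x)) - (CLINT x|M. iexp (t * Y x)))
      = norm (CLINT x|M. iexp (t * X x) - iexp (t * Y x))"
    using int by simp
  also have "\<dots> \<le> expectation (\<lambda>x. norm (iexp (t * X x) - iexp (t * Y x)))"
    by (rule integral_norm_bound[of M "\<lambda>x. iexp (t * X x) - iexp (t * Y x)"])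
  also have "\<dots> \<le> expectation (\<lambda>x. \<bar>t\<bar> * \<bar>X x - Y x\<bar>)"
  proof (rule integral_mono)
    show "integrable M (\<lambda>x. \<bar>t\<bar> * \<bar>X x - Y x\<bar>)"
      using L2_integrable[OF L2_diff[OF assms]] by auto
    show "norm (iexp (t * X x) - iexp (t * Y x)) \<le> \<bar>t\<bar> * \<bar>X x - Y x\<bar>" for x
    proof -
      have "t * X x - t * Y x = t * (X x - Y x)" by (rule right_diff_distrib[symmetric])
      with lip[of "t * X x" "t * Y x"] show ?thesis by (simp only: abs_mult)
    qed
  qed (use int in auto)
  also have "\<dots> \<le> \<bar>t\<bar> * l2norm (\<lambda>x. X x - Y x)"
    using abs_expectation_le_l2norm(1)[OF L2_diff[OF assms]] by (simp add: mult_left_mono)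
  finally show ?thesis .
qed

end

section \<open>Real sequences\<close>

lemma quasi_additive:
  fixes f :: "nat \<Rightarrow> real"
  assumes f: "\<And>a b. \<bar>f (a + b) - f a - f b\<bar> \<le> \<kappa>"
  obtains \<mu> where "(\<lambda>n. f n / real n) \<longlonglongrightarrow> \<mu>" "\<And>n. \<bar>f n - real n * \<mu>\<bar> \<le> \<kappa>"
proof -
  have \<kappa>: "\<kappa> \<ge> 0" using f[of 0 0] by linarith
  have mult: "\<bar>f (Suc k * n) - real (Suc k) * f n\<bar> \<le> real k * \<kappa>" for k n
  proof (induction k)
    case (Suc k)
    have "\<bar>f (n + Suc k * n) - f n - f (Suc k * n)\<bar> \<le> \<kappa>" by (rule f)
    with Suc show ?case by (simp add: algebra_simps)
  qed simp
  have close: "\<bar>f (k * n) / real (k * n) - f n / real n\<bar> \<le> \<kappa> / real n" if "k > 0" "n > 0" for k n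
  proof -
    obtain j where k: "k = Suc j" using \<open>k > 0\<close> gr0_implies_Suc by blast
    have "f (k * n) / real (k * n) - f n / real n = (f (k * n) - real k * f n) / real (k * n)"
      using that by (simp add: field_simps)
    also have "\<bar>\<dots>\<bar> \<le> real k * \<kappa> / real (k * n)"
    proof -
      have "\<bar>f (k * n) - real k * f n\<bar> \<le> real k * \<kappa>"
        using mult[of j n] \<kappa> unfolding k by (simp add: algebra_simps)
      then have "\<bar>f (k * n) - real k * f n\<bar> / real (k * n) \<le> real k * \<kappa> / real (k * n)"
        by (rule divide_right_mono) simp
      then show ?thesis by (simp only: abs_divide abs_of_nat)
    qed
    also have "\<dots> = \<kappa> / real n" using that by simp
    finally show ?thesis .
  qed
  have close2: "\<bar>f k / real k - f n / real n\<bar> \<le> \<kappa> / real n + \<kappa> / real k" if "k > 0" "n > 0" for k n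
    using close[OF that] close[OF that(2,1)] by (simp add: mult.commute)
  have "Cauchy (\<lambda>n. f n / real n)"
  proof (rule metric_CauchyI)
    fix e :: real assume "e > 0"
    obtain N :: nat where N: "2 * \<kappa> / e < real N" using reals_Archimedean2 by blast
    have "dist (f k / real k) (f n / real n) < e" if "k \<ge> Suc N" "n \<ge> Suc N" for k n
    proof -
      have *: "\<kappa> / real j < e / 2" if "j \<ge> Suc N" for j
      proof -
        have "2 * \<kappa> / e < real j" using N that by linarith
        then show ?thesis using \<open>e > 0\<close> that by (simp add: field_simps)
      qed
      have "k > 0" "n > 0" using that by auto
      from close2[OF this] *[OF that(1)] *[OF that(2)] show ?thesis
        unfolding dist_real_def by linarith
    qed
    then show "\<exists>N. \<forall>k\<ge>N. \<forall>n\<ge>N. dist (f k / real k) (f n / real n) < e" by blast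
  qed
  then obtain \<mu> where \<mu>: "(\<lambda>n. f n / real n) \<longlonglongrightarrow> \<mu>"
    using real_Cauchy_convergent convergent_def by blast
  have "\<bar>f n - real n * \<mu>\<bar> \<le> \<kappa>" for n
  proof (cases "n = 0")
    case True
    then show ?thesis using f[of 0 0] by simp
  next
    case False
    \<comment> \<open>Letting \<open>k\<close> grow in \<open>close2\<close> removes the second
      error term, which leaves a bound on \<open>f n - n * \<mu>\<close> that is uniform in
      \<open>n\<close>.\<close>
    have "\<bar>\<mu> - f n / real n\<bar> \<le> \<kappa> / real n + 0"
    proof (rule tendsto_le[OF sequentially_bot])
      show "(\<lambda>k. \<bar>f k / real k - f n / real n\<bar>) \<longlonglongrightarrow> \<bar>\<mu> - f n / real n\<bar>"
        by (intro tendsto_intros \<mu>)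
      show "(\<lambda>k. \<kappa> / real n + \<kappa> / real k) \<longlonglongrightarrow> \<kappa> / real n + 0"
        by (intro tendsto_intros lim_const_over_n)
      show "eventually (\<lambda>k. \<bar>f k / real k - f n / real n\<bar> \<le> \<kappa> / real n + \<kappa> / real k) sequentially"
        using eventually_gt_at_top[of 0] by eventually_elim (rule close2, use False in auto)
    qed
    moreover have "\<bar>f n - real n * \<mu>\<bar> = real n * \<bar>\<mu> - f n / real n\<bar>"
      using False by (simp add: abs_mult_pos'[symmetric] field_simps abs_minus_commute)
    ultimately show ?thesis using False by (simp add: field_simps)
  qed
  with \<mu> show ?thesis using that by blast
qed

text \<open>Exchange of the limits in \<open>n\<close> and in the block length \<open>L\<close>. The
  error \<open>E L n\<close> need not vanish for fixed \<open>L\<close>; only its limit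
  \<open>e L\<close> tends to zero. \<open>Lmin\<close> leaves out short blocks, whose variance may
  be zero.\<close>

lemma double_limit:
  fixes a :: "nat \<Rightarrow> 'x::metric_space"
  assumes d: "\<And>L n. L \<ge> Lmin \<Longrightarrow> dist (a n) (B L n) \<le> E L n"
    and E: "\<And>L. L \<ge> Lmin \<Longrightarrow> E L \<longlonglongrightarrow> e L" and e: "e \<longlonglongrightarrow> 0"
    and B: "\<And>L. L \<ge> Lmin \<Longrightarrow> B L \<longlonglongrightarrow> b L" and b: "b \<longlonglongrightarrow> b0"
  shows "a \<longlonglongrightarrow> b0"
proof (rule metric_LIMSEQ_I)
  fix r :: real assume r: "r > 0"
  have "eventually (\<lambda>L. e L < r/4 \<and> dist (b L) b0 < r/4 \<and> L \<ge> Lmin) sequentially"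
    using r order_tendstoD(2)[OF e, of "r/4"] tendstoD[OF b, of "r/4"]
    by (intro eventually_conj eventually_ge_at_top) auto
  then obtain L where L: "e L < r/4" "dist (b L) b0 < r/4" "L \<ge> Lmin"
    unfolding eventually_sequentially by blast
  have "eventually (\<lambda>n. E L n < r/4 \<and> dist (B L n) (b L) < r/4) sequentially"
    using r order_tendstoD(2)[OF E[OF L(3)] L(1)] tendstoD[OF B[OF L(3)], of "r/4"]
    by (intro eventually_conj) auto
  then have "eventually (\<lambda>n. dist (a n) b0 < r) sequentially"
  proof eventually_elim
    case (elim n)
    have "dist (a n) b0 \<le> dist (a n) (B L n) + dist (B L n) (b L) + dist (b L) b0"
      using dist_triangle[of "a n" b0 "B L n"] dist_triangle[of "B L n" b0 "b L"] by linarith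
    then show ?case using d[OF L(3), of n] elim L r by linarith
  qed
  then show "\<exists>no. \<forall>n\<ge>no. dist (a n) b0 < r" unfolding eventually_sequentially .
qed

lemma div_ratio_tendsto:
  fixes N :: "nat \<Rightarrow> nat"
  assumes N: "(\<lambda>n. real (N n) / real n) \<longlonglongrightarrow> c" and L: "L > 0"
  shows "(\<lambda>n. real (N n div L) / real n) \<longlonglongrightarrow> c / real L"
proof -
  have "(\<lambda>n. real (N n div L) / real n - (real (N n) / real n) / real L) \<longlonglongrightarrow> 0"
  proof (rule Lim_null_comparison)
    show "(\<lambda>n. 1 / real n) \<longlonglongrightarrow> 0" by (rule lim_const_over_n)
    show "eventually (\<lambda>n. norm (real (N n div L) / real n - (real (N n) / real n) / real L) \<le> 1 / real n) sequentially"
    proof (intro always_eventually allI)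
      fix n
      have "real (N n) = real (N n div L) * real L + real (N n mod L)"
        by (metis div_mult_mod_eq of_nat_add of_nat_mult)
      then have "real (N n div L) - real (N n) / real L = - (real (N n mod L) / real L)"
        using L by (simp add: field_simps)
      moreover have "real (N n mod L) / real L \<le> 1"
        using L mod_less_divisor[OF L, of "N n"] by simp
      ultimately have "\<bar>real (N n div L) - real (N n) / real L\<bar> \<le> 1" by simp
      moreover have "real (N n div L) / real n - (real (N n) / real n) / real L
          = (real (N n div L) - real (N n) / real L) / real n" by (simp add: diff_divide_distrib)
      ultimately show "norm (real (N n div L) / real n - (real (N n) / real n) / real L) \<le> 1 / real n"
        by (simp add: abs_divide divide_right_mono)
    qed
  qed
  from tendsto_add[OF this tendsto_divide[OF N tendsto_const[of "real L"]]] L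
  show ?thesis by simp
qed

lemma sum_lessThan_add:
  fixes k1 k2 :: nat
  shows "(\<Sum>i<k1 + k2. f i) = (\<Sum>i<k1. f i) + (\<Sum>i<k2. (f (k1 + i) :: real))"
  by (induction k2) (auto simp: add.assoc)

lemma div_self_ratio: "L > 0 \<Longrightarrow> (\<lambda>n. real (n div L) / real n) \<longlonglongrightarrow> 1 / real L"
proof (rule div_ratio_tendsto)
  have "eventually (\<lambda>n. real n / real n = 1) sequentially"
    using eventually_gt_at_top[of 0] by eventually_elim simp
  then show "(\<lambda>n. real n / real n) \<longlonglongrightarrow> 1" by (rule tendsto_eventually)
qed

lemma over_sqrt_tendsto_0: "(\<lambda>n. c / sqrt (real n)) \<longlonglongrightarrow> 0"
  by (rule tendsto_divide_0[OF tendsto_const filterlim_at_top_imp_at_infinity[OF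
      filterlim_compose[OF sqrt_at_top filterlim_real_sequentially]]])

text \<open>The induction step for the bound \<open>20 \<kappa> \<surd>k - 10 \<kappa>\<close> on the error of cutting into \<open>k\<close>
  blocks: splitting in halves gains a factor \<open>\<surd>2\<close> on the negative constant, which pays for the
  additional error \<open>\<kappa>\<close>.\<close>

lemma halving_step:
  fixes \<kappa> :: real and k k1 k2 :: nat
  assumes k: "k \<ge> 2" and k1: "k1 = k div 2" and k2: "k2 = k - k1" and \<kappa>: "\<kappa> \<ge> 0"
  shows "sqrt ((20 * \<kappa> * sqrt k1 - 10 * \<kappa>)\<^sup>2 + (20 * \<kappa> * sqrt k2 - 10 * \<kappa>)\<^sup>2) + \<kappa>
    \<le> 20 * \<kappa> * sqrt k - 10 * \<kappa>"
proof -
  define x y z where "x = sqrt k1" "y = sqrt k2" "z = sqrt k"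
  have sq: "x\<^sup>2 = real k1" "y\<^sup>2 = real k2" "z\<^sup>2 = real k" by (auto simp: x_y_z_def)
  have nn: "x \<ge> 0" "y \<ge> 0" "z \<ge> 1" using k by (auto simp: x_y_z_def)
  \<comment> \<open>The first bound is sharp at \<open>k = 3\<close>, where
    \<open>k1 = 1\<close>.\<close>
  have "k \<le> 3 * k1" "k \<le> 2 * k2" using k k1 k2 by auto
  then have "real k \<le> 3 * real k1" "real k \<le> 2 * real k2" by linarith+
  then have "real k * real k \<le> (3 * real k1) * (2 * real k2)" by (intro mult_mono) auto
  moreover have "(z\<^sup>2)\<^sup>2 = real k * real k" "(x * y)\<^sup>2 = real k1 * real k2"
    by (simp_all only: sq power_mult_distrib power2_eq_square[of "real k"])
  ultimately have "(x * y)\<^sup>2 \<ge> (z\<^sup>2)\<^sup>2 / 6" by linarith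
  moreover have "(2/5 * z\<^sup>2)\<^sup>2 = 4/25 * (z\<^sup>2)\<^sup>2" by (simp add: power_mult_distrib power_divide)
  ultimately have "(2/5 * z\<^sup>2)\<^sup>2 \<le> (x * y)\<^sup>2" using zero_le_power2[of "z\<^sup>2"] by linarith
  \<comment> \<open>2/5 is a rational number slightly below \<open>1 / sqrt 6\<close>.\<close>
  then have "x * y \<ge> 2/5 * z\<^sup>2" by (rule power2_le_imp_le) (simp add: nn)
  moreover have "x\<^sup>2 + y\<^sup>2 = z\<^sup>2" unfolding sq using k1 k2 k by simp
  moreover have "(x + y)\<^sup>2 = x\<^sup>2 + y\<^sup>2 + 2 * (x * y)" by (simp add: power2_sum)
  moreover have "(67/50 * z)\<^sup>2 = 4489/2500 * z\<^sup>2" by (simp add: power_mult_distrib power_divide)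
  ultimately have "(67/50 * z)\<^sup>2 \<le> (x + y)\<^sup>2" using zero_le_power2[of z] by linarith
  \<comment> \<open>67/50 is slightly below \<open>sqrt (9/5)\<close>, and
    \<open>9/5 = 1 + 2 * (2/5)\<close> is the lower bound for the square of \<open>x + y\<close>
    relative to that of \<open>z\<close>.\<close>
  then have xy: "67/50 * z \<le> x + y" by (rule power2_le_imp_le) (simp add: nn)
  \<comment> \<open>The claim divided by \<kappa>, with the additional error 1 moved to the right:
    \<open>20 * z - 10 - 1\<close>. The cross terms leave \<open>536 * z\<close> against
    \<open>440 * z\<close>, and the surplus \<open>96 * z\<close> covers the constant
    \<open>200 - 121 = 79\<close> because \<open>z \<ge> 1\<close>.\<close>
  have "(20 * x - 10)\<^sup>2 + (20 * y - 10)\<^sup>2 \<le> (20 * z - 11)\<^sup>2"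
  proof -
    have "(20 * x - 10)\<^sup>2 + (20 * y - 10)\<^sup>2 = 400 * (x\<^sup>2 + y\<^sup>2) - 400 * (x + y) + 200"
      by (simp add: power2_eq_square algebra_simps)
    also have "\<dots> \<le> 400 * z\<^sup>2 - 440 * z + 121"
      using xy nn \<open>x\<^sup>2 + y\<^sup>2 = z\<^sup>2\<close> by simp
    also have "\<dots> = (20 * z - 11)\<^sup>2" by (simp add: power2_eq_square algebra_simps)
    finally show ?thesis .
  qed
  then have "sqrt ((20 * x - 10)\<^sup>2 + (20 * y - 10)\<^sup>2) \<le> 20 * z - 11"
    by (rule real_le_lsqrt[rotated]) (use nn in simp_all)
  then have "\<kappa> * sqrt ((20 * x - 10)\<^sup>2 + (20 * y - 10)\<^sup>2) + \<kappa> \<le> \<kappa> * (20 * z - 11) + \<kappa>"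
    using \<kappa> by (simp add: mult_left_mono)
  also have "\<kappa> * sqrt ((20 * x - 10)\<^sup>2 + (20 * y - 10)\<^sup>2)
      = sqrt (\<kappa>\<^sup>2 * ((20 * x - 10)\<^sup>2 + (20 * y - 10)\<^sup>2))"
    using \<kappa> by (simp add: real_sqrt_mult)
  also have "\<kappa>\<^sup>2 * ((20 * x - 10)\<^sup>2 + (20 * y - 10)\<^sup>2) = (20 * \<kappa> * x - 10 * \<kappa>)\<^sup>2 + (20 * \<kappa> * y - 10 * \<kappa>)\<^sup>2"
    by (simp add: power2_eq_square algebra_simps)
  finally show ?thesis unfolding x_y_z_def by (simp add: algebra_simps)
qed

section \<open>Nearly additive arrays\<close>

text \<open>\<open>G a b\<close> stands for the information in the columns \<open>a\<close> to
  \<open>b - 1\<close>. \<open>C_tail\<close> is uniform in \<open>b\<close>, so that order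
  \<open>n\<close> many cut errors stay below \<open>\<epsilon> * sqrt n\<close> simultaneously with
  high probability. \<open>var_lower\<close> starts at 2 because in the application a single column
  has passage time zero.\<close>

locale nearly_additive = prob_space M for M :: "'a measure" +
  fixes G :: "nat \<Rightarrow> nat \<Rightarrow> 'a measure" and T :: "nat \<Rightarrow> nat \<Rightarrow> 'a \<Rightarrow> real"
    and C :: "nat \<Rightarrow> 'a \<Rightarrow> real" and \<kappa> \<delta> :: real
  assumes subalg: "\<And>a b. subalgebra M (G a b)"
    and G_mono: "\<And>a b a' b'. a' \<le> a \<Longrightarrow> b \<le> b' \<Longrightarrow> sets (G a b) \<subseteq> sets (G a' b')"
    and G_indep: "\<And>n. mono n \<Longrightarrow> indep_sets (\<lambda>l. sets (G (n l) (n (Suc l)))) UNIV"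
    and T_meas: "\<And>a b. T a b \<in> borel_measurable (G a b)"
    and T_square: "\<And>a b. integrable M (\<lambda>x. (T a b x)\<^sup>2)"
    and T_stationary: "\<And>a b. a \<le> b \<Longrightarrow> distr M borel (T a b) = distr M borel (T 0 (b - a))"
    and near: "\<And>a b c x. a \<le> b \<Longrightarrow> b \<le> c \<Longrightarrow> x \<in> space M \<Longrightarrow> \<bar>T a c x - T a b x - T b c x\<bar> \<le> C b x"
    and L2_C: "\<And>b. L2 (C b)"
    and C_norm: "\<And>b. l2norm (C b) \<le> \<kappa>"
    and C_tail: "\<And>\<epsilon>. \<epsilon> > 0 \<Longrightarrow> \<exists>\<tau>. (\<lambda>n. real n * \<tau> n) \<longlonglongrightarrow> 0 \<and>
       (\<forall>n b. prob {x \<in> space M. C b x > \<epsilon> * sqrt (real n)} \<le> \<tau> n)"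
    and \<delta>_pos: "\<delta> > 0"
    and var_lower: "\<And>n. n \<ge> 2 \<Longrightarrow> \<delta> * real n \<le> variance (T 0 n)"
begin

lemma G_measurable_M: "X \<in> borel_measurable (G a b) \<Longrightarrow> X \<in> borel_measurable M"
  using measurable_from_subalg[OF subalg] .

lemma G_measurable_mono:
  assumes "X \<in> borel_measurable (G a b)" "a' \<le> a" "b \<le> b'"
  shows "X \<in> borel_measurable (G a' b')"
proof -
  have "subalgebra (G a' b') (G a b)"
    using G_mono[OF assms(2,3)] subalg unfolding subalgebra_def by auto
  then show ?thesis using assms(1) measurable_from_subalg by blast
qed

lemma T_measM [measurable]: "T a b \<in> borel_measurable M"
  using T_meas G_measurable_M by blast

lemma C_measM [measurable]: "C b \<in> borel_measurable M"
  using L2_C by (rule L2_measurable)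

lemma L2_T: "L2 (T a b)"
  using T_square by (simp add: L2_def)

lemma C_nonneg: "x \<in> space M \<Longrightarrow> 0 \<le> C b x"
  using near[of b b b x] by linarith

lemma \<kappa>_nonneg: "\<kappa> \<ge> 0"
  using C_norm[of 0] l2norm_nonneg[of "C 0"] by linarith

lemma l2norm_le_\<kappa>:
  assumes "X \<in> borel_measurable M" "\<And>x. x \<in> space M \<Longrightarrow> \<bar>X x\<bar> \<le> C b x"
  shows "l2norm X \<le> \<kappa>" "L2 X"
proof -
  have *: "\<bar>X x\<bar> \<le> \<bar>C b x\<bar>" if "x \<in> space M" for x
    using assms(2)[OF that] C_nonneg[OF that, of b] by simp
  show "l2norm X \<le> \<kappa>" using l2norm_mono[OF assms(1) L2_C *] C_norm[of b] by linarith
  show "L2 X" by (rule L2_bound[OF assms(1) L2_C *])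
qed

lemma indep_blocks:
  fixes X :: "nat \<Rightarrow> 'a \<Rightarrow> real"
  assumes "mono n" "\<And>l. X l \<in> borel_measurable (G (n l) (n (Suc l)))"
  shows "indep_vars (\<lambda>_. borel) X UNIV"
  unfolding indep_vars_def2
proof (intro conjI ballI)
  show "X i \<in> borel_measurable M" for i using assms(2) by (rule G_measurable_M)
  show "indep_sets (\<lambda>i. {X i -` A \<inter> space M |A. A \<in> sets borel}) UNIV"
  proof (rule indep_sets_mono_sets[OF G_indep[OF assms(1)]])
    fix l :: nat
    have "space (G (n l) (n (Suc l))) = space M" using subalg by (simp add: subalgebra_def)
    then show "{X l -` A \<inter> space M |A. A \<in> sets borel} \<subseteq> sets (G (n l) (n (Suc l)))"
      using measurable_sets[OF assms(2)[of l]] by auto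
  qed
qed

lemma indep_two_blocks:
  fixes X Y :: "'a \<Rightarrow> real"
  assumes "a \<le> b" "b \<le> c" "X \<in> borel_measurable (G a b)" "Y \<in> borel_measurable (G b c)"
  shows "indep_var borel X borel Y"
proof -
  \<comment> \<open>The sequence stays at \<open>c\<close> after the second block, and the further
    blocks carry the constant 0.\<close>
  define n where "n l = (if l = 0 then a else if l = 1 then b else c)" for l :: nat
  define Z where "Z l = (if l = 0 then X else if l = 1 then Y else (\<lambda>_. 0))" for l :: nat
  have "mono n" using assms(1,2) by (auto simp: mono_def n_def)
  moreover have "Z l \<in> borel_measurable (G (n l) (n (Suc l)))" for l
    using assms(3,4) by (auto simp: Z_def n_def)
  ultimately have "indep_vars (\<lambda>_. borel) Z UNIV" by (rule indep_blocks)
  then have "indep_vars (\<lambda>_. borel) Z (insert 0 {1})" by (rule indep_vars_subset) auto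
  from indep_vars_sum[OF _ _ this] show ?thesis by (simp add: Z_def)
qed

section \<open>Mean and standard deviation of a block\<close>

definition m :: "nat \<Rightarrow> real" where "m n = expectation (T 0 n)"
definition s :: "nat \<Rightarrow> real" where "s n = sd (T 0 n)"

lemma expectation_T: "a \<le> b \<Longrightarrow> expectation (T a b) = m (b - a)"
  and sd_T: "a \<le> b \<Longrightarrow> sd (T a b) = s (b - a)"
  unfolding m_def s_def
  by (intro sd_distr T_stationary T_measM; simp)+

lemma m_quasi_additive: "\<bar>m (a + b) - m a - m b\<bar> \<le> \<kappa>"
proof -
  let ?X = "\<lambda>x. T 0 (a + b) x - T 0 a x - T a (a + b) x"
  have "\<bar>expectation ?X\<bar> \<le> l2norm ?X"
    by (intro abs_expectation_le_l2norm L2_diff L2_T)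
  also have "\<dots> \<le> \<kappa>" by (rule l2norm_le_\<kappa>[where b=a]) (auto intro: near)
  also have "expectation ?X = m (a + b) - m a - m b"
    using expectation_T[of 0 "a+b"] expectation_T[of 0 a] expectation_T[of a "a+b"]
    by (simp add: L2_integrable L2_T)
  finally show ?thesis .
qed

definition \<mu> :: real where "\<mu> = lim (\<lambda>n. m n / real n)"

lemma mean_limit: "(\<lambda>n. m n / real n) \<longlonglongrightarrow> \<mu>"
  and mean_error: "\<bar>m n - real n * \<mu>\<bar> \<le> \<kappa>"
proof -
  obtain u where u: "(\<lambda>n. m n / real n) \<longlonglongrightarrow> u" "\<And>n. \<bar>m n - real n * u\<bar> \<le> \<kappa>"
    using quasi_additive[of m \<kappa>] m_quasi_additive by blast
  then have "\<mu> = u" unfolding \<mu>_def by (simp add: limI)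
  then show "(\<lambda>n. m n / real n) \<longlonglongrightarrow> \<mu>" "\<bar>m n - real n * \<mu>\<bar> \<le> \<kappa>" using u by auto
qed

section \<open>The error of cutting into blocks\<close>

definition D :: "nat \<Rightarrow> nat \<Rightarrow> nat \<Rightarrow> 'a \<Rightarrow> real" where
  "D a L k x = T a (a + k * L) x - (\<Sum>i<k. T (a + i * L) (a + Suc i * L) x)"

lemma D_measurable: "D a L k \<in> borel_measurable (G a (a + k * L))"
proof -
  have "T (a + i * L) (a + Suc i * L) \<in> borel_measurable (G a (a + k * L))" if "i < k" for i
  proof (rule G_measurable_mono[OF T_meas])
    have "Suc i * L \<le> k * L" using that by (intro mult_le_mono) auto
    then show "a + Suc i * L \<le> a + k * L" by simp
  qed auto
  then show ?thesis
    unfolding D_def[abs_def] by (intro borel_measurable_diff borel_measurable_sum T_meas) auto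
qed

lemma L2_D: "L2 (D a L k)"
  unfolding D_def[abs_def] by (intro L2_diff L2_sum L2_T)

lemma D_split:
  "D a L (k1 + k2) x = D a L k1 x + D (a + k1 * L) L k2 x +
    (T a (a + (k1 + k2) * L) x - T a (a + k1 * L) x - T (a + k1 * L) (a + (k1 + k2) * L) x)"
  unfolding D_def sum_lessThan_add by (simp add: algebra_simps)

text \<open>Standard deviations instead of norms: the means of the cut errors may add up linearly in
  \<open>k\<close>, whereas the centred errors of the two halves are independent and add in squares.
  Only the error of the middle cut is added by the triangle inequality. The case
  \<open>k = 0\<close> is excluded as the bound would be negative.\<close>

lemma sd_D_pos: "k \<ge> 1 \<Longrightarrow> sd (D a L k) \<le> 20 * \<kappa> * sqrt k - 10 * \<kappa>"
proof (induction k arbitrary: a rule: less_induct)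
  case (less k)
  show ?case
  proof (cases "k = 1")
    case True
    have "D a L 1 = (\<lambda>x. 0)" by (auto simp: D_def)
    then show ?thesis using True \<kappa>_nonneg by (simp add: sd_def)
  next
    case False
    define k1 k2 where "k1 = k div 2" "k2 = k - k1"
    have k: "k \<ge> 2" "k = k1 + k2" "k1 < k" "k2 < k" "k1 \<ge> 1" "k2 \<ge> 1"
      using less.prems False by (auto simp: k1_k2_def)
    let ?X = "D a L k1" and ?Y = "D (a + k1 * L) L k2"
    let ?e = "\<lambda>x. T a (a + (k1 + k2) * L) x - T a (a + k1 * L) x - T (a + k1 * L) (a + (k1 + k2) * L) x"
    have near': "\<bar>?e x\<bar> \<le> C (a + k1 * L) x" if "x \<in> space M" for x
      using that by (intro near) (simp_all add: add_mult_distrib)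
    have e: "l2norm ?e \<le> \<kappa>" "L2 ?e"
      by (rule l2norm_le_\<kappa>[OF _ near']; measurable)+
    have sde: "sd (\<lambda>x. ?X x + ?Y x + ?e x) \<le> sd (\<lambda>x. ?X x + ?Y x) + sd ?e"
      by (intro sd_add L2_add L2_D e)
    have eq: "(\<lambda>x. ?X x + ?Y x + ?e x) = D a L k"
      unfolding k(2) by (rule ext, rule D_split[symmetric])
    have e\<kappa>: "sd ?e \<le> \<kappa>" using sd_le_l2norm[OF e(2)] e(1) by linarith
    have sdXY: "sd (\<lambda>x. ?X x + ?Y x) \<le> sqrt ((20 * \<kappa> * sqrt k1 - 10 * \<kappa>)\<^sup>2 + (20 * \<kappa> * sqrt k2 - 10 * \<kappa>)\<^sup>2)"
    proof (rule real_le_rsqrt)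
      have "?Y \<in> borel_measurable (G (a + k1 * L) (a + k * L))"
        using D_measurable[of "a + k1 * L" L k2] unfolding k(2) by (simp add: add_mult_distrib add.assoc)
      moreover have "k1 * L \<le> k * L" using k(3) by (intro mult_le_mono1) simp
      ultimately have "indep_var borel ?X borel ?Y"
        by (intro indep_two_blocks[OF _ _ D_measurable]) simp_all
      then have "(sd (\<lambda>x. ?X x + ?Y x))\<^sup>2 = (sd ?X)\<^sup>2 + (sd ?Y)\<^sup>2"
        by (intro indep_var_covariance L2_D)
      also have "\<dots> \<le> (20 * \<kappa> * sqrt k1 - 10 * \<kappa>)\<^sup>2 + (20 * \<kappa> * sqrt k2 - 10 * \<kappa>)\<^sup>2"
        by (intro add_mono power_mono sd_nonneg less.IH k)
      finally show "(sd (\<lambda>x. ?X x + ?Y x))\<^sup>2 \<le> (20 * \<kappa> * sqrt k1 - 10 * \<kappa>)\<^sup>2 + (20 * \<kappa> * sqrt k2 - 10 * \<kappa>)\<^sup>2" .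
    qed
    have "sqrt ((20 * \<kappa> * sqrt k1 - 10 * \<kappa>)\<^sup>2 + (20 * \<kappa> * sqrt k2 - 10 * \<kappa>)\<^sup>2) + \<kappa>
        \<le> 20 * \<kappa> * sqrt k - 10 * \<kappa>"
      by (rule halving_step[OF k(1) k1_k2_def \<kappa>_nonneg])
    with sdXY e\<kappa> sde show ?thesis unfolding eq by linarith
  qed
qed

lemma sd_D: "sd (D a L k) \<le> 20 * \<kappa> * sqrt k + \<kappa>"
proof (cases "k = 0")
  case True
  have "sd (D a L 0) \<le> l2norm (D a L 0)" by (rule sd_le_l2norm[OF L2_D])
  also have "\<dots> \<le> \<kappa>"
  proof (rule l2norm_le_\<kappa>)
    show "D a L 0 \<in> borel_measurable M" using L2_D by (rule L2_measurable)
    show "\<bar>D a L 0 x\<bar> \<le> C a x" if "x \<in> space M" for x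
      \<comment> \<open>With three equal columns near additivity reads
        \<open>\<bar>T a a x\<bar> \<le> C a x\<close>.\<close>
      using near[of a a a x] that by (simp add: D_def)
  qed
  finally show ?thesis using True by simp
next
  case False
  then show ?thesis using sd_D_pos[of k a L] \<kappa>_nonneg by simp
qed

definition blocks :: "nat \<Rightarrow> nat \<Rightarrow> 'a \<Rightarrow> real" where
  "blocks L k x = (\<Sum>i<k. T (i * L) (Suc i * L) x)"

text \<open>Everything in the block error that does not grow with \<open>n\<close>. The sum
  dominates the standard deviation of the incomplete last block, whatever its length; one \<kappa>
  is for cutting it off, the other comes from \<open>sd_D\<close>.\<close>

definition R :: "nat \<Rightarrow> real" where "R L = (\<Sum>r<L. s r) + 2 * \<kappa>"

lemma L2_blocks: "L2 (blocks L k)"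
  unfolding blocks_def[abs_def] by (intro L2_sum L2_T)

lemma sd_blocks_error:
  assumes "L > 0"
  shows "sd (\<lambda>x. T 0 n x - blocks L (n div L) x) \<le> 20 * \<kappa> * sqrt (real (n div L)) + R L"
proof -
  let ?k = "n div L"
  have le: "?k * L \<le> n" by (simp add: div_times_less_eq_dividend)
  let ?e = "\<lambda>x. T 0 n x - T 0 (?k * L) x - T (?k * L) n x"
  have near': "\<bar>?e x\<bar> \<le> C (?k * L) x" if "x \<in> space M" for x
    using that le by (intro near) simp_all
  have e: "l2norm ?e \<le> \<kappa>" "L2 ?e"
    by (rule l2norm_le_\<kappa>[OF _ near']; measurable)+
  have "sd (\<lambda>x. D 0 L ?k x + T (?k * L) n x + ?e x) \<le> sd (D 0 L ?k) + sd (T (?k * L) n) + sd ?e"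
    using sd_add[OF L2_add[OF L2_D L2_T] e(2), of 0 L ?k "?k * L" n]
      sd_add[OF L2_D L2_T, of 0 L ?k "?k * L" n] by linarith
  also have "(\<lambda>x. D 0 L ?k x + T (?k * L) n x + ?e x) = (\<lambda>x. T 0 n x - blocks L ?k x)"
    by (auto simp: D_def blocks_def)
  also have "sd ?e \<le> \<kappa>" using sd_le_l2norm[OF e(2)] e(1) by linarith
  also have "sd (D 0 L ?k) \<le> 20 * \<kappa> * sqrt ?k + \<kappa>" by (rule sd_D)
  also have "sd (T (?k * L) n) \<le> (\<Sum>r<L. s r)"
  proof -
    have "n - ?k * L < L" using assms by (simp add: minus_div_mult_eq_mod)
    then have "s (n - ?k * L) \<le> (\<Sum>r<L. s r)"
      by (intro member_le_sum) (auto simp: s_def sd_nonneg)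
    then show ?thesis using sd_T[OF le] by simp
  qed
  finally show ?thesis by (simp add: R_def)
qed

lemma blocks_indep: "indep_vars (\<lambda>_. borel) (\<lambda>i. T (i * L) (Suc i * L)) UNIV"
  by (rule indep_blocks[where n="\<lambda>i. i * L"]) (auto simp: mono_def T_meas intro: mult_le_mono1)

lemma sd_blocks: "sd (blocks L k) = sqrt k * s L"
proof -
  have "(sd (blocks L k))\<^sup>2 = (\<Sum>i<k. (sd (T (i * L) (Suc i * L)))\<^sup>2)"
    unfolding blocks_def[abs_def]
    by (intro indep_vars_sd_sum L2_T indep_vars_subset[OF blocks_indep]) auto
  also have "\<dots> = (sqrt k * s L)\<^sup>2"
    by (simp add: sd_T power_mult_distrib)
  finally show ?thesis
    by (rule power2_eq_imp_eq) (auto simp: s_def sd_nonneg)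
qed

lemma s_error:
  assumes "L > 0"
  shows "\<bar>s n - sqrt (real (n div L)) * s L\<bar> \<le> 20 * \<kappa> * sqrt (real (n div L)) + R L"
  using sd_diff[OF L2_T L2_blocks, of 0 n L "n div L"] sd_blocks_error[OF assms, of n]
  by (simp add: s_def[symmetric] sd_blocks)

lemma s_ratio_error:
  assumes "L > 0"
  shows "\<bar>s n / sqrt n - sqrt (real (n div L) / real n) * s L\<bar> \<le> 20 * \<kappa> * sqrt (real (n div L) / real n) + R L / sqrt n"
proof -
  have "s n / sqrt n - sqrt (real (n div L) / real n) * s L = (s n - sqrt (real (n div L)) * s L) / sqrt n"
    by (simp add: real_sqrt_divide diff_divide_distrib)
  also have "\<bar>\<dots>\<bar> \<le> (20 * \<kappa> * sqrt (real (n div L)) + R L) / sqrt n"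
    unfolding abs_divide using s_error[OF assms, of n] by (simp add: divide_right_mono)
  finally show ?thesis by (simp add: real_sqrt_divide add_divide_distrib)
qed

section \<open>Limit of the normalised standard deviation\<close>

definition \<sigma> :: real where "\<sigma> = lim (\<lambda>n. s n / sqrt n)"

text \<open>For fixed \<open>L\<close> and growing \<open>n\<close> the ratio
  \<open>s n / sqrt n\<close> ends up within about \<open>20 * \<kappa> / sqrt L\<close> of
  \<open>s L / sqrt L\<close>. Since this width is arbitrarily small for large \<open>L\<close>, the
  sequence is Cauchy.\<close>

lemma sd_limit: "(\<lambda>n. s n / sqrt n) \<longlonglongrightarrow> \<sigma>"
proof -
  have ev: "eventually (\<lambda>n. \<bar>s n / sqrt n - s L / sqrt L\<bar> < r + 20 * \<kappa> / sqrt L) sequentially"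
    if L: "L > 0" and r: "r > 0" for L r
  proof -
    have 1: "(\<lambda>n. sqrt (real (n div L) / real n)) \<longlonglongrightarrow> 1 / sqrt L"
      using tendsto_real_sqrt[OF div_self_ratio[OF L]] by (simp add: real_sqrt_divide)
    have "(\<lambda>n. 20 * \<kappa> * sqrt (real (n div L) / real n) + R L / sqrt n + \<bar>sqrt (real (n div L) / real n) * s L - s L / sqrt L\<bar>)
      \<longlonglongrightarrow> 20 * \<kappa> * (1 / sqrt L) + 0 + \<bar>(1 / sqrt L) * s L - s L / sqrt L\<bar>"
      by (intro tendsto_intros 1 over_sqrt_tendsto_0)
    then have "eventually (\<lambda>n. 20 * \<kappa> * sqrt (real (n div L) / real n) + R L / sqrt n
        + \<bar>sqrt (real (n div L) / real n) * s L - s L / sqrt L\<bar> < r + 20 * \<kappa> / sqrt L) sequentially"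
      by (rule order_tendstoD(2)) (use r in simp)
    then show ?thesis
    proof eventually_elim
      case (elim n)
      then show ?case using s_ratio_error[OF L, of n] by linarith
    qed
  qed
  have "Cauchy (\<lambda>n. s n / sqrt n)"
  proof (rule metric_CauchyI)
    fix e :: real assume e: "e > 0"
    have "eventually (\<lambda>L. 20 * \<kappa> / sqrt (real L) < e / 4 \<and> L > 0) sequentially"
      using e by (intro eventually_conj order_tendstoD(2)[OF over_sqrt_tendsto_0] eventually_gt_at_top) auto
    then obtain L where L: "20 * \<kappa> / sqrt (real L) < e / 4" "L > 0"
      unfolding eventually_sequentially by blast
    obtain N where N: "\<And>n. n \<ge> N \<Longrightarrow> \<bar>s n / sqrt n - s L / sqrt L\<bar> < e / 4 + 20 * \<kappa> / sqrt L"
      using ev[OF L(2), of "e/4"] e unfolding eventually_sequentially by auto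
    have "dist (s k / sqrt k) (s n / sqrt n) < e" if "k \<ge> N" "n \<ge> N" for k n
      using N[OF that(1)] N[OF that(2)] L(1) by (simp add: dist_real_def)
    then show "\<exists>N. \<forall>k\<ge>N. \<forall>n\<ge>N. dist (s k / sqrt k) (s n / sqrt n) < e" by blast
  qed
  then show ?thesis
    unfolding \<sigma>_def using real_Cauchy_convergent convergent_LIMSEQ_iff by blast
qed

lemma variance_limit: "(\<lambda>n. variance (T 0 n) / real n) \<longlonglongrightarrow> \<sigma>\<^sup>2"
  using tendsto_power[OF sd_limit, of 2] by (simp add: power_divide s_def sd_sq)

lemma \<sigma>_pos: "\<sigma> > 0"
proof -
  have "\<delta> \<le> \<sigma>\<^sup>2"
  proof (rule tendsto_lowerbound[OF variance_limit])
    show "eventually (\<lambda>n. \<delta> \<le> variance (T 0 n) / real n) sequentially"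
      using eventually_ge_at_top[of 2] by eventually_elim (use var_lower in \<open>simp add: pos_le_divide_eq\<close>)
  qed auto
  moreover have "\<sigma> \<ge> 0"
    by (rule tendsto_lowerbound[OF sd_limit]) (auto simp: s_def sd_nonneg)
  ultimately show ?thesis using \<delta>_pos by (cases "\<sigma> = 0") auto
qed

lemma s_pos: "n \<ge> 2 \<Longrightarrow> s n > 0"
proof -
  assume n: "n \<ge> 2"
  have "0 < \<delta> * real n" using n \<delta>_pos by simp
  also have "\<dots> \<le> variance (T 0 n)" by (rule var_lower[OF n])
  finally show ?thesis by (simp add: s_def sd_def)
qed

end

section \<open>Central limit theorem\<close>

text \<open>The centred normal law of variance \<open>v\<close>, as a push-forward: its
  characteristic function and its moments reduce to the standard ones by substitution.\<close>

definition gaussian :: "real \<Rightarrow> real measure" where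
  "gaussian v = distr std_normal_distribution borel (\<lambda>x. sqrt v * x)"

lemma real_distribution_gaussian: "real_distribution (gaussian v)"
  unfolding gaussian_def
  by (intro prob_space.real_distribution_distr real_distribution.axioms(1)[OF real_dist_normal_dist]) auto

lemma char_gaussian: "v \<ge> 0 \<Longrightarrow> char (gaussian v) t = complex_of_real (exp (- (t\<^sup>2 * v / 2)))"
proof -
  assume v: "v \<ge> 0"
  have "char (gaussian v) t = (CLINT x|std_normal_distribution. iexp (t * (sqrt v * x)))"
    unfolding gaussian_def char_def by (rule integral_distr) measurable
  also have "\<dots> = char std_normal_distribution (t * sqrt v)"
    unfolding char_def by (simp only: mult.assoc)
  finally show ?thesis using v by (simp add: char_std_normal_distribution power_mult_distrib)
qed

context nearly_additive
begin

definition centred_blocks :: "nat \<Rightarrow> nat \<Rightarrow> 'a \<Rightarrow> real" where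
  "centred_blocks L k x = (\<Sum>i<k. T (i * L) (Suc i * L) x - m L)"

lemma L2_centred_blocks: "L2 (centred_blocks L k)"
  unfolding centred_blocks_def[abs_def] by (intro L2_sum L2_diff L2_T L2_const)

lemma centred_blocks_eq: "centred_blocks L k x = blocks L k x - real k * m L"
  by (simp add: centred_blocks_def blocks_def sum_subtractf)

lemma expectation_block: "expectation (T (i * L) (Suc i * L)) = m L"
  using expectation_T[of "i * L" "Suc i * L"] by simp

lemma expectation_blocks: "expectation (blocks L k) = real k * m L"
  unfolding blocks_def[abs_def]
  by (subst Bochner_Integration.integral_sum) (auto simp: L2_integrable L2_T expectation_block[simplified])

lemma l2norm_centred_blocks: "l2norm (centred_blocks L k) = sqrt (real k) * s L"
proof -
  have "centred_blocks L k = (\<lambda>x. blocks L k x - expectation (blocks L k))"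
    by (auto simp: centred_blocks_eq expectation_blocks)
  then show ?thesis using sd_blocks[of L k] by (simp add: sd_eq_l2norm)
qed

text \<open>The centred difference is covered by \<open>sd_blocks_error\<close>. Centring
  \<open>T 0 n\<close> at \<open>n * \<mu>\<close> instead of its mean costs
  \<open>mean_error\<close>, the additional \<kappa>.\<close>

lemma l2norm_T_blocks:
  assumes "L > 0"
  shows "l2norm (\<lambda>x. (T 0 n x - real n * \<mu>) - centred_blocks L (n div L) x)
    \<le> 20 * \<kappa> * sqrt (real (n div L)) + R L + \<kappa>"
proof -
  let ?X = "\<lambda>x. T 0 n x - blocks L (n div L) x"
  let ?c = "m n - real n * \<mu>"
  have E: "expectation ?X = m n - real (n div L) * m L"
    by (simp add: L2_integrable L2_T L2_blocks expectation_blocks m_def)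
  have eq: "(\<lambda>x. (T 0 n x - real n * \<mu>) - centred_blocks L (n div L) x) = (\<lambda>x. (?X x - expectation ?X) + ?c)"
    unfolding E centred_blocks_eq by (auto simp: algebra_simps)
  have "l2norm (\<lambda>x. (?X x - expectation ?X) + ?c) \<le> l2norm (\<lambda>x. ?X x - expectation ?X) + l2norm (\<lambda>x. ?c)"
    by (intro l2norm_triangle L2_diff L2_T L2_blocks L2_const)
  moreover have "l2norm (\<lambda>x. ?X x - expectation ?X) = sd ?X" by (rule sd_eq_l2norm[symmetric])
  moreover have "l2norm (\<lambda>x. ?c) = \<bar>?c\<bar>" by (simp add: l2norm_def prob_space)
  ultimately show ?thesis
    unfolding eq using sd_blocks_error[OF assms, of n] mean_error[of n] by linarith
qed

text \<open>The central limit theorem for the independent blocks normalises by the number of blocks,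
  whereas \<open>sqrt n\<close> is needed here. The ratio of the two normalisations is deterministic
  and convergent, so it can be moved into the frequency of the characteristic function.\<close>

lemma clt_blocks:
  assumes L: "L \<ge> 2" and N: "(\<lambda>n. real (N n) / real n) \<longlonglongrightarrow> c" and c: "c > 0"
  shows "(\<lambda>n. CLINT x|M. iexp (t * (centred_blocks L (N n div L) x / sqrt (real n))))
    \<longlonglongrightarrow> complex_of_real (exp (- (t\<^sup>2 * (c * (s L / sqrt (real L))\<^sup>2) / 2)))"
proof -
  define k where "k n = N n div L" for n
  let ?Z = "\<lambda>k x. centred_blocks L k x / sqrt (real k * (s L)\<^sup>2)"
  let ?u = "t * sqrt (c / L) * s L"
  \<comment> \<open>The frequency \<open>?t n\<close> tends to \<open>?u\<close>. Replacing one by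
    the other changes the characteristic function by at most \<open>\<bar>?t n - ?u\<bar>\<close>,
    since the normalised sum has norm at most 1.\<close>
  let ?t = "\<lambda>n. t * (sqrt (real (k n) / real n) * s L)"
  have L0: "L > 0" using L by simp
  have sL: "s L > 0" using s_pos[OF L] .
  have kn: "(\<lambda>n. real (k n) / real n) \<longlonglongrightarrow> c / real L"
    unfolding k_def by (rule div_ratio_tendsto[OF N L0])
  have kinf: "filterlim k at_top sequentially"
  proof -
    have "filterlim (\<lambda>n. real (k n) / real n * real n) at_top sequentially"
      by (rule filterlim_tendsto_pos_mult_at_top[OF kn _ filterlim_real_sequentially]) (use c L0 in simp)
    moreover have "eventually (\<lambda>n. real (k n) / real n * real n = real (k n)) sequentially"
      using eventually_gt_at_top[of 0] by eventually_elim simp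
    ultimately have "filterlim (\<lambda>n. real (k n)) at_top sequentially"
      by (rule filterlim_cong[OF refl refl, THEN iffD1, rotated])
    then have "eventually (\<lambda>n. real Z \<le> real (k n)) sequentially" for Z
      unfolding filterlim_at_top by (rule spec)
    then show ?thesis unfolding filterlim_at_top of_nat_le_iff by blast
  qed
  have clt: "weak_conv_m (\<lambda>k. distr M borel (?Z k)) std_normal_distribution"
    unfolding centred_blocks_def
  proof (rule central_limit_theorem)
    show "indep_vars (\<lambda>i. borel) (\<lambda>i. T (i * L) (Suc i * L)) UNIV" by (rule blocks_indep)
    show "expectation (T (n * L) (Suc n * L)) = m L" for n by (rule expectation_block)
    show "variance (T (n * L) (Suc n * L)) = (s L)\<^sup>2" for n
      using sd_T[of "n * L" "Suc n * L"] sd_sq[of "T (n * L) (Suc n * L)"] by simp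
    show "distr M borel (T (n * L) (Suc n * L)) = distr M borel (T 0 L)" for n
      using T_stationary[of "n * L" "Suc n * L"] by simp
  qed (use sL T_square in auto)
  have Zm [measurable]: "?Z k \<in> borel_measurable M" for k
    using L2_measurable[OF L2_centred_blocks, of L k] by measurable
  have L2Z: "L2 (\<lambda>x. a * ?Z k x)" for a k
  proof -
    have "(\<lambda>x. a * ?Z k x) = (\<lambda>x. (a / sqrt (real k * (s L)\<^sup>2)) * centred_blocks L k x)" by auto
    then show ?thesis using L2_cmult[OF L2_centred_blocks] by presburger
  qed
  have char_eq: "char (distr M borel X) v = (CLINT x|M. iexp (v * X x))" if [measurable]: "X \<in> borel_measurable M" for X v
    unfolding char_def by (rule integral_distr[OF that]) measurable
  have A: "(\<lambda>n. CLINT x|M. iexp (?u * ?Z (k n) x)) \<longlonglongrightarrow> complex_of_real (exp (- (?u\<^sup>2) / 2))"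
  proof -
    have "(\<lambda>n. char (distr M borel (?Z n)) ?u) \<longlonglongrightarrow> char std_normal_distribution ?u"
      by (rule levy_continuity1[OF _ real_dist_normal_dist clt])
        (auto intro!: real_distribution_distr)
    then have "(\<lambda>n. char (distr M borel (?Z (k n))) ?u) \<longlonglongrightarrow> char std_normal_distribution ?u"
      by (rule filterlim_compose[OF _ kinf])
    then show ?thesis by (simp add: char_eq char_std_normal_distribution)
  qed
  have tt: "?t \<longlonglongrightarrow> ?u"
    using tendsto_mult[OF tendsto_const[of t] tendsto_mult[OF tendsto_real_sqrt[OF kn] tendsto_const[of "s L"]]]
    by (simp add: mult.assoc)
  have diff: "norm ((CLINT x|M. iexp (?t n * ?Z (k n) x)) - (CLINT x|M. iexp (?u * ?Z (k n) x))) \<le> \<bar>?t n - ?u\<bar>" for n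
  proof -
    have "norm ((CLINT x|M. iexp (1 * (?t n * ?Z (k n) x))) - (CLINT x|M. iexp (1 * (?u * ?Z (k n) x))))
        \<le> \<bar>1\<bar> * l2norm (\<lambda>x. ?t n * ?Z (k n) x - ?u * ?Z (k n) x)"
      by (intro iexp_expectation_diff L2Z)
    also have "(\<lambda>x. ?t n * ?Z (k n) x - ?u * ?Z (k n) x)
        = (\<lambda>x. ((?t n - ?u) / sqrt (real (k n) * (s L)\<^sup>2)) * centred_blocks L (k n) x)"
      by (auto simp: left_diff_distrib diff_divide_distrib)
    also have "l2norm \<dots> = \<bar>(?t n - ?u) / sqrt (real (k n) * (s L)\<^sup>2)\<bar> * (sqrt (real (k n)) * s L)"
      unfolding l2norm_cmult l2norm_centred_blocks by simp
    also have "\<dots> \<le> \<bar>?t n - ?u\<bar>"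
      using sL by (simp add: real_sqrt_mult abs_divide)
    finally show ?thesis by simp
  qed
  have B: "(\<lambda>n. CLINT x|M. iexp (?t n * ?Z (k n) x)) \<longlonglongrightarrow> complex_of_real (exp (- (?u\<^sup>2) / 2))"
  proof -
    have "(\<lambda>n. (CLINT x|M. iexp (?t n * ?Z (k n) x)) - (CLINT x|M. iexp (?u * ?Z (k n) x))) \<longlonglongrightarrow> 0"
    proof (rule Lim_null_comparison[OF always_eventually])
      show "\<forall>n. norm ((CLINT x|M. iexp (?t n * ?Z (k n) x)) - (CLINT x|M. iexp (?u * ?Z (k n) x))) \<le> \<bar>?t n - ?u\<bar>"
        using diff by blast
      show "(\<lambda>n. \<bar>?t n - ?u\<bar>) \<longlonglongrightarrow> 0"
        by (rule tendsto_rabs_zero) (rule LIM_zero[OF tt])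
    qed
    from tendsto_add[OF this A] show ?thesis by simp
  qed
  have "?t n * ?Z (k n) x = t * (centred_blocks L (k n) x / sqrt (real n))" for n x
  \<comment> \<open>There may be no complete block for small \<open>n\<close>; both sides are then
    zero.\<close>
  proof (cases "k n = 0")
    case True
    then show ?thesis by (simp add: centred_blocks_def)
  next
    case False
    then show ?thesis using sL by (simp add: real_sqrt_mult real_sqrt_divide)
  qed
  moreover have "?u\<^sup>2 = t\<^sup>2 * (c * (s L / sqrt (real L))\<^sup>2)"
    using c L0 by (simp add: power_mult_distrib power_divide)
  ultimately show ?thesis using B by (simp add: k_def)
qed

text \<open>The characteristic function of the block sum differs from that of \<open>T\<close> by an
  error whose limit in \<open>n\<close> is
  \<open>20 * \<bar>t\<bar> * \<kappa> * sqrt (c / L)\<close>. It vanishes as \<open>L\<close>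
  grows, while the block variances per unit length tend to the square of \<sigma>. The scale is
  \<open>sqrt n\<close> and not \<open>sqrt (N n)\<close>, so that increments over different mesh
  intervals share it.\<close>

lemma clt:
  assumes N: "(\<lambda>n. real (N n) / real n) \<longlonglongrightarrow> c" and c: "c > 0"
  shows "(\<lambda>n. CLINT x|M. iexp (t * ((T 0 (N n) x - real (N n) * \<mu>) / sqrt (real n))))
    \<longlonglongrightarrow> complex_of_real (exp (- (t\<^sup>2 * (c * \<sigma>\<^sup>2) / 2)))"
proof (rule double_limit[where Lmin=2])
  fix L n :: nat assume L: "L \<ge> 2"
  let ?k = "N n div L"
  let ?E = "\<lambda>L n. \<bar>t\<bar> * (20 * \<kappa> * sqrt (real (N n div L) / real n) + (R L + \<kappa>) / sqrt (real n))"
  have l2: "L2 (\<lambda>x. (T 0 (N n) x - real (N n) * \<mu>) / sqrt (real n))"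
    using L2_cmult[OF L2_diff[OF L2_T L2_const], of "1 / sqrt (real n)" 0 "N n" "real (N n) * \<mu>"] by simp
  have l2': "L2 (\<lambda>x. centred_blocks L ?k x / sqrt (real n))"
    using L2_cmult[OF L2_centred_blocks, of "1 / sqrt (real n)" L ?k] by simp
  have "norm ((CLINT x|M. iexp (t * ((T 0 (N n) x - real (N n) * \<mu>) / sqrt (real n))))
      - (CLINT x|M. iexp (t * (centred_blocks L ?k x / sqrt (real n)))))
    \<le> \<bar>t\<bar> * l2norm (\<lambda>x. (T 0 (N n) x - real (N n) * \<mu>) / sqrt (real n) - centred_blocks L ?k x / sqrt (real n))"
    by (rule iexp_expectation_diff[OF l2 l2'])
  also have "(\<lambda>x. (T 0 (N n) x - real (N n) * \<mu>) / sqrt (real n) - centred_blocks L ?k x / sqrt (real n))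
     = (\<lambda>x. (1 / sqrt (real n)) * ((T 0 (N n) x - real (N n) * \<mu>) - centred_blocks L ?k x))"
    by (simp add: diff_divide_distrib)
  also have "l2norm \<dots> = 1 / sqrt (real n) * l2norm (\<lambda>x. (T 0 (N n) x - real (N n) * \<mu>) - centred_blocks L ?k x)"
    unfolding l2norm_cmult by simp
  also have "\<dots> \<le> 1 / sqrt (real n) * (20 * \<kappa> * sqrt (real ?k) + R L + \<kappa>)"
    using L by (intro mult_left_mono l2norm_T_blocks) auto
  also have "\<dots> = 20 * \<kappa> * sqrt (real ?k / real n) + (R L + \<kappa>) / sqrt (real n)"
    by (simp add: real_sqrt_divide add_divide_distrib)
  finally show "dist (CLINT x|M. iexp (t * ((T 0 (N n) x - real (N n) * \<mu>) / sqrt (real n))))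
      (CLINT x|M. iexp (t * (centred_blocks L ?k x / sqrt (real n)))) \<le> ?E L n"
    by (simp add: dist_norm mult_left_mono)
next
  fix L :: nat assume L: "L \<ge> 2"
  then have L0: "L > 0" by simp
  show "(\<lambda>n. \<bar>t\<bar> * (20 * \<kappa> * sqrt (real (N n div L) / real n) + (R L + \<kappa>) / sqrt (real n)))
      \<longlonglongrightarrow> \<bar>t\<bar> * (20 * \<kappa> * sqrt (c / real L) + 0)"
    by (intro tendsto_intros over_sqrt_tendsto_0 div_ratio_tendsto[OF N L0])
  show "(\<lambda>n. CLINT x|M. iexp (t * (centred_blocks L (N n div L) x / sqrt (real n))))
      \<longlonglongrightarrow> complex_of_real (exp (- (t\<^sup>2 * (c * (s L / sqrt (real L))\<^sup>2) / 2)))"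
    by (rule clt_blocks[OF L N c])
next
  have "(\<lambda>L. \<bar>t\<bar> * (20 * \<kappa> * sqrt (c / real L) + 0)) \<longlonglongrightarrow> \<bar>t\<bar> * (20 * \<kappa> * sqrt 0 + 0)"
    by (intro tendsto_intros lim_const_over_n)
  then show "(\<lambda>L. \<bar>t\<bar> * (20 * \<kappa> * sqrt (c / real L) + 0)) \<longlonglongrightarrow> 0" by simp
  show "(\<lambda>L. complex_of_real (exp (- (t\<^sup>2 * (c * (s L / sqrt (real L))\<^sup>2) / 2))))
      \<longlonglongrightarrow> complex_of_real (exp (- (t\<^sup>2 * (c * \<sigma>\<^sup>2) / 2)))"
    by (intro tendsto_intros sd_limit) auto
qed

lemma clt_weak_conv:
  assumes N: "(\<lambda>n. real (N n) / real n) \<longlonglongrightarrow> c" and c: "c > 0"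
  shows "weak_conv_m (\<lambda>n. distr M borel (\<lambda>x. (T 0 (N n) x - real (N n) * \<mu>) / (\<sigma> * sqrt (real n)))) (gaussian c)"
proof (rule levy_continuity[OF _ real_distribution_gaussian])
  show "real_distribution (distr M borel (\<lambda>x. (T 0 (N n) x - real (N n) * \<mu>) / (\<sigma> * sqrt (real n))))" for n
    by (intro real_distribution_distr) measurable
  fix t
  have "char (distr M borel (\<lambda>x. (T 0 (N n) x - real (N n) * \<mu>) / (\<sigma> * sqrt (real n)))) t
      = (CLINT x|M. iexp ((t / \<sigma>) * ((T 0 (N n) x - real (N n) * \<mu>) / sqrt (real n))))" for n
    unfolding char_def by (subst integral_distr) simp_all
  moreover have "(t / \<sigma>)\<^sup>2 * (c * \<sigma>\<^sup>2) / 2 = t\<^sup>2 * c / 2"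
    using \<sigma>_pos by (simp add: power_divide)
  ultimately show "(\<lambda>n. char (distr M borel (\<lambda>x. (T 0 (N n) x - real (N n) * \<mu>) / (\<sigma> * sqrt (real n)))) t)
      \<longlonglongrightarrow> char (gaussian c) t"
    using clt[OF N c, of "t / \<sigma>"] c by (simp only: char_gaussian less_imp_le)
qed

end

section \<open>Joint convergence of independent components\<close>

text \<open>Independent variables may be realised on separate spaces: applying a map in each
  coordinate of a product measure produces the product of the image laws. Checked on boxes.\<close>

lemma distr_PiM_components:
  assumes I: "finite I" and \<Omega>: "\<And>i. prob_space (\<Omega> i)"
    and f [measurable]: "\<And>i. f i \<in> \<Omega> i \<rightarrow>\<^sub>M (borel :: real measure)"
  shows "distr (PiM I \<Omega>) (PiM I (\<lambda>_. borel)) (\<lambda>w. \<lambda>i\<in>I. f i (w i)) = PiM I (\<lambda>i. distr (\<Omega> i) borel (f i))"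
proof -
  interpret \<Omega>: product_prob_space \<Omega> by (intro product_prob_spaceI \<Omega>)
  interpret N: product_prob_space "\<lambda>i. distr (\<Omega> i) borel (f i)"
    by (intro product_prob_spaceI prob_space.prob_space_distr \<Omega> f)
  show ?thesis
  proof (rule N.PiM_eqI[OF I])
    show "sets (distr (PiM I \<Omega>) (PiM I (\<lambda>_. borel)) (\<lambda>w. \<lambda>i\<in>I. f i (w i)))
        = sets (PiM I (\<lambda>i. distr (\<Omega> i) borel (f i)))"
      unfolding sets_distr by (rule sets_PiM_cong) auto
    fix A assume A: "\<And>i. i \<in> I \<Longrightarrow> A i \<in> sets (distr (\<Omega> i) borel (f i))"
    then have A': "A i \<in> sets borel" if "i \<in> I" for i using that by simp
    have m: "(\<lambda>w. \<lambda>i\<in>I. f i (w i)) \<in> PiM I \<Omega> \<rightarrow>\<^sub>M PiM I (\<lambda>_. borel)"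
      by measurable
    have "emeasure (distr (PiM I \<Omega>) (PiM I (\<lambda>_. borel)) (\<lambda>w. \<lambda>i\<in>I. f i (w i))) (Pi\<^sub>E I A)
        = emeasure (PiM I \<Omega>) ((\<lambda>w. \<lambda>i\<in>I. f i (w i)) -` Pi\<^sub>E I A \<inter> space (PiM I \<Omega>))"
      by (rule emeasure_distr[OF m]) (intro sets_PiM_I_finite I A')
    also have "(\<lambda>w. \<lambda>i\<in>I. f i (w i)) -` Pi\<^sub>E I A \<inter> space (PiM I \<Omega>)
        = Pi\<^sub>E I (\<lambda>i. f i -` A i \<inter> space (\<Omega> i))"
      by (auto simp: space_PiM PiE_iff)
    also have "emeasure (PiM I \<Omega>) \<dots> = (\<Prod>i\<in>I. emeasure (\<Omega> i) (f i -` A i \<inter> space (\<Omega> i)))"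
      by (rule \<Omega>.emeasure_PiM[OF I]) (rule measurable_sets[OF f A'])
    also have "\<dots> = (\<Prod>i\<in>I. emeasure (distr (\<Omega> i) borel (f i)) (A i))"
      by (rule prod.cong[OF refl], rule emeasure_distr[symmetric, OF f A'])
    finally show "emeasure (distr (PiM I \<Omega>) (PiM I (\<lambda>_. borel)) (\<lambda>w. \<lambda>i\<in>I. f i (w i))) (Pi\<^sub>E I A)
        = (\<Prod>i\<in>I. emeasure (distr (\<Omega> i) borel (f i)) (A i))" .
  qed
qed

text \<open>Skorohod's theorem gives each coordinate its own space with pointwise convergent copies.
  Independence makes the product of these spaces carry the right joint law for every
  \<open>n\<close> and for the limit, so dominated convergence applies there.\<close>

lemma joint_convergence:
  fixes U :: "nat \<Rightarrow> nat \<Rightarrow> 'a \<Rightarrow> real" and V :: "nat \<Rightarrow> 'b \<Rightarrow> real" and \<psi> :: "(nat \<Rightarrow> real) \<Rightarrow> real"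
  assumes M: "prob_space M" and N: "prob_space N" and r: "r > 0"
    and U: "\<And>n l. U n l \<in> borel_measurable M" and V: "\<And>l. V l \<in> borel_measurable N"
    and indU: "\<And>n. prob_space.indep_vars M (\<lambda>_. borel) (U n) {..<r}"
    and indV: "prob_space.indep_vars N (\<lambda>_. borel) V {..<r}"
    and conv: "\<And>l. l < r \<Longrightarrow> weak_conv_m (\<lambda>n. distr M borel (U n l)) (distr N borel (V l))"
    and \<psi>m: "\<psi> \<in> borel_measurable borel"
    and lip: "\<And>u u'. \<bar>\<psi> u - \<psi> u'\<bar> \<le> L * (\<Sum>l<r. \<bar>u l - u' l\<bar>)" and bd: "\<And>u. \<bar>\<psi> u\<bar> \<le> b"
  shows "(\<lambda>n. \<integral>\<xi>. \<psi> (\<lambda>l. U n l \<xi>) \<partial>M) \<longlonglongrightarrow> (\<integral>\<zeta>. \<psi> (\<lambda>l. V l \<zeta>) \<partial>N)"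
proof -
  interpret M: prob_space M by (rule M)
  interpret N: prob_space N by (rule N)
  let ?J = "{..<r}"
  have J: "?J \<noteq> {}" using r by auto
  \<comment> \<open>A version of \<psi> on the product over \<open>{..<r}\<close>, where a point is
    \<open>undefined\<close> outside the index set; the cut-off at \<open>r\<close> removes these
    values.\<close>
  define \<psi>' where "\<psi>' u = \<psi> (\<lambda>l. if l < r then u l else 0)" for u
  have \<psi>': "\<psi> u = \<psi>' u'" if "\<And>l. l < r \<Longrightarrow> u l = u' l" for u u'
    using lip[of u "\<lambda>l. if l < r then u' l else 0"] that by (simp add: \<psi>'_def)
  have \<psi>'m: "\<psi>' \<in> borel_measurable (PiM ?J (\<lambda>_. borel))"
    unfolding \<psi>'_def
  proof (rule measurable_compose[OF measurable_coordinatewise_then_product \<psi>m])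
    show "(\<lambda>u. if i < r then u i else 0) \<in> borel_measurable (PiM ?J (\<lambda>_. borel :: real measure))" for i
      by (cases "i < r") (auto intro: measurable_component_singleton)
  qed
  \<comment> \<open>The index is clamped so that Skorohod's theorem supplies a probability space for
    every natural number, as a product family requires.\<close>
  define l' where "l' l = (if l < r then l else 0)" for l
  have "\<exists>(\<Omega> :: real measure) (Ys :: nat \<Rightarrow> real \<Rightarrow> real) (Y :: real \<Rightarrow> real).
      prob_space \<Omega> \<and> (\<forall>n. Ys n \<in> measurable \<Omega> borel) \<and> (\<forall>n. distr \<Omega> borel (Ys n) = distr M borel (U n (l' l))) \<and>
      Y \<in> measurable \<Omega> lborel \<and> distr \<Omega> borel Y = distr N borel (V (l' l)) \<and>
      (\<forall>x \<in> space \<Omega>. (\<lambda>n. Ys n x) \<longlonglongrightarrow> Y x)" for l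
    by (rule Skorohod) (auto intro!: M.real_distribution_distr N.real_distribution_distr U V conv simp: l'_def r)
  then obtain \<Omega> :: "nat \<Rightarrow> real measure" and Ys Y where S: "\<And>l. prob_space (\<Omega> l)"
    "\<And>l n. Ys l n \<in> borel_measurable (\<Omega> l)" "\<And>l n. distr (\<Omega> l) borel (Ys l n) = distr M borel (U n (l' l))"
    "\<And>l. Y l \<in> borel_measurable (\<Omega> l)" "\<And>l. distr (\<Omega> l) borel (Y l) = distr N borel (V (l' l))"
    "\<And>l x. x \<in> space (\<Omega> l) \<Longrightarrow> (\<lambda>n. Ys l n x) \<longlonglongrightarrow> Y l x"
    unfolding measurable_lborel1 by metis
  interpret \<Omega>: product_prob_space \<Omega> by (intro product_prob_spaceI S)
  have comp: "(\<lambda>w. X (w l)) \<in> borel_measurable (PiM ?J \<Omega>)"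
    if "l \<in> ?J" "X \<in> borel_measurable (\<Omega> l)" for l and X :: "real \<Rightarrow> real"
    using measurable_compose[OF measurable_component_singleton[OF that(1), of \<Omega>] that(2)] .
  have trans: "(\<integral>\<xi>. \<psi> (\<lambda>l. Z l \<xi>) \<partial>K) = (\<integral>w. \<psi> (\<lambda>l. if l < r then X l (w l) else 0) \<partial>PiM ?J \<Omega>)"
    if K: "prob_space K" and Z: "\<And>l. Z l \<in> borel_measurable K" and X: "\<And>l. X l \<in> borel_measurable (\<Omega> l)"
      and ind: "prob_space.indep_vars K (\<lambda>_. borel) Z ?J"
      and eq: "\<And>l. l < r \<Longrightarrow> distr (\<Omega> l) borel (X l) = distr K borel (Z l)"
    for K :: "'z measure" and Z :: "nat \<Rightarrow> 'z \<Rightarrow> real" and X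
  proof -
    have m: "(\<lambda>\<xi>. \<lambda>l\<in>?J. Z l \<xi>) \<in> K \<rightarrow>\<^sub>M PiM ?J (\<lambda>_. borel)" by (intro measurable_restrict Z)
    have m': "(\<lambda>w. \<lambda>l\<in>?J. X l (w l)) \<in> PiM ?J \<Omega> \<rightarrow>\<^sub>M PiM ?J (\<lambda>_. borel)"
      by (intro measurable_restrict comp X)
    have "(\<integral>\<xi>. \<psi> (\<lambda>l. Z l \<xi>) \<partial>K) = (\<integral>\<xi>. \<psi>' (\<lambda>l\<in>?J. Z l \<xi>) \<partial>K)"
      by (intro Bochner_Integration.integral_cong refl \<psi>') simp
    also have "\<dots> = (\<integral>u. \<psi>' u \<partial>distr K (PiM ?J (\<lambda>_. borel)) (\<lambda>\<xi>. \<lambda>l\<in>?J. Z l \<xi>))"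
      by (rule integral_distr[symmetric, OF m \<psi>'m])
    also have "distr K (PiM ?J (\<lambda>_. borel)) (\<lambda>\<xi>. \<lambda>l\<in>?J. Z l \<xi>) = PiM ?J (\<lambda>l. distr K borel (Z l))"
      using prob_space.indep_vars_iff_distr_eq_PiM[OF K J Z] ind by simp
    also have "\<dots> = PiM ?J (\<lambda>l. distr (\<Omega> l) borel (X l))"
      by (rule PiM_cong) (simp_all add: eq)
    also have "\<dots> = distr (PiM ?J \<Omega>) (PiM ?J (\<lambda>_. borel)) (\<lambda>w. \<lambda>l\<in>?J. X l (w l))"
      by (rule distr_PiM_components[symmetric]) (use S X in auto)
    also have "(\<integral>u. \<psi>' u \<partial>\<dots>) = (\<integral>w. \<psi>' (\<lambda>l\<in>?J. X l (w l)) \<partial>PiM ?J \<Omega>)"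
      by (rule integral_distr[OF m' \<psi>'m])
    also have "\<dots> = (\<integral>w. \<psi> (\<lambda>l. if l < r then X l (w l) else 0) \<partial>PiM ?J \<Omega>)"
      by (intro Bochner_Integration.integral_cong refl \<psi>'[symmetric]) simp
    finally show ?thesis .
  qed
  have U': "(\<integral>\<xi>. \<psi> (\<lambda>l. U n l \<xi>) \<partial>M) = (\<integral>w. \<psi> (\<lambda>l. if l < r then Ys l n (w l) else 0) \<partial>PiM ?J \<Omega>)" for n
    by (rule trans[OF M U S(2) indU]) (simp add: S l'_def)
  have V': "(\<integral>\<zeta>. \<psi> (\<lambda>l. V l \<zeta>) \<partial>N) = (\<integral>w. \<psi> (\<lambda>l. if l < r then Y l (w l) else 0) \<partial>PiM ?J \<Omega>)"
    by (rule trans[OF N V S(4) indV]) (simp add: S l'_def)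
  have Xm: "(\<lambda>w. \<psi> (\<lambda>l. if l < r then X l (w l) else 0)) \<in> borel_measurable (PiM ?J \<Omega>)"
    if X: "\<And>l. X l \<in> borel_measurable (\<Omega> l)" for X
  proof (rule measurable_compose[OF measurable_coordinatewise_then_product \<psi>m])
    show "(\<lambda>w. if i < r then X i (w i) else 0) \<in> borel_measurable (PiM ?J \<Omega>)" for i
      by (cases "i < r") (auto intro: comp X)
  qed
  interpret P: prob_space "PiM ?J \<Omega>" by (rule prob_space_PiM) (rule S)
  show ?thesis
    unfolding U' V'
  proof (rule integral_dominated_convergence[where w="\<lambda>_. b"])
    show "AE w in PiM ?J \<Omega>. (\<lambda>n. \<psi> (\<lambda>l. if l < r then Ys l n (w l) else 0))
        \<longlonglongrightarrow> \<psi> (\<lambda>l. if l < r then Y l (w l) else 0)"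
    proof (rule AE_I2)
      fix w assume w: "w \<in> space (PiM ?J \<Omega>)"
      have c: "(\<lambda>n. Ys l n (w l)) \<longlonglongrightarrow> Y l (w l)" if "l < r" for l
        using w that by (intro S(6)) (auto simp: space_PiM PiE_iff)
      have "(\<lambda>n. \<psi> (\<lambda>l. if l < r then Ys l n (w l) else 0) - \<psi> (\<lambda>l. if l < r then Y l (w l) else 0)) \<longlonglongrightarrow> 0"
      proof (rule Lim_null_comparison[OF always_eventually])
        show "\<forall>n. norm (\<psi> (\<lambda>l. if l < r then Ys l n (w l) else 0) - \<psi> (\<lambda>l. if l < r then Y l (w l) else 0))
            \<le> L * (\<Sum>l<r. \<bar>Ys l n (w l) - Y l (w l)\<bar>)"
          using lip[of "\<lambda>l. if l < r then Ys l _ (w l) else 0" "\<lambda>l. if l < r then Y l (w l) else 0"] by simp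
        have "(\<lambda>n. L * (\<Sum>l<r. \<bar>Ys l n (w l) - Y l (w l)\<bar>)) \<longlonglongrightarrow> L * (\<Sum>l<r. \<bar>Y l (w l) - Y l (w l)\<bar>)"
          by (intro tendsto_intros c) auto
        then show "(\<lambda>n. L * (\<Sum>l<r. \<bar>Ys l n (w l) - Y l (w l)\<bar>)) \<longlonglongrightarrow> 0" by simp
      qed
      then show "(\<lambda>n. \<psi> (\<lambda>l. if l < r then Ys l n (w l) else 0)) \<longlonglongrightarrow> \<psi> (\<lambda>l. if l < r then Y l (w l) else 0)"
        by (rule LIM_zero_cancel)
    qed
  qed (use bd S Xm in \<open>auto intro: P.integrable_const\<close>)
qed

section \<open>Maximal inequality\<close>

context nearly_additive
begin

definition cT :: "nat \<Rightarrow> nat \<Rightarrow> 'a \<Rightarrow> real" where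
  "cT a j x = T a (a + j) x - real j * \<mu>"

lemma cT_measurable: "cT a j \<in> borel_measurable (G a (a + j))"
  unfolding cT_def[abs_def] by (intro borel_measurable_diff borel_measurable_const T_meas)

lemma cT_measM [measurable]: "cT a j \<in> borel_measurable M"
  by (rule G_measurable_M[OF cT_measurable])

lemma L2_cT: "L2 (cT a j)"
  unfolding cT_def[abs_def] by (intro L2_diff L2_T L2_const)

lemma cT_near:
  assumes "j \<le> N" "x \<in> space M"
  shows "\<bar>cT a N x - cT a j x - cT (a + j) (N - j) x\<bar> \<le> C (a + j) x"
proof -
  have "\<bar>T a (a + N) x - T a (a + j) x - T (a + j) (a + N) x\<bar> \<le> C (a + j) x"
    by (rule near) (use assms in auto)
  moreover have "real N * \<mu> = real j * \<mu> + real (N - j) * \<mu>"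
    using assms(1) by (simp add: of_nat_diff algebra_simps)
  ultimately show ?thesis using assms(1) by (simp add: cT_def)
qed

text \<open>Let \<open>j\<close> be the first index where the threshold \<open>3 * r\<close> is
  exceeded. The remainder from column \<open>a + j\<close> on is independent of this event and at
  most \<open>r\<close> with probability at least 1/2. One \<open>r\<close> is lost to the remainder
  and one to the cut error at \<open>a + j\<close>, so the endpoint still exceeds \<open>r\<close>.
  Without exact additivity the cut errors have to be paid for, hence the second sum.\<close>

lemma maximal_inequality:
  assumes half: "\<And>j. j \<le> N \<Longrightarrow> prob {x \<in> space M. \<bar>cT (a + j) (N - j) x\<bar> > r} \<le> 1/2"
  shows "prob {x \<in> space M. \<exists>j\<le>N. \<bar>cT a j x\<bar> > 3 * r}
    \<le> 2 * (prob {x \<in> space M. \<bar>cT a N x\<bar> > r} + (\<Sum>j\<le>N. prob {x \<in> space M. C (a + j) x > r}))"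
proof -
  \<comment> \<open>First exceedance at \<open>j\<close>. These events are disjoint, and each
    depends on the columns before \<open>a + j\<close> only.\<close>
  define A where "A j = {x \<in> space M. \<bar>cT a j x\<bar> > 3 * r \<and> (\<forall>i<j. \<bar>cT a i x\<bar> \<le> 3 * r)}" for j
  let ?B = "{x \<in> space M. \<bar>cT a N x\<bar> > r}"
  have spG: "space (G c d) = space M" for c d using subalg by (simp add: subalgebra_def)
  have AG: "A j \<in> sets (G a (a + j))" for j
  proof -
    have [measurable]: "cT a i \<in> borel_measurable (G a (a + j))" if "i \<le> j" for i
      by (rule G_measurable_mono[OF cT_measurable]) (use that in auto)
    have "{x \<in> space (G a (a + j)). \<bar>cT a j x\<bar> > 3 * r} \<in> sets (G a (a + j))" by measurable
    moreover have "{x \<in> space (G a (a + j)). \<forall>i\<in>{..<j}. \<bar>cT a i x\<bar> \<le> 3 * r} \<in> sets (G a (a + j))"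
      by (rule sets.sets_Collect_finite_All) measurable
    ultimately have "{x \<in> space (G a (a + j)). \<bar>cT a j x\<bar> > 3 * r} \<inter>
      {x \<in> space (G a (a + j)). \<forall>i\<in>{..<j}. \<bar>cT a i x\<bar> \<le> 3 * r} \<in> sets (G a (a + j))" by (rule sets.Int)
    moreover have "{x \<in> space (G a (a + j)). \<bar>cT a j x\<bar> > 3 * r} \<inter>
      {x \<in> space (G a (a + j)). \<forall>i\<in>{..<j}. \<bar>cT a i x\<bar> \<le> 3 * r} = A j"
      by (auto simp: A_def spG)
    ultimately show ?thesis by simp
  qed
  have AM [measurable]: "A j \<in> sets M" for j using AG subalg unfolding subalgebra_def by blast
  have disj: "disjoint_family_on A {..N}"
  proof -
    have "A i \<inter> A j = {}" if "i < j" for i j using that unfolding A_def by fastforce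
    then show ?thesis unfolding disjoint_family_on_def by (metis inf_commute linorder_neqE_nat)
  qed
  have un: "{x \<in> space M. \<exists>j\<le>N. \<bar>cT a j x\<bar> > 3 * r} = (\<Union>j\<le>N. A j)"
  proof (intro set_eqI iffI)
    fix x assume "x \<in> {x \<in> space M. \<exists>j\<le>N. \<bar>cT a j x\<bar> > 3 * r}"
    then obtain j where j: "x \<in> space M" "j \<le> N" "\<bar>cT a j x\<bar> > 3 * r" by blast
    define i where "i = (LEAST i. \<bar>cT a i x\<bar> > 3 * r)"
    have "\<bar>cT a i x\<bar> > 3 * r" "i \<le> j" unfolding i_def using j(3) by (rule LeastI, intro Least_le j(3))
    moreover have "\<forall>k<i. \<bar>cT a k x\<bar> \<le> 3 * r" unfolding i_def using not_less_Least not_less by blast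
    ultimately have "x \<in> A i" "i \<le> N" using j by (auto simp: A_def)
    then show "x \<in> (\<Union>j\<le>N. A j)" by blast
  qed (auto simp: A_def)
  have ineq: "prob (A j) / 2 \<le> prob (A j \<inter> ?B) + prob {x \<in> space M. C (a + j) x > r}" if j: "j \<le> N" for j
  proof -
    let ?Q = "{x \<in> space M. \<bar>cT (a + j) (N - j) x\<bar> \<le> r}"
    have "prob ?Q = 1 - prob {x \<in> space M. \<bar>cT (a + j) (N - j) x\<bar> > r}"
    proof -
      have "?Q = space M - {x \<in> space M. \<bar>cT (a + j) (N - j) x\<bar> > r}" by auto
      moreover have "{x \<in> space M. \<bar>cT (a + j) (N - j) x\<bar> > r} \<in> events" by measurable
      ultimately show ?thesis using prob_compl by metis
    qed
    then have Q: "prob ?Q \<ge> 1/2" using half[OF j] by linarith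
    \<comment> \<open>Independence is available for real random variables, so the event
      \<open>A j\<close> enters through its indicator.\<close>
    have ind: "indep_var borel (indicator (A j) :: 'a \<Rightarrow> real) borel (cT (a + j) (N - j))"
      by (rule indep_two_blocks[where a=a and b="a + j" and c="a + j + (N - j)"])
        (use AG in \<open>auto intro: cT_measurable\<close>)
    have "prob ((\<lambda>x. (indicator (A j) x :: real, cT (a + j) (N - j) x)) -` ({1} \<times> {-r..r}) \<inter> space M)
        = prob ((indicator (A j) :: 'a \<Rightarrow> real) -` {1} \<inter> space M) * prob (cT (a + j) (N - j) -` {-r..r} \<inter> space M)"
      by (rule indep_varD[OF ind]) auto
    moreover have "(\<lambda>x. (indicator (A j) x :: real, cT (a + j) (N - j) x)) -` ({1} \<times> {-r..r}) \<inter> space M = A j \<inter> ?Q"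
      by (auto simp: indicator_def A_def split: if_splits)
    moreover have "(indicator (A j) :: 'a \<Rightarrow> real) -` {1} \<inter> space M = A j"
      by (auto simp: indicator_def A_def split: if_splits)
    moreover have "cT (a + j) (N - j) -` {-r..r} \<inter> space M = ?Q" by auto
    ultimately have "prob (A j) * prob ?Q = prob (A j \<inter> ?Q)" by simp
    moreover have "prob (A j) * (1/2) \<le> prob (A j) * prob ?Q"
      using Q by (intro mult_left_mono) auto
    moreover have "prob (A j \<inter> ?Q) \<le> prob ((A j \<inter> ?B) \<union> {x \<in> space M. C (a + j) x > r})"
    proof (rule finite_measure_mono)
      show "A j \<inter> ?Q \<subseteq> (A j \<inter> ?B) \<union> {x \<in> space M. C (a + j) x > r}"
      proof
        fix x assume x: "x \<in> A j \<inter> ?Q"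
        then have "x \<in> space M" "\<bar>cT a j x\<bar> > 3 * r" "\<bar>cT (a + j) (N - j) x\<bar> \<le> r" by (auto simp: A_def)
        then show "x \<in> (A j \<inter> ?B) \<union> {x \<in> space M. C (a + j) x > r}"
          using cT_near[OF j, of x a] x by (cases "C (a + j) x > r") auto
      qed
    qed measurable
    moreover have "\<dots> \<le> prob (A j \<inter> ?B) + prob {x \<in> space M. C (a + j) x > r}"
      by (rule measure_Un_le) measurable
    ultimately show ?thesis by linarith
  qed
  have "prob {x \<in> space M. \<exists>j\<le>N. \<bar>cT a j x\<bar> > 3 * r} = (\<Sum>j\<le>N. prob (A j))"
    unfolding un by (rule finite_measure_finite_Union) (use disj AM in auto)
  also have "\<dots> = 2 * (\<Sum>j\<le>N. prob (A j) / 2)" by (simp add: sum_distrib_left)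
  also have "\<dots> \<le> 2 * (\<Sum>j\<le>N. prob (A j \<inter> ?B) + prob {x \<in> space M. C (a + j) x > r})"
    using ineq by (intro mult_left_mono sum_mono) auto
  also have "\<dots> = 2 * ((\<Sum>j\<le>N. prob (A j \<inter> ?B)) + (\<Sum>j\<le>N. prob {x \<in> space M. C (a + j) x > r}))"
    by (simp add: sum.distrib)
  also have "(\<Sum>j\<le>N. prob (A j \<inter> ?B)) = prob (\<Union>j\<le>N. A j \<inter> ?B)"
  proof (rule finite_measure_finite_Union[symmetric])
    show "disjoint_family_on (\<lambda>j. A j \<inter> ?B) {..N}"
      using disj unfolding disjoint_family_on_def by blast
  qed auto
  also have "\<dots> \<le> prob ?B" by (rule finite_measure_mono) auto
  finally show ?thesis by simp
qed

end

section \<open>The invariance principle\<close>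

lemma gaussian_fourth_moment:
  assumes "v \<ge> 0"
  shows "integrable (gaussian v) (\<lambda>x. x ^ 4)" "(\<integral>x. x ^ 4 \<partial>gaussian v) = 3 * v\<^sup>2"
proof -
  have int: "integrable std_normal_distribution (\<lambda>x. x ^ 4)"
    by (rule integrable_std_normal_distribution_moment)
  have mom: "(\<integral>x. x ^ 4 \<partial>std_normal_distribution) = 3"
    using std_normal_distribution_even_moments(1)[of 2] by (simp add: fact_numeral)
  have eq: "(sqrt v * x) ^ 4 = v\<^sup>2 * x ^ 4" for x
  proof -
    have "sqrt v ^ 4 = ((sqrt v)\<^sup>2)\<^sup>2" by (simp flip: power_mult)
    then show ?thesis using assms by (simp add: power_mult_distrib)
  qed
  have m: "(\<lambda>x. sqrt v * x) \<in> std_normal_distribution \<rightarrow>\<^sub>M borel" by measurable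
  have p: "(\<lambda>x::real. x ^ 4) \<in> borel_measurable borel" by measurable
  show "integrable (gaussian v) (\<lambda>x. x ^ 4)"
    unfolding gaussian_def integrable_distr_eq[OF m p] eq using int by (rule integrable_mult_right)
  show "(\<integral>x. x ^ 4 \<partial>gaussian v) = 3 * v\<^sup>2"
    unfolding gaussian_def integral_distr[OF m p] eq using mom by simp
qed

text \<open>The polygon with mesh width \<open>1 / K\<close> and increments \<open>u l\<close>.
  Freezing it after \<open>r\<close> steps makes it a function of finitely many increments, to which
  \<open>joint_convergence\<close> applies.\<close>

definition poly_path :: "nat \<Rightarrow> nat \<Rightarrow> (nat \<Rightarrow> real) \<Rightarrow> real \<Rightarrow> real" where
  "poly_path K r u = lin_path (real K) (\<lambda>i. \<Sum>l<min i r. u l)"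

lemma poly_path_lipschitz: "ucc_dist (poly_path K r u) (poly_path K r u') \<le> (\<Sum>l<r. \<bar>u l - u' l\<bar>)"
  unfolding poly_path_def
proof (rule lin_path_close)
  fix i
  have "\<bar>(\<Sum>l<min i r. u l) - (\<Sum>l<min i r. u' l)\<bar> = \<bar>\<Sum>l<min i r. u l - u' l\<bar>"
    by (simp add: sum_subtractf)
  also have "\<dots> \<le> (\<Sum>l<min i r. \<bar>u l - u' l\<bar>)" by (rule sum_abs)
  also have "\<dots> \<le> (\<Sum>l<r. \<bar>u l - u' l\<bar>)" by (rule sum_mono2) auto
  finally show "\<bar>(\<Sum>l<min i r. u l) - (\<Sum>l<min i r. u' l)\<bar> \<le> (\<Sum>l<r. \<bar>u l - u' l\<bar>)" .
qed

lemma poly_path_in_C: "poly_path K r u \<in> C_half_line"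
  unfolding poly_path_def by (rule lin_path_in_C) simp

lemma poly_path_measurable:
  assumes "\<And>l. (\<lambda>x. u x l) \<in> borel_measurable M"
  shows "(\<lambda>x. poly_path K r (u x)) \<in> measurable M (borel_of_topology ucc_topology)"
  unfolding poly_path_def
  by (rule lin_path_measurable) (auto intro!: borel_measurable_sum assms)

context nearly_additive
begin

section \<open>Oscillation over one mesh interval\<close>

lemma second_moment_bound:
  obtains K0 where "K0 > 0" "\<And>a b. (l2norm (cT a b))\<^sup>2 \<le> K0 * (real b + 1)"
proof -
  have "Bseq (\<lambda>n. s n / sqrt n)"
    using sd_limit convergentI Bseq_conv_Bfun convergent_imp_Bseq by blast
  then obtain c where c: "c > 0" "\<And>n. norm (s n / sqrt n) \<le> c" unfolding Bseq_def by blast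
  have s_le: "s n \<le> c * sqrt n + \<kappa>" for n
  proof (cases "n = 0")
    case True
    have "s 0 \<le> l2norm (T 0 0)" unfolding s_def by (rule sd_le_l2norm[OF L2_T])
    also have "\<dots> \<le> \<kappa>"
      by (rule l2norm_le_\<kappa>[where b=0]) (use near[of 0 0 0] in auto)
    finally show ?thesis using True by simp
  next
    case False
    have "s n / sqrt n \<le> c" using c(2)[of n] unfolding real_norm_def by linarith
    then have "s n \<le> c * sqrt n" using False by (simp add: pos_divide_le_eq)
    then show ?thesis using \<kappa>_nonneg by linarith
  qed
  define K0 where "K0 = (c + 2 * \<kappa>)\<^sup>2"
  have "(l2norm (cT a b))\<^sup>2 \<le> K0 * (real b + 1)" for a b
  proof -
    let ?e = "expectation (T a (a + b))"
    have E: "?e = m b" using expectation_T[of a "a + b"] by simp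
    have "cT a b = (\<lambda>x. (T a (a + b) x - ?e) + (?e - real b * \<mu>))" by (auto simp: cT_def)
    moreover have "l2norm (\<lambda>x. (T a (a + b) x - ?e) + (?e - real b * \<mu>))
        \<le> l2norm (\<lambda>x. T a (a + b) x - ?e) + l2norm (\<lambda>x. ?e - real b * \<mu>)"
      by (intro l2norm_triangle L2_diff L2_T L2_const)
    moreover have "l2norm (\<lambda>x. T a (a + b) x - ?e) = s b"
      using sd_T[of a "a + b"] by (simp add: sd_eq_l2norm)
    moreover have "l2norm (\<lambda>x. ?e - real b * \<mu>) \<le> \<kappa>"
      unfolding E using mean_error[of b] by (simp add: l2norm_def prob_space)
    ultimately have "l2norm (cT a b) \<le> c * sqrt b + 2 * \<kappa>"
      using s_le[of b] by simp
    also have "\<dots> \<le> (c + 2 * \<kappa>) * sqrt (real b + 1)"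
    proof -
      have "c * sqrt b \<le> c * sqrt (real b + 1)" using c(1) by simp
      moreover have "2 * \<kappa> * 1 \<le> 2 * \<kappa> * sqrt (real b + 1)"
        using \<kappa>_nonneg by (intro mult_left_mono) auto
      ultimately show ?thesis by (simp add: distrib_right)
    qed
    finally have "(l2norm (cT a b))\<^sup>2 \<le> ((c + 2 * \<kappa>) * sqrt (real b + 1))\<^sup>2"
      by (rule power_mono) (rule l2norm_nonneg)
    then show ?thesis by (simp add: K0_def power_mult_distrib)
  qed
  moreover have "K0 > 0" using c(1) \<kappa>_nonneg by (simp add: K0_def)
  ultimately show ?thesis using that by blast
qed

text \<open>Centring depends only on the length of the interval, so stationarity of \<open>T\<close>
  carries over.\<close>

lemma distr_cT: "distr M borel (cT a N) = distr M borel (cT 0 N)"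
proof -
  have "distr M borel (cT a N) = distr (distr M borel (T a (a + N))) borel (\<lambda>y. y - real N * \<mu>)"
    by (subst distr_distr) (auto simp: comp_def cT_def[abs_def])
  also have "distr M borel (T a (a + N)) = distr M borel (T 0 N)"
    using T_stationary[of a "a + N"] by simp
  also have "distr \<dots> borel (\<lambda>y. y - real N * \<mu>) = distr M borel (cT 0 N)"
    by (subst distr_distr) (auto simp: comp_def cT_def[abs_def])
  finally show ?thesis .
qed

lemma prob_cT_stationary:
  "prob {x \<in> space M. \<bar>cT a N x\<bar> > r} = prob {x \<in> space M. \<bar>cT 0 N x\<bar> > r}"
proof -
  have "prob {x \<in> space M. \<bar>cT a N x\<bar> > r} = measure (distr M borel (cT a N)) {y. \<bar>y\<bar> > r}" for a
    by (subst measure_distr) (auto intro!: arg_cong[where f=prob])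
  then show ?thesis using distr_cT by metis
qed

text \<open>The summand \<open>4\<close> absorbs all rounding errors.\<close>

definition mesh :: "nat \<Rightarrow> nat \<Rightarrow> nat" where "mesh K n = n div K + 4"

lemma mesh_ratio: "K > 0 \<Longrightarrow> (\<lambda>n. real (mesh K n) / real n) \<longlonglongrightarrow> 1 / real K"
proof -
  assume "K > 0"
  from tendsto_add[OF div_self_ratio[OF this] lim_const_over_n[of 4]]
  show ?thesis by (simp add: mesh_def add_divide_distrib)
qed

text \<open>The order \<open>1 / K^2\<close> is what a sum over \<open>K * H\<close> intervals can
  bear; Chebyshev's inequality would give \<open>1 / K\<close>. The fourth moment is that of the
  Gaussian limit with variance \<open>1 / K\<close>, whose value is \<open>3 / K^2\<close>.\<close>

lemma endpoint_tail:
  assumes K: "K > 0" and \<epsilon>: "\<epsilon> > 0"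
  shows "eventually (\<lambda>n. prob {x \<in> space M. \<bar>cT 0 (mesh K n) x\<bar> > \<epsilon> * (\<sigma> * sqrt (real n))}
    \<le> 13/4 / ((real K)\<^sup>2 * \<epsilon> ^ 4)) sequentially"
proof -
  \<comment> \<open>A bounded continuous function between the indicator of
    \<open>\<bar>x\<bar> > \<epsilon>\<close> and the fourth power over that of \<epsilon>. It can
    be integrated along the weak convergence although \<open>T\<close> may have no fourth
    moment.\<close>
  define \<phi> :: "real \<Rightarrow> real" where "\<phi> x = min 1 (x ^ 4 / \<epsilon> ^ 4)" for x
  let ?Z = "\<lambda>n x. (T 0 (mesh K n) x - real (mesh K n) * \<mu>) / (\<sigma> * sqrt (real n))"
  have \<phi>m [measurable]: "\<phi> \<in> borel_measurable borel" unfolding \<phi>_def by measurable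
  have \<phi>01: "0 \<le> \<phi> x" "\<phi> x \<le> 1" for x using \<epsilon> by (auto simp: \<phi>_def)
  have wc: "weak_conv_m (\<lambda>n. distr M borel (?Z n)) (gaussian (1 / real K))"
    by (rule clt_weak_conv[OF mesh_ratio[OF K]]) (use K in simp)
  have "(\<lambda>n. \<integral>y. \<phi> y \<partial>distr M borel (?Z n)) \<longlonglongrightarrow> (\<integral>y. \<phi> y \<partial>gaussian (1 / real K))"
  proof (rule weak_conv_imp_integral_bdd_continuous_conv[OF _ real_distribution_gaussian wc, where B=1])
    show "real_distribution (distr M borel (?Z n))" for n by (intro real_distribution_distr) measurable
    show "isCont \<phi> x" for x unfolding \<phi>_def[abs_def] using \<epsilon> by (intro continuous_intros) auto
    show "norm (\<phi> x) \<le> 1" for x using \<phi>01[of x] by simp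
  qed
  moreover have "(\<integral>y. \<phi> y \<partial>distr M borel (?Z n)) = expectation (\<lambda>x. \<phi> (?Z n x))" for n
    by (rule integral_distr) measurable
  ultimately have lim: "(\<lambda>n. expectation (\<lambda>x. \<phi> (?Z n x))) \<longlonglongrightarrow> (\<integral>y. \<phi> y \<partial>gaussian (1 / real K))" by simp
  have v0: "(1 / real K) \<ge> 0" by simp
  interpret g: real_distribution "gaussian (1 / real K)" by (rule real_distribution_gaussian)
  have "(\<integral>y. \<phi> y \<partial>gaussian (1 / real K)) \<le> (\<integral>y. y ^ 4 / \<epsilon> ^ 4 \<partial>gaussian (1 / real K))"
  proof (rule integral_mono)
    show "integrable (gaussian (1 / real K)) \<phi>"
      by (rule g.integrable_const_bound[where B=1]) (use \<phi>01 in \<open>auto simp: gaussian_def\<close>)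
    show "integrable (gaussian (1 / real K)) (\<lambda>y. y ^ 4 / \<epsilon> ^ 4)"
      using gaussian_fourth_moment(1)[OF v0] by simp
  qed (simp add: \<phi>_def)
  also have "\<dots> = 3 / ((real K)\<^sup>2 * \<epsilon> ^ 4)"
    using gaussian_fourth_moment(2)[OF v0] by (simp add: power_divide)
  \<comment> \<open>Any factor above 3 leaves room for the limit in \<open>n\<close>; 13/4 makes the
    final constant 7.\<close>
  also have "\<dots> < 13/4 / ((real K)\<^sup>2 * \<epsilon> ^ 4)"
    using K \<epsilon> by (intro divide_strict_right_mono) auto
  finally have "eventually (\<lambda>n. expectation (\<lambda>x. \<phi> (?Z n x)) < 13/4 / ((real K)\<^sup>2 * \<epsilon> ^ 4)) sequentially"
    using order_tendstoD(2)[OF lim] by blast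
  then show ?thesis
    using eventually_gt_at_top[of 0]
  proof eventually_elim
    case (elim n)
    have sn: "\<sigma> * sqrt (real n) > 0" using elim \<sigma>_pos by simp
    let ?E = "{x \<in> space M. \<bar>cT 0 (mesh K n) x\<bar> > \<epsilon> * (\<sigma> * sqrt (real n))}"
    have Em: "?E \<in> events" by measurable
    have "prob ?E = expectation (indicator ?E)" by simp
    also have "\<dots> \<le> expectation (\<lambda>x. \<phi> (?Z n x))"
    proof (rule integral_mono)
      show "integrable M (\<lambda>x. \<phi> (?Z n x))"
        by (rule integrable_const_bound[where B=1]) (use \<phi>01 in auto)
      show "indicator ?E x \<le> \<phi> (?Z n x)" for x
      proof (cases "x \<in> ?E")
        case True
        then have "\<epsilon> < \<bar>?Z n x\<bar>"
          using sn by (simp add: cT_def abs_divide pos_less_divide_eq)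
        then have "\<epsilon> ^ 4 \<le> \<bar>?Z n x\<bar> ^ 4" using \<epsilon> by (intro power_mono) auto
        moreover have "\<bar>?Z n x\<bar> ^ 4 = (?Z n x) ^ 4" by (rule power_even_abs) simp
        ultimately have "1 \<le> (?Z n x) ^ 4 / \<epsilon> ^ 4" using \<epsilon> by (simp only: pos_le_divide_eq zero_less_power)
        then have "\<phi> (?Z n x) = 1" unfolding \<phi>_def by (rule min_absorb1)
        then show ?thesis by (simp add: indicator_def)
      next
        case False
        then have "indicator ?E x = (0::real)" by (rule indicator_simps(2))
        then show ?thesis using \<phi>01(1)[of "?Z n x"] by linarith
      qed
      show "integrable M (indicator ?E :: 'a \<Rightarrow> real)"
        by (rule integrable_const_bound[where B=1]) (use Em in \<open>simp_all add: indicator_le_1\<close>)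
    qed
    finally show ?case using elim by simp
  qed
qed

text \<open>The constant is \<open>7 = 2 * (13/4 + 1/4)\<close>: the factor 2 of the maximal
  inequality, the tail of the endpoint, and the cut errors, which vanish in the limit. All bounds
  are uniform in the starting column \<open>a\<close>, by stationarity for the endpoint and by
  \<open>C_tail\<close> for the cuts.\<close>

lemma maximal_tail:
  assumes \<epsilon>: "\<epsilon> > 0"
  obtains K0 :: nat where "K0 > 0" "\<And>K. K \<ge> K0 \<Longrightarrow>
    eventually (\<lambda>n. \<forall>a. prob {x \<in> space M. \<exists>j\<le>mesh K n. \<bar>cT a j x\<bar> > 3 * (\<epsilon> * (\<sigma> * sqrt (real n)))}
      \<le> 7 / ((real K)\<^sup>2 * \<epsilon> ^ 4)) sequentially"
proof -
  obtain k0 where k0: "k0 > 0" "\<And>a b. (l2norm (cT a b))\<^sup>2 \<le> k0 * (real b + 1)"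
    using second_moment_bound by blast
  let ?c = "\<epsilon>\<^sup>2 * \<sigma>\<^sup>2"
  have c: "?c > 0" using \<epsilon> \<sigma>_pos by simp
  \<comment> \<open>Chebyshev's bound for a remainder tends to \<open>k0 / (K * ?c)\<close> as
    \<open>n\<close> grows; for \<open>K \<ge> K0\<close> this is below the 1/2 that the maximal
    inequality asks for.\<close>
  obtain K0 :: nat where K0: "2 * k0 / ?c < real K0" using reals_Archimedean2 by blast
  have K0pos: "K0 > 0"
  proof -
    have "0 \<le> 2 * k0 / ?c" using k0(1) c by simp
    then show ?thesis using K0 by (cases "K0 = 0") auto
  qed
  have "eventually (\<lambda>n. \<forall>a. prob {x \<in> space M. \<exists>j\<le>mesh K n. \<bar>cT a j x\<bar> > 3 * (\<epsilon> * (\<sigma> * sqrt (real n)))}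
      \<le> 7 / ((real K)\<^sup>2 * \<epsilon> ^ 4)) sequentially" if K: "K \<ge> K0" for K
  proof -
    have Kpos: "K > 0" using K K0pos by simp
    have Kbig: "k0 * (1 / real K + 0) / ?c < 1/2"
    proof -
      have "2 * k0 / ?c < real K" using K0 K by linarith
      then show ?thesis using Kpos c by (simp add: field_simps)
    qed
    have "(\<lambda>n. k0 * (real (mesh K n) / real n + 1 / real n) / ?c) \<longlonglongrightarrow> k0 * (1 / real K + 0) / ?c"
      using c by (intro tendsto_intros mesh_ratio Kpos lim_const_over_n) auto
    then have ev1: "eventually (\<lambda>n. k0 * (real (mesh K n) / real n + 1 / real n) / ?c < 1/2) sequentially"
      using Kbig by (rule order_tendstoD(2))
    have "\<epsilon> * \<sigma> > 0" using \<epsilon> \<sigma>_pos by simp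
    from C_tail[OF this] obtain \<tau> where \<tau>: "(\<lambda>n. real n * \<tau> n) \<longlonglongrightarrow> 0"
      "\<And>n b. prob {x \<in> space M. C b x > \<epsilon> * \<sigma> * sqrt (real n)} \<le> \<tau> n" by blast
    \<comment> \<open>The sum over the cuts has \<open>mesh K n + 1\<close> terms of size at most
      \<open>\<tau> n\<close>; written in this way it is a bounded factor times
      \<open>n * \<tau> n\<close>.\<close>
    have "(\<lambda>n. (real (mesh K n) / real n + 1 / real n) * (real n * \<tau> n)) \<longlonglongrightarrow> (1 / real K + 0) * 0"
      by (intro tendsto_intros mesh_ratio Kpos lim_const_over_n \<tau>)
    then have ev2: "eventually (\<lambda>n. (real (mesh K n) / real n + 1 / real n) * (real n * \<tau> n) < 1/4 / ((real K)\<^sup>2 * \<epsilon> ^ 4)) sequentially"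
      by (rule order_tendstoD(2)) (use Kpos \<epsilon> in simp)
    show ?thesis
      using ev1 ev2 endpoint_tail[OF Kpos \<epsilon>] eventually_gt_at_top[of 0]
    proof eventually_elim
      case (elim n)
      let ?N = "mesh K n" and ?r = "\<epsilon> * (\<sigma> * sqrt (real n))"
      have n: "real n > 0" and r: "?r > 0" using elim \<epsilon> \<sigma>_pos by auto
      have rsq: "?r\<^sup>2 = ?c * real n" by (simp add: power_mult_distrib)
      show ?case
      proof
        fix a
        have half: "prob {x \<in> space M. \<bar>cT (a + j) (?N - j) x\<bar> > ?r} \<le> 1/2" if j: "j \<le> ?N" for j
        proof -
          have "prob {x \<in> space M. \<bar>cT (a + j) (?N - j) x\<bar> > ?r} \<le> (l2norm (cT (a + j) (?N - j)))\<^sup>2 / ?r\<^sup>2"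
            by (rule prob_abs_gt_le[OF L2_cT r])
          also have "\<dots> \<le> k0 * (real (?N - j) + 1) / ?r\<^sup>2"
            by (rule divide_right_mono[OF k0(2)]) simp
          also have "\<dots> \<le> k0 * (real ?N + 1) / ?r\<^sup>2"
            using k0(1) by (intro divide_right_mono mult_left_mono) auto
          also have "\<dots> = k0 * (real ?N / real n + 1 / real n) / ?c"
            unfolding rsq using n by (simp add: add_divide_distrib[symmetric] mult.commute)
          finally show ?thesis using elim(1) by linarith
        qed
        have "prob {x \<in> space M. \<exists>j\<le>?N. \<bar>cT a j x\<bar> > 3 * ?r}
          \<le> 2 * (prob {x \<in> space M. \<bar>cT a ?N x\<bar> > ?r} + (\<Sum>j\<le>?N. prob {x \<in> space M. C (a + j) x > ?r}))"
          by (rule maximal_inequality[OF half])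
        moreover have "(\<Sum>j\<le>?N. prob {x \<in> space M. C (a + j) x > ?r}) \<le> (\<Sum>j\<le>?N. \<tau> n)"
          using \<tau>(2) by (intro sum_mono) (simp add: mult.assoc)
        moreover have "(\<Sum>j\<le>?N. \<tau> n) = (real ?N / real n + 1 / real n) * (real n * \<tau> n)"
          using n by (simp add: add_divide_distrib[symmetric] add.commute)
        moreover have "prob {x \<in> space M. \<bar>cT a ?N x\<bar> > ?r} \<le> 13/4 / ((real K)\<^sup>2 * \<epsilon> ^ 4)"
          using elim(3) prob_cT_stationary[where a=a and N="?N" and r="?r"] by simp
        moreover have "2 * (13/4 / ((real K)\<^sup>2 * \<epsilon> ^ 4) + 1/4 / ((real K)\<^sup>2 * \<epsilon> ^ 4)) = 7 / ((real K)\<^sup>2 * \<epsilon> ^ 4)"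
          by (simp add: add_divide_distrib[symmetric])
        \<comment> \<open>The final estimate with the nonlinear expressions abstracted to
          variables.\<close>
        moreover have "p \<le> z" if "p \<le> 2 * (q + u)" "u \<le> v" "v = w" "q \<le> x" "2 * (x + y) = z" "w < y"
          for p q u v w x y z :: real
        proof -
          have "p \<le> 2 * q + 2 * u" using that(1) by simp
          moreover have "z = 2 * x + 2 * y" using that(5) by simp
          ultimately show ?thesis using that(2,3,4,6) by linarith
        qed
        ultimately show "prob {x \<in> space M. \<exists>j\<le>?N. \<bar>cT a j x\<bar> > 3 * ?r} \<le> 7 / ((real K)\<^sup>2 * \<epsilon> ^ 4)"
          using elim(2) by blast
      qed
    qed
  qed
  then show ?thesis using that K0pos by blast
qed

section \<open>Comparison of the scaled path with a polygon\<close>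

definition grid :: "nat \<Rightarrow> nat \<Rightarrow> nat \<Rightarrow> nat" where "grid K n i = (n * i) div K"

text \<open>An increment is the centred passage time of its own slab and not a difference of two
  values of \<open>T 0\<close>. This makes the increments independent, at the price of the cut
  errors in \<open>telescope\<close>.\<close>

definition incr :: "nat \<Rightarrow> nat \<Rightarrow> nat \<Rightarrow> 'a \<Rightarrow> real" where
  "incr K n l x = cT (grid K n l) (grid K n (Suc l) - grid K n l) x / (\<sigma> * sqrt (real n))"

text \<open>\<open>Suc j\<close>: the box of columns \<open>0, \<dots>, j\<close> has \<open>j + 1\<close> columns.\<close>

definition scaled_path :: "nat \<Rightarrow> 'a \<Rightarrow> real \<Rightarrow> real" where
  "scaled_path n x = lin_path (real n) (\<lambda>j. (T 0 (Suc j) x - real j * \<mu>) / (\<sigma> * sqrt (real n)))"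

lemma scaled_path_measurable: "scaled_path n \<in> measurable M (borel_of_topology ucc_topology)"
  unfolding scaled_path_def[abs_def] by (rule lin_path_measurable) measurable

lemma grid_mono: "i \<le> j \<Longrightarrow> grid K n i \<le> grid K n j"
  unfolding grid_def by (intro div_le_mono mult_le_mono) auto

lemma grid_bounds:
  assumes "K > 0"
  shows "real (grid K n i) \<le> real (n * i) / real K" "real (n * i) / real K < real (grid K n i) + 1"
proof -
  have "real (n * i) = real (grid K n i) * real K + real ((n * i) mod K)"
    unfolding grid_def by (metis div_mult_mod_eq of_nat_add of_nat_mult)
  moreover have "real ((n * i) mod K) < real K" using assms by simp
  ultimately show "real (grid K n i) \<le> real (n * i) / real K" "real (n * i) / real K < real (grid K n i) + 1"
    using assms by (simp_all only: pos_le_divide_eq pos_divide_less_eq of_nat_0_less_iff distrib_right)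
qed

lemma telescope:
  assumes "x \<in> space M" "grid K n i \<le> b"
  shows "\<bar>T 0 b x - (\<Sum>l<i. T (grid K n l) (grid K n (Suc l)) x) - T (grid K n i) b x\<bar>
    \<le> (\<Sum>l<i. C (grid K n (Suc l)) x)"
  using assms(2)
proof (induction i)
  case 0
  then show ?case by (simp add: grid_def)
next
  case (Suc i)
  have le: "grid K n i \<le> grid K n (Suc i)" by (rule grid_mono) simp
  then have "grid K n i \<le> b" using Suc.prems by simp
  from Suc.IH[OF this] near[OF le Suc.prems assms(1)] show ?case by simp
qed

text \<open>Both paths are compared at time \<open>t\<close> with the polygon at the last mesh point
  before \<open>t\<close>. The polygon is within \<open>3 * e\<close> of it, one increment. The
  scaled path is within \<open>5 * e\<close>: an oscillation \<open>3 * e\<close>, the cut errors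
  \<open>e\<close>, and \<open>e\<close> for the offset by one column in the centring.\<close>

lemma scaled_path_close:
  assumes K: "K > 0" and n: "n > 0" and x: "x \<in> space M" and e: "e > 0"
    and M: "\<And>i j. i < K * H \<Longrightarrow> j \<le> mesh K n \<Longrightarrow> \<bar>cT (grid K n i) j x\<bar> \<le> 3 * (e * (\<sigma> * sqrt (real n)))"
    and Cs: "(\<Sum>i<K * H. C (grid K n i) x) \<le> e * (\<sigma> * sqrt (real n))"
    and mu: "\<bar>\<mu>\<bar> \<le> e * (\<sigma> * sqrt (real n))"
  shows "ucc_dist (scaled_path n x) (poly_path K (K * H) (\<lambda>l. incr K n l x)) \<le> 8 * e + 1 / (1 + real H)"
proof (rule ucc_dist_le_max)
  fix t assume t: "0 \<le> t" "t < real H"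
  define w where "w = \<sigma> * sqrt (real n)"
  have w: "w > 0" using \<sigma>_pos n by (simp add: w_def)
  define i where "i = nat \<lfloor>real K * t\<rfloor>"
  define j where "j = nat \<lfloor>real n * t\<rfloor>"
  let ?g = "grid K n"
  \<comment> \<open>The common reference value: the polygon at its vertex \<open>i\<close>.\<close>
  define V where "V = (\<Sum>l<i. incr K n l x)"
  have i: "real i \<le> real K * t" "real K * t < real i + 1" using t by (auto simp: i_def)
  have j: "real j \<le> real n * t" "real n * t < real j + 1" using t by (auto simp: j_def)
  have iH: "i < K * H"
  proof -
    have "real K * t < real K * real H" using t K by simp
    then have "real i < real (K * H)" using i unfolding of_nat_mult by linarith
    then show ?thesis by (simp only: of_nat_less_iff)
  qed
  have it: "real (n * i) / real K \<le> real n * t"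
  proof -
    have "real n * real i \<le> real n * (real K * t)" using i by (intro mult_left_mono) auto
    then show ?thesis using K by (simp add: pos_divide_le_eq mult.assoc mult.commute mult.left_commute)
  qed
  have ti: "real n * t < real (n * i) / real K + real n / real K"
  proof -
    have "real n * (real K * t) < real n * (real i + 1)" using i n by (intro mult_strict_left_mono) auto
    then show ?thesis using K by (simp add: pos_less_divide_eq add_divide_distrib[symmetric] algebra_simps)
  qed
  have gi: "?g i \<le> j"
  proof -
    have "real (?g i) < real j + 1" using grid_bounds(1)[OF K, of n i] it j by linarith
    then show ?thesis by simp
  qed
  have nK: "real n / real K < real (n div K) + 1"
    using grid_bounds(2)[OF K, of n 1] by (simp add: grid_def)
  \<comment> \<open>The interpolation at \<open>t\<close> uses the indices \<open>j\<close> and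
    \<open>j + 1\<close>, and the latter involves \<open>j + 2\<close> columns; all of this has to
    fit into one mesh interval.\<close>
  have gj: "Suc (Suc j) \<le> ?g i + mesh K n"
  proof -
    have "real j < real (?g i) + 1 + (real (n div K) + 1)"
      using j(1) ti grid_bounds(2)[OF K, of n i] nK by linarith
    then have "j < ?g i + n div K + 2" by linarith
    then show ?thesis by (simp add: mesh_def)
  qed
  have gS: "?g (Suc i) - ?g i \<le> mesh K n"
  proof -
    have "real (?g (Suc i)) \<le> real (n * i) / real K + real n / real K"
      using grid_bounds(1)[OF K, of n "Suc i"] by (simp add: add_divide_distrib algebra_simps)
    then have "real (?g (Suc i)) < real (?g i) + 1 + (real (n div K) + 1)"
      using grid_bounds(2)[OF K, of n i] nK by linarith
    then have "?g (Suc i) < ?g i + n div K + 2" by linarith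
    then show ?thesis by (simp add: mesh_def)
  qed
  have scale: "\<bar>y / w\<bar> \<le> c * e" if "\<bar>y\<bar> \<le> c * (e * w)" for y c
  proof -
    have "\<bar>y\<bar> / w \<le> c * e" using that w by (simp add: pos_divide_le_eq mult.assoc)
    then show ?thesis using w by (simp add: abs_divide)
  qed
  have A: "\<bar>linear_interpolation (\<lambda>i. \<Sum>l<min i (K * H). incr K n l x) (real K * t) - V\<bar> \<le> 3 * e"
  proof (rule linear_interpolation_close)
    show "\<bar>(\<Sum>l<min (nat \<lfloor>real K * t\<rfloor>) (K * H). incr K n l x) - V\<bar> \<le> 3 * e"
      using iH e unfolding i_def[symmetric] V_def by (simp add: min_absorb1)
    have "\<bar>incr K n i x\<bar> \<le> 3 * e"
      unfolding incr_def w_def[symmetric] using M[OF iH gS] by (intro scale) (simp add: w_def)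
    then show "\<bar>(\<Sum>l<min (Suc (nat \<lfloor>real K * t\<rfloor>)) (K * H). incr K n l x) - V\<bar> \<le> 3 * e"
      using iH unfolding i_def[symmetric] V_def by (simp add: min_absorb1 Suc_leI)
  qed
  have V: "V = ((\<Sum>l<i. T (?g l) (?g (Suc l)) x) - real (?g i) * \<mu>) / w"
  proof -
    have "(\<Sum>l<k. real (?g (Suc l) - ?g l)) = real (?g k)" for k
    proof (induction k)
      case (Suc k)
      have "?g k \<le> ?g (Suc k)" by (rule grid_mono) simp
      with Suc show ?case by (simp add: of_nat_diff)
    qed (simp add: grid_def)
    then have "(\<Sum>l<i. cT (?g l) (?g (Suc l) - ?g l) x) = (\<Sum>l<i. T (?g l) (?g (Suc l)) x) - real (?g i) * \<mu>"
      by (simp add: cT_def sum_subtractf grid_mono sum_distrib_right[symmetric])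
    then show ?thesis by (simp add: V_def incr_def w_def sum_divide_distrib[symmetric])
  qed
  have Ci: "(\<Sum>l<i. C (?g (Suc l)) x) \<le> e * w"
  proof -
    have "(\<Sum>l<i. C (?g (Suc l)) x) = (\<Sum>l\<in>Suc ` {..<i}. C (?g l) x)"
      by (simp add: sum.reindex)
    also have "\<dots> \<le> (\<Sum>l<K * H. C (?g l) x)"
      by (rule sum_mono2) (use iH C_nonneg[OF x] in auto)
    finally show ?thesis using Cs by (simp add: w_def)
  qed
  have point: "\<bar>(T 0 (Suc k) x - real k * \<mu>) / w - V\<bar> \<le> 5 * e" if k: "j \<le> k" "Suc k \<le> ?g i + mesh K n" for k
  proof -
    have le: "?g i \<le> Suc k" using gi k by simp
    \<comment> \<open>The extra \<mu> appears because \<open>T 0 (Suc k)\<close> spans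
      \<open>k + 1\<close> columns but is centred by \<open>k * \<mu>\<close>.\<close>
    have "(T 0 (Suc k) x - real k * \<mu>) / w - V
      = ((T 0 (Suc k) x - (\<Sum>l<i. T (?g l) (?g (Suc l)) x) - T (?g i) (Suc k) x) + cT (?g i) (Suc k - ?g i) x + \<mu>) / w"
    proof -
      have "real (Suc k - ?g i) = real k + 1 - real (?g i)" using le by (simp add: of_nat_diff)
      moreover have "?g i + (Suc k - ?g i) = Suc k" using le by simp
      ultimately show ?thesis
        unfolding V cT_def diff_divide_distrib[symmetric] by (simp only:) (simp add: algebra_simps)
    qed
    also have "\<bar>\<dots>\<bar> \<le> 5 * e"
    proof (rule scale)
      have "\<bar>cT (?g i) (Suc k - ?g i) x\<bar> \<le> 3 * (e * w)"
        using M[OF iH, of "Suc k - ?g i"] k by (simp add: w_def)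
      then show "\<bar>(T 0 (Suc k) x - (\<Sum>l<i. T (?g l) (?g (Suc l)) x) - T (?g i) (Suc k) x) + cT (?g i) (Suc k - ?g i) x + \<mu>\<bar>
          \<le> 5 * (e * w)"
        using telescope[OF x le] Ci mu unfolding w_def[symmetric] by linarith
    qed
    finally show ?thesis .
  qed
  have B: "\<bar>linear_interpolation (\<lambda>j. (T 0 (Suc j) x - real j * \<mu>) / w) (real n * t) - V\<bar> \<le> 5 * e"
    by (rule linear_interpolation_close; unfold j_def[symmetric]; rule point) (use gj in auto)
  show "\<bar>scaled_path n x t - poly_path K (K * H) (\<lambda>l. incr K n l x) t\<bar> \<le> 8 * e"
    using A B t unfolding scaled_path_def poly_path_def lin_path_def w_def[symmetric] by simp
qed (use e in auto)

lemma grid_ratio: "K > 0 \<Longrightarrow> (\<lambda>n. real (grid K n i) / real n) \<longlonglongrightarrow> real i / real K"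
  unfolding grid_def
proof (rule div_ratio_tendsto)
  have "eventually (\<lambda>n. real (n * i) / real n = real i) sequentially"
    using eventually_gt_at_top[of 0] by eventually_elim simp
  then show "(\<lambda>n. real (n * i) / real n) \<longlonglongrightarrow> real i" by (rule tendsto_eventually)
qed

lemma incr_measurable: "incr K n l \<in> borel_measurable (G (grid K n l) (grid K n (Suc l)))"
proof -
  have "grid K n l + (grid K n (Suc l) - grid K n l) = grid K n (Suc l)"
    using grid_mono[of l "Suc l" K n] by simp
  then have "cT (grid K n l) (grid K n (Suc l) - grid K n l) \<in> borel_measurable (G (grid K n l) (grid K n (Suc l)))"
    using cT_measurable by metis
  then show ?thesis unfolding incr_def[abs_def] by (rule borel_measurable_divide) simp
qed

lemma incr_measM [measurable]: "incr K n l \<in> borel_measurable M"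
  by (rule G_measurable_M[OF incr_measurable])

lemma incr_indep: "indep_vars (\<lambda>_. borel) (incr K n) UNIV"
  by (rule indep_blocks[where n="grid K n"]) (auto simp: mono_def grid_mono incr_measurable)

text \<open>Stationarity moves the increment to column 0, where \<open>clt_weak_conv\<close> applies
  to its length, asymptotically \<open>n / K\<close>.\<close>

lemma incr_weak_conv:
  assumes K: "K > 0"
  shows "weak_conv_m (\<lambda>n. distr M borel (incr K n l)) (gaussian (1 / real K))"
proof -
  define N where "N n = grid K n (Suc l) - grid K n l" for n
  have "real (N n) / real n = real (grid K n (Suc l)) / real n - real (grid K n l) / real n" for n
    using grid_mono[of l "Suc l" K n] by (simp add: N_def of_nat_diff diff_divide_distrib)
  moreover have "(\<lambda>n. real (grid K n (Suc l)) / real n - real (grid K n l) / real n) \<longlonglongrightarrow> real (Suc l) / real K - real l / real K"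
    by (intro tendsto_diff grid_ratio K)
  moreover have "real (Suc l) / real K - real l / real K = 1 / real K"
    by (simp add: diff_divide_distrib[symmetric])
  ultimately have "(\<lambda>n. real (N n) / real n) \<longlonglongrightarrow> 1 / real K" by (simp only:)
  from clt_weak_conv[OF this]
  have "weak_conv_m (\<lambda>n. distr M borel (\<lambda>x. (T 0 (N n) x - real (N n) * \<mu>) / (\<sigma> * sqrt (real n)))) (gaussian (1 / real K))"
    using K by simp
  moreover have "distr M borel (\<lambda>x. (T 0 (N n) x - real (N n) * \<mu>) / (\<sigma> * sqrt (real n))) = distr M borel (incr K n l)" for n
  proof -
    have "distr M borel (incr K n l) = distr (distr M borel (cT (grid K n l) (N n))) borel (\<lambda>y. y / (\<sigma> * sqrt (real n)))"
      by (subst distr_distr) (auto simp: comp_def incr_def[abs_def] N_def)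
    also have "\<dots> = distr (distr M borel (cT 0 (N n))) borel (\<lambda>y. y / (\<sigma> * sqrt (real n)))"
      by (simp only: distr_cT[of "grid K n l"])
    also have "\<dots> = distr M borel (\<lambda>x. (T 0 (N n) x - real (N n) * \<mu>) / (\<sigma> * sqrt (real n)))"
      by (subst distr_distr) (auto simp: comp_def cT_def)
    finally show ?thesis by simp
  qed
  ultimately show ?thesis by simp
qed

text \<open>Mesh width \<open>1 / H^2\<close> up to time \<open>H\<close> gives \<open>H^3\<close>
  mesh intervals. Each of them oscillates too much with probability at most
  \<open>7 / (H^4 * e^4)\<close>, so together they cost \<open>7 / (H * e^4)\<close>. Outside the
  bad event the distance is at most \<open>8 * e + 1 / (1 + H)\<close>; the ninth \<open>e\<close>
  is the probability of large cut errors.\<close>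

lemma poly_path_approx:
  assumes g: "ucc_lipschitz L g" and b: "\<And>f. f \<in> C_half_line \<Longrightarrow> \<bar>g f\<bar> \<le> b" and e: "e > 0"
  obtains H0 :: nat where "H0 > 0" "\<And>H. H \<ge> H0 \<Longrightarrow> eventually (\<lambda>n.
     \<bar>expectation (\<lambda>x. g (scaled_path n x)) - expectation (\<lambda>x. g (poly_path (H\<^sup>2) (H\<^sup>2 * H) (\<lambda>l. incr (H\<^sup>2) n l x)))\<bar>
     \<le> L * (9 * e + 1 / (1 + real H) + 7 / (real H * e ^ 4))) sequentially"
proof -
  obtain K0 :: nat where K0: "K0 > 0" "\<And>K. K \<ge> K0 \<Longrightarrow>
    eventually (\<lambda>n. \<forall>a. prob {x \<in> space M. \<exists>j\<le>mesh K n. \<bar>cT a j x\<bar> > 3 * (e * (\<sigma> * sqrt (real n)))}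
      \<le> 7 / ((real K)\<^sup>2 * e ^ 4)) sequentially"
    using maximal_tail[OF e] by blast
  have L: "L \<ge> 0" using g by (simp add: ucc_lipschitz_def)
  have gc: "continuous_map ucc_topology euclideanreal g" by (rule ucc_lipschitz_continuous_map[OF g])
  have "eventually (\<lambda>n.
     \<bar>expectation (\<lambda>x. g (scaled_path n x)) - expectation (\<lambda>x. g (poly_path (H\<^sup>2) (H\<^sup>2 * H) (\<lambda>l. incr (H\<^sup>2) n l x)))\<bar>
     \<le> L * (9 * e + 1 / (1 + real H) + 7 / (real H * e ^ 4))) sequentially" if H: "H \<ge> K0" for H
  proof -
    define K r where "K = H\<^sup>2" "r = H\<^sup>2 * H"
    have H0: "H > 0" using H K0(1) by simp
    have K: "K > 0" "r = K * H" using H0 by (auto simp: K_r_def)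
    have KK0: "K \<ge> K0"
    proof -
      have "H \<le> K" unfolding K_r_def power2_eq_square by (rule le_square)
      then show ?thesis using H by linarith
    qed
    \<comment> \<open>The number \<open>r\<close> of mesh points does not depend on
      \<open>n\<close>, so here the triangle inequality suffices for the sum of the cut errors, and
      Chebyshev's bound is \<open>c / n\<close>.\<close>
    define c where "c = (real r * \<kappa>)\<^sup>2 / (e\<^sup>2 * \<sigma>\<^sup>2)"
    have "(\<lambda>n. c / real n) \<longlonglongrightarrow> 0" by (rule lim_const_over_n)
    then have ev1: "eventually (\<lambda>n. c / real n < e) sequentially" using e by (rule order_tendstoD(2))
    have "(\<lambda>n. (\<bar>\<mu>\<bar> / (e * \<sigma>)) / sqrt (real n)) \<longlonglongrightarrow> 0" by (rule over_sqrt_tendsto_0)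
    then have ev2: "eventually (\<lambda>n. (\<bar>\<mu>\<bar> / (e * \<sigma>)) / sqrt (real n) < 1) sequentially" by (rule order_tendstoD(2)) simp
    show ?thesis
      unfolding K_r_def[symmetric]
      using ev1 ev2 K0(2)[OF KK0] eventually_gt_at_top[of 0]
    proof eventually_elim
      case (elim n)
      let ?w = "e * (\<sigma> * sqrt (real n))"
      let ?P = "\<lambda>x. poly_path K r (\<lambda>l. incr K n l x)"
      have n: "n > 0" using elim by simp
      have w: "?w > 0" using e \<sigma>_pos n by simp
      define B1 where "B1 = {x \<in> space M. \<bar>\<Sum>i<r. C (grid K n i) x\<bar> > ?w}"
      define B2 where "B2 i = {x \<in> space M. \<exists>j\<le>mesh K n. \<bar>cT (grid K n i) j x\<bar> > 3 * ?w}" for i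
      define B where "B = B1 \<union> (\<Union>i<r. B2 i)"
      have B1m [measurable]: "B1 \<in> sets M" unfolding B1_def by measurable
      have B2m [measurable]: "B2 i \<in> sets M" for i
      proof -
        have "B2 i = (\<Union>j\<le>mesh K n. {x \<in> space M. \<bar>cT (grid K n i) j x\<bar> > 3 * ?w})" by (auto simp: B2_def)
        also have "\<dots> \<in> sets M" by measurable
        finally show ?thesis .
      qed
      have Bm [measurable]: "B \<in> sets M" unfolding B_def by measurable
      have PB1: "prob B1 \<le> e"
      proof -
        have L2S: "L2 (\<lambda>x. \<Sum>i<r. C (grid K n i) x)" by (intro L2_sum L2_C)
        have norm_sum: "l2norm (\<lambda>x. \<Sum>i<k. C (grid K n i) x) \<le> real k * \<kappa>" for k
        proof (induction k)
          case (Suc k)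
          have "l2norm (\<lambda>x. (\<Sum>i<k. C (grid K n i) x) + C (grid K n k) x)
             \<le> l2norm (\<lambda>x. \<Sum>i<k. C (grid K n i) x) + l2norm (C (grid K n k))"
            by (intro l2norm_triangle L2_sum L2_C)
          with Suc C_norm[of "grid K n k"] show ?case by (simp add: algebra_simps)
        qed (simp add: l2norm_def)
        have "prob B1 \<le> (l2norm (\<lambda>x. \<Sum>i<r. C (grid K n i) x))\<^sup>2 / ?w\<^sup>2"
          unfolding B1_def by (rule prob_abs_gt_le[OF L2S w])
        also have "\<dots> \<le> (real r * \<kappa>)\<^sup>2 / ?w\<^sup>2"
          by (intro divide_right_mono power_mono norm_sum l2norm_nonneg) simp
        also have "\<dots> = c / real n" using n by (simp add: c_def power_mult_distrib mult.assoc)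
        finally show ?thesis using elim(1) by linarith
      qed
      have PB: "prob B \<le> e + 7 / (real H * e ^ 4)"
      proof -
        have "prob B \<le> prob B1 + prob (\<Union>i<r. B2 i)" unfolding B_def by (rule measure_Un_le) measurable
        also have "prob (\<Union>i<r. B2 i) \<le> (\<Sum>i<r. prob (B2 i))" by (rule measure_UNION_le) auto
        also have "\<dots> \<le> (\<Sum>i<r. 7 / ((real K)\<^sup>2 * e ^ 4))"
          unfolding B2_def using elim(3) by (intro sum_mono) blast
        also have "\<dots> = 7 / (real H * e ^ 4)"
          using H0 e by (simp add: K_r_def power2_eq_square field_simps)
        finally show ?thesis using PB1 by simp
      qed
      have close: "\<bar>g (scaled_path n x) - g (?P x)\<bar> \<le> L * (8 * e + 1 / (1 + real H)) + L * indicator B x" if x: "x \<in> space M" for x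
      proof -
        have lip: "\<bar>g (scaled_path n x) - g (?P x)\<bar> \<le> L * ucc_dist (scaled_path n x) (?P x)"
          using g unfolding ucc_lipschitz_def scaled_path_def by (simp add: lin_path_in_C poly_path_in_C)
        have "ucc_dist (scaled_path n x) (?P x) \<le> (8 * e + 1 / (1 + real H)) + indicator B x"
        proof (cases "x \<in> B")
          case True
          then have "indicator B x = (1::real)" by simp
          moreover have "0 \<le> 1 / (1 + real H)" by simp
          ultimately show ?thesis using ucc_dist_le_1[of "scaled_path n x" "?P x"] e by linarith
        next
          case False
          have "ucc_dist (scaled_path n x) (?P x) \<le> 8 * e + 1 / (1 + real H)"
            unfolding K(2)
          proof (rule scaled_path_close[OF K(1) n x e])
            show "\<bar>cT (grid K n i) j x\<bar> \<le> 3 * ?w" if "i < K * H" "j \<le> mesh K n" for i j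
            proof (rule ccontr)
              assume "\<not> \<bar>cT (grid K n i) j x\<bar> \<le> 3 * ?w"
              then have "x \<in> B2 i" unfolding B2_def using that x by auto
              then show False using False that unfolding B_def K(2) by blast
            qed
            have "\<bar>\<Sum>i<r. C (grid K n i) x\<bar> \<le> ?w" using False x unfolding B_def B1_def by auto
            then show "(\<Sum>i<K * H. C (grid K n i) x) \<le> ?w" unfolding K(2) by linarith
            have "\<bar>\<mu>\<bar> / ?w < 1" using elim(2) by (simp add: mult.assoc)
            then show "\<bar>\<mu>\<bar> \<le> ?w" using w by (simp add: pos_divide_less_eq)
          qed
          then show ?thesis using False by simp
        qed
        then have "L * ucc_dist (scaled_path n x) (?P x) \<le> L * ((8 * e + 1 / (1 + real H)) + indicator B x)"
          using L by (rule mult_left_mono)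
        with lip show ?thesis by (simp add: distrib_left)
      qed
      have Pm: "?P \<in> measurable M (borel_of_topology ucc_topology)"
        by (rule poly_path_measurable) measurable
      have i1: "integrable M (\<lambda>x. g (scaled_path n x))" by (rule integrable_bounded_ucc[OF scaled_path_measurable gc b])
      have i2: "integrable M (\<lambda>x. g (?P x))" by (rule integrable_bounded_ucc[OF Pm gc b])
      have iB: "integrable M (indicator B :: 'a \<Rightarrow> real)"
        by (rule integrable_const_bound[where B=1]) (use Bm in \<open>simp_all add: indicator_le_1\<close>)
      have i3: "integrable M (\<lambda>x. L * (8 * e + 1 / (1 + real H)) + L * indicator B x)"
        by (rule Bochner_Integration.integrable_add[OF integrable_const]) (use iB in simp)
      have "\<bar>expectation (\<lambda>x. g (scaled_path n x)) - expectation (\<lambda>x. g (?P x))\<bar> = \<bar>expectation (\<lambda>x. g (scaled_path n x) - g (?P x))\<bar>"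
        using i1 i2 by simp
      also have "\<dots> \<le> expectation (\<lambda>x. \<bar>g (scaled_path n x) - g (?P x)\<bar>)" by (rule integral_abs_bound)
      also have "\<dots> \<le> expectation (\<lambda>x. L * (8 * e + 1 / (1 + real H)) + L * indicator B x)"
        by (rule integral_mono[OF _ i3 close]) (use i1 i2 in auto)
      also have "\<dots> = L * (8 * e + 1 / (1 + real H)) + L * prob B"
        using iB Bm Bochner_Integration.integral_add[OF integrable_const integrable_mult_right[OF iB],
          of "L * (8 * e + 1 / (1 + real H))" L] by (simp add: prob_space)
      also have "\<dots> \<le> L * (8 * e + 1 / (1 + real H)) + L * (e + 7 / (real H * e ^ 4))"
        using PB L by (intro add_left_mono mult_left_mono) auto
      also have "\<dots> = L * (9 * e + 1 / (1 + real H) + 7 / (real H * e ^ 4))" by (simp add: algebra_simps)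
      finally show ?case unfolding K(2) .
    qed
  qed
  then show ?thesis using that K0(1) by blast
qed

end

section \<open>Convergence to Brownian motion\<close>

lemma (in prob_space) distr_centred_normal:
  assumes X: "distributed M lborel X (normal_density 0 (sqrt v))" and v: "v > 0"
  shows "distr M borel X = gaussian v"
proof -
  have "distributed M lborel (\<lambda>x. (X x - 0) / sqrt v) std_normal_density"
    using X normal_standard_normal_convert[of "sqrt v" X 0] v by simp
  then have d: "distr M lborel (\<lambda>x. X x / sqrt v) = std_normal_distribution"
    and m: "(\<lambda>x. X x / sqrt v) \<in> measurable M lborel"
    by (simp_all add: distributed_def)
  have "gaussian v = distr (distr M lborel (\<lambda>x. X x / sqrt v)) borel (\<lambda>x. sqrt v * x)"
    unfolding gaussian_def d ..
  also have "\<dots> = distr M borel ((\<lambda>x. sqrt v * x) \<circ> (\<lambda>x. X x / sqrt v))"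
    by (rule distr_distr[OF _ m]) simp
  also have "(\<lambda>x. sqrt v * x) \<circ> (\<lambda>x. X x / sqrt v) = X" using v by (auto simp: comp_def)
  finally show ?thesis by simp
qed

context nearly_additive
begin

text \<open>Three comparisons, all for a Lipschitz test function: the scaled path with its polygon,
  uniformly for large \<open>n\<close>; the polygon with the Brownian polygon on the same fixed
  mesh, by joint convergence; the Brownian polygon with Brownian motion, by continuity of paths. The
  mesh is fixed before \<open>n\<close> is sent to infinity.\<close>

theorem scaled_path_converges_in_distribution:
  fixes N :: "'b measure" and B :: "real \<Rightarrow> 'b \<Rightarrow> real"
  assumes BM: "standard_brownian_motion N B"
  shows "converges_in_distribution ucc_topology M scaled_path N (\<lambda>\<zeta>. \<lambda>t\<in>{0..}. B t \<zeta>)"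
proof -
  interpret N: prob_space N using BM by (simp add: standard_brownian_motion_def)
  have Bm: "B t \<in> borel_measurable N" if "t \<ge> 0" for t
    using BM that by (simp add: standard_brownian_motion_def)
  have B0: "AE \<zeta> in N. B 0 \<zeta> = 0" using BM by (simp add: standard_brownian_motion_def)
  have Bn: "distributed N lborel (\<lambda>\<zeta>. B t \<zeta> - B s \<zeta>) (normal_density 0 (sqrt (t - s)))" if "0 \<le> s" "s < t" for s t
    using BM that by (simp add: standard_brownian_motion_def)
  have Bi: "N.indep_vars (\<lambda>_. borel) (\<lambda>i \<zeta>. B (\<tau> (Suc i)) \<zeta> - B (\<tau> i) \<zeta>) {..<k}"
    if "0 \<le> \<tau> 0" "\<And>i. i < k \<Longrightarrow> \<tau> i \<le> \<tau> (Suc i)" for \<tau> and k :: nat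
    using BM that by (simp add: standard_brownian_motion_def)
  have Bc: "continuous_on {0..} (\<lambda>t. B t \<zeta>)" if "\<zeta> \<in> space N" for \<zeta>
    using BM that by (simp add: standard_brownian_motion_def)
  let ?Z = "\<lambda>\<zeta>. \<lambda>t\<in>{0..}. B t \<zeta>"
  \<comment> \<open>Mesh and number of steps match \<open>poly_path_approx\<close> with
    \<open>H = Suc q\<close>, so that \<open>H\<close> is never zero.\<close>
  define K where "K q = (Suc q)\<^sup>2" for q :: nat
  define r where "r q = K q * Suc q" for q
  have Kpos: "K q > 0" "r q > 0" for q by (simp_all add: K_def r_def)
  have ZC: "?Z \<zeta> \<in> C_half_line" if "\<zeta> \<in> space N" for \<zeta>
    unfolding C_half_line_def
  proof (intro CollectI conjI)
    show "continuous_on {0..} (restrict (\<lambda>t. B t \<zeta>) {0..})"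
      by (rule continuous_on_eq[OF Bc[OF that]]) simp
  qed simp
  \<comment> \<open>Brownian motion sampled on the mesh and frozen at time
    \<open>r q / K q = Suc q\<close>.\<close>
  define S where "S q \<zeta> = lin_path (real (K q)) (\<lambda>i. B (real (min i (r q)) / real (K q)) \<zeta>)" for q \<zeta>
  have Sm: "S q \<in> measurable N (borel_of_topology ucc_topology)" for q
    unfolding S_def[abs_def] by (rule lin_path_measurable) (auto intro: Bm)
  have Slim: "(\<lambda>q. ucc_dist (S q \<zeta>) (?Z \<zeta>)) \<longlonglongrightarrow> 0" if "\<zeta> \<in> space N" for \<zeta>
    unfolding S_def
  proof (rule lin_path_sample_tendsto[OF ZC[OF that]])
    show "filterlim K at_top sequentially"
      unfolding filterlim_at_top
    proof
      fix z
      show "eventually (\<lambda>q. z \<le> K q) sequentially"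
        using eventually_ge_at_top[of z]
      proof eventually_elim
        case (elim q)
        have "Suc q \<le> K q" unfolding K_def power2_eq_square by (rule le_square)
        with elim show ?case by linarith
      qed
    qed
    fix H :: real
    obtain h :: nat where h: "H \<le> real h" using real_arch_simple by blast
    show "eventually (\<lambda>q. \<forall>i. real i \<le> H * real (K q) \<longrightarrow>
      B (real (min i (r q)) / real (K q)) \<zeta> = ?Z \<zeta> (real i / real (K q))) sequentially"
      using eventually_ge_at_top[of h]
    proof eventually_elim
      case (elim q)
      show ?case
      proof (intro allI impI)
        fix i assume i: "real i \<le> H * real (K q)"
        also have "\<dots> \<le> real (Suc q) * real (K q)" using h elim by (intro mult_right_mono) auto
        finally have "real i \<le> real (r q)" by (simp only: r_def of_nat_mult mult.commute)
        then have "min i (r q) = i" by (simp add: min_absorb1)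
        then show "B (real (min i (r q)) / real (K q)) \<zeta> = ?Z \<zeta> (real i / real (K q))" by simp
      qed
    qed
  qed
  have Zm: "?Z \<in> measurable N (borel_of_topology ucc_topology)"
    by (rule measurable_ucc_limit[OF Sm ZC Slim])
  define W where "W q l \<zeta> = B (real (Suc l) / real (K q)) \<zeta> - B (real l / real (K q)) \<zeta>" for q l \<zeta>
  have Wm: "W q l \<in> borel_measurable N" for q l
    unfolding W_def[abs_def] by (intro borel_measurable_diff Bm) auto
  have Wd: "distr N borel (W q l) = gaussian (1 / real (K q))" for q l
  proof (rule N.distr_centred_normal)
    have "real (Suc l) / real (K q) - real l / real (K q) = 1 / real (K q)"
      by (simp add: diff_divide_distrib[symmetric])
    moreover have "real l / real (K q) < real (Suc l) / real (K q)"
      using Kpos by (intro divide_strict_right_mono) auto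
    ultimately show "distributed N lborel (W q l) (normal_density 0 (sqrt (1 / real (K q))))"
      using Bn[of "real l / real (K q)" "real (Suc l) / real (K q)"] unfolding W_def[abs_def] by simp
  qed (use Kpos in simp)
  have Wi: "N.indep_vars (\<lambda>_. borel) (W q) {..<r q}" for q
    unfolding W_def[abs_def]
    by (rule Bi[of "\<lambda>i. real i / real (K q)"]) (auto intro!: divide_right_mono)
  \<comment> \<open>Only almost surely: the sampled path starts at \<open>B 0\<close>, the polygon
    of the increments at 0.\<close>
  have WS: "AE \<zeta> in N. poly_path (K q) (r q) (\<lambda>l. W q l \<zeta>) = S q \<zeta>" for q
    using B0
  proof eventually_elim
    case (elim \<zeta>)
    have "(\<Sum>l<k. W q l \<zeta>) = B (real k / real (K q)) \<zeta>" for k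
      unfolding W_def using sum_lessThan_telescope[of "\<lambda>l. B (real l / real (K q)) \<zeta>" k] elim by simp
    then show ?case by (simp add: poly_path_def S_def)
  qed
  show ?thesis
  proof (rule converges_in_distribution_uccI[OF _ _ scaled_path_measurable Zm])
    show "prob_space M" "prob_space N" by unfold_locales
    fix g L b assume g: "ucc_lipschitz L g" and b: "\<And>f. f \<in> C_half_line \<Longrightarrow> \<bar>g f\<bar> \<le> b"
    have gc: "continuous_map ucc_topology euclideanreal g" by (rule ucc_lipschitz_continuous_map[OF g])
    have L: "L \<ge> 0" using g by (simp add: ucc_lipschitz_def)
    have joint: "(\<lambda>n. expectation (\<lambda>x. g (poly_path (K q) (r q) (\<lambda>l. incr (K q) n l x))))
      \<longlonglongrightarrow> N.expectation (\<lambda>\<zeta>. g (poly_path (K q) (r q) (\<lambda>l. W q l \<zeta>)))" for q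
    proof (rule joint_convergence[where \<psi>="\<lambda>u. g (poly_path (K q) (r q) u)" and r="r q" and b=b and L=L])
      show "indep_vars (\<lambda>_. borel) (incr (K q) n) {..<r q}" for n
        by (rule indep_vars_subset[OF incr_indep]) auto
      show "N.indep_vars (\<lambda>_. borel) (W q) {..<r q}" by (rule Wi)
      show "weak_conv_m (\<lambda>n. distr M borel (incr (K q) n l)) (distr N borel (W q l))" for l
        unfolding Wd by (rule incr_weak_conv[OF Kpos(1)])
      have "poly_path (K q) (r q) \<in> measurable borel (borel_of_topology ucc_topology)"
        using poly_path_measurable[of "\<lambda>u. u" borel "K q" "r q"] by simp
      from measurable_compose[OF this continuous_map_measurable[OF gc]]
      show "(\<lambda>u. g (poly_path (K q) (r q) u)) \<in> borel_measurable borel" .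
      show "\<bar>g (poly_path (K q) (r q) u) - g (poly_path (K q) (r q) u')\<bar> \<le> L * (\<Sum>l<r q. \<bar>u l - u' l\<bar>)" for u u'
      proof -
        have "\<bar>g (poly_path (K q) (r q) u) - g (poly_path (K q) (r q) u')\<bar>
          \<le> L * ucc_dist (poly_path (K q) (r q) u) (poly_path (K q) (r q) u')"
          using g by (simp add: ucc_lipschitz_def poly_path_in_C)
        also have "\<dots> \<le> L * (\<Sum>l<r q. \<bar>u l - u' l\<bar>)"
          by (rule mult_left_mono[OF poly_path_lipschitz L])
        finally show ?thesis .
      qed
    qed (use Kpos Wm b poly_path_in_C prob_space_axioms N.prob_space_axioms in auto)
    have Wlim: "(\<lambda>q. N.expectation (\<lambda>\<zeta>. g (poly_path (K q) (r q) (\<lambda>l. W q l \<zeta>)))) \<longlonglongrightarrow> N.expectation (\<lambda>\<zeta>. g (?Z \<zeta>))"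
    proof -
      have "(\<lambda>q. N.expectation (\<lambda>\<zeta>. g (S q \<zeta>))) \<longlonglongrightarrow> N.expectation (\<lambda>\<zeta>. g (?Z \<zeta>))"
      proof (rule integral_dominated_convergence[where w="\<lambda>_. b"])
        show "AE \<zeta> in N. (\<lambda>q. g (S q \<zeta>)) \<longlonglongrightarrow> g (?Z \<zeta>)"
        proof (rule AE_I2)
          fix \<zeta> assume \<zeta>: "\<zeta> \<in> space N"
          have "(\<lambda>q. g (S q \<zeta>) - g (?Z \<zeta>)) \<longlonglongrightarrow> 0"
          proof (rule Lim_null_comparison[OF always_eventually])
            show "\<forall>q. norm (g (S q \<zeta>) - g (?Z \<zeta>)) \<le> L * ucc_dist (S q \<zeta>) (?Z \<zeta>)"
              using g ZC[OF \<zeta>] by (simp add: ucc_lipschitz_def S_def lin_path_in_C)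
            show "(\<lambda>q. L * ucc_dist (S q \<zeta>) (?Z \<zeta>)) \<longlonglongrightarrow> 0"
              by (rule tendsto_mult_right_zero[OF Slim[OF \<zeta>]])
          qed
          then show "(\<lambda>q. g (S q \<zeta>)) \<longlonglongrightarrow> g (?Z \<zeta>)" by (rule LIM_zero_cancel)
        qed
        show "AE \<zeta> in N. norm (g (S q \<zeta>)) \<le> b" for q
          using b by (simp add: S_def lin_path_in_C)
      qed (use measurable_compose[OF Zm continuous_map_measurable[OF gc]]
             measurable_compose[OF Sm continuous_map_measurable[OF gc]] in auto)
      moreover have "N.expectation (\<lambda>\<zeta>. g (poly_path (K q) (r q) (\<lambda>l. W q l \<zeta>))) = N.expectation (\<lambda>\<zeta>. g (S q \<zeta>))" for q
      proof (rule integral_cong_AE)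
        show "AE \<zeta> in N. g (poly_path (K q) (r q) (\<lambda>l. W q l \<zeta>)) = g (S q \<zeta>)"
          using WS[of q] by eventually_elim simp
        show "(\<lambda>\<zeta>. g (poly_path (K q) (r q) (\<lambda>l. W q l \<zeta>))) \<in> borel_measurable N"
          by (rule measurable_compose[OF poly_path_measurable continuous_map_measurable[OF gc]]) (rule Wm)
        show "(\<lambda>\<zeta>. g (S q \<zeta>)) \<in> borel_measurable N"
          by (rule measurable_compose[OF Sm continuous_map_measurable[OF gc]])
      qed
      ultimately show ?thesis by simp
    qed
    show "(\<lambda>n. \<integral>\<xi>. g (scaled_path n \<xi>) \<partial>M) \<longlonglongrightarrow> (\<integral>\<zeta>. g (?Z \<zeta>) \<partial>N)"
    proof (rule LIMSEQ_I)
      fix d :: real assume d: "d > 0"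
      \<comment> \<open>Then \<open>L * (9 * e) \<le> d / 4\<close>, also for \<open>L = 0\<close>.
        This leaves room for the terms in \<open>H\<close> below \<open>d / 2\<close>; the other two
        comparisons get \<open>d / 4\<close> each.\<close>
      define e where "e = d / (36 * (L + 1))"
      have e: "e > 0" using d L by (simp add: e_def)
      have Le: "L * (9 * e) < d / 2"
      proof -
        have "L * (9 * e) \<le> (L + 1) * (9 * e)" using e by (intro mult_right_mono) auto
        also have "\<dots> = d / 4" using L by (simp add: e_def field_simps)
        finally show ?thesis using d by simp
      qed
      obtain H0 where H0: "H0 > 0" "\<And>H. H \<ge> H0 \<Longrightarrow> eventually (\<lambda>n.
         \<bar>expectation (\<lambda>x. g (scaled_path n x)) - expectation (\<lambda>x. g (poly_path (H\<^sup>2) (H\<^sup>2 * H) (\<lambda>l. incr (H\<^sup>2) n l x)))\<bar>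
         \<le> L * (9 * e + 1 / (1 + real H) + 7 / (real H * e ^ 4))) sequentially"
        using poly_path_approx[OF g b e] by blast
      have "(\<lambda>q. L * (9 * e + 1 / real (Suc (Suc q)) + (7 / e ^ 4) / real (Suc q))) \<longlonglongrightarrow> L * (9 * e + 0 + 0)"
        by (intro tendsto_intros LIMSEQ_Suc[OF LIMSEQ_Suc[OF lim_const_over_n]] LIMSEQ_Suc[OF lim_const_over_n])
      then have "eventually (\<lambda>q. L * (9 * e + 1 / real (Suc (Suc q)) + (7 / e ^ 4) / real (Suc q)) < d / 2) sequentially"
        by (rule order_tendstoD(2)) (use Le in simp)
      moreover have "eventually (\<lambda>q. dist (N.expectation (\<lambda>\<zeta>. g (poly_path (K q) (r q) (\<lambda>l. W q l \<zeta>))))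
          (N.expectation (\<lambda>\<zeta>. g (?Z \<zeta>))) < d / 4) sequentially"
        using Wlim by (rule tendstoD) (use d in simp)
      ultimately have "eventually (\<lambda>q. L * (9 * e + 1 / real (Suc (Suc q)) + (7 / e ^ 4) / real (Suc q)) < d / 2 \<and>
          dist (N.expectation (\<lambda>\<zeta>. g (poly_path (K q) (r q) (\<lambda>l. W q l \<zeta>)))) (N.expectation (\<lambda>\<zeta>. g (?Z \<zeta>))) < d / 4 \<and> q \<ge> H0) sequentially"
        using eventually_ge_at_top[of H0] by eventually_elim simp
      then obtain q where q: "L * (9 * e + 1 / real (Suc (Suc q)) + (7 / e ^ 4) / real (Suc q)) < d / 2"
        "dist (N.expectation (\<lambda>\<zeta>. g (poly_path (K q) (r q) (\<lambda>l. W q l \<zeta>)))) (N.expectation (\<lambda>\<zeta>. g (?Z \<zeta>))) < d / 4" "q \<ge> H0"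
        unfolding eventually_sequentially by blast
      have qH: "Suc q \<ge> H0" using q(3) by simp
      have eqb: "9 * e + 1 / (1 + real (Suc q)) + 7 / (real (Suc q) * e ^ 4) = 9 * e + 1 / real (Suc (Suc q)) + (7 / e ^ 4) / real (Suc q)"
        by simp
      have ev1: "eventually (\<lambda>n. \<bar>expectation (\<lambda>x. g (scaled_path n x)) - expectation (\<lambda>x. g (poly_path (K q) (r q) (\<lambda>l. incr (K q) n l x)))\<bar> < d / 2) sequentially"
        using H0(2)[OF qH]
      proof eventually_elim
        case (elim n)
        from order.strict_trans1[OF elim[unfolded eqb] q(1)] show ?case by (simp only: K_def r_def)
      qed
      have ev2: "eventually (\<lambda>n. dist (expectation (\<lambda>x. g (poly_path (K q) (r q) (\<lambda>l. incr (K q) n l x))))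
          (N.expectation (\<lambda>\<zeta>. g (poly_path (K q) (r q) (\<lambda>l. W q l \<zeta>)))) < d / 4) sequentially"
        using joint by (rule tendstoD) (use d in simp)
      have "eventually (\<lambda>n. norm ((\<integral>\<xi>. g (scaled_path n \<xi>) \<partial>M) - (\<integral>\<zeta>. g (?Z \<zeta>) \<partial>N)) < d) sequentially"
        using ev1 ev2
      proof eventually_elim
        case (elim n)
        then show ?case using q(2) unfolding dist_real_def real_norm_def by linarith
      qed
      then show "\<exists>no. \<forall>n\<ge>no. norm ((\<integral>\<xi>. g (scaled_path n \<xi>) \<partial>M) - (\<integral>\<zeta>. g (?Z \<zeta>) \<partial>N)) < d"
        unfolding eventually_sequentially .
    qed
  qed
qed

end

section \<open>Paths and passage times\<close>

lemma path_weight_singleton [simp]: "path_weight w [x] = 0"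
  by (simp add: path_weight_def)

lemma path_weight_Cons: "path_weight w (x # y # P) = w {x, y} + path_weight w (y # P)"
  by (simp add: path_weight_def sum.lessThan_Suc_shift del: sum.lessThan_Suc)

lemma path_weight_append:
  "P \<noteq> [] \<Longrightarrow> Q \<noteq> [] \<Longrightarrow> path_weight w (P @ Q) = path_weight w P + w {last P, hd Q} + path_weight w Q"
proof (induction P)
  case (Cons x P)
  show ?case
  proof (cases P)
    case Nil
    then show ?thesis using Cons.prems by (cases Q) (auto simp: path_weight_Cons)
  next
    case (Cons y P')
    then show ?thesis using Cons.IH Cons.prems by (simp add: path_weight_Cons)
  qed
qed simp

lemma path_weight_join: "path_weight w (P @ x # Q) = path_weight w (P @ [x]) + path_weight w (x # Q)"
proof (cases "P = []")
  case False
  then show ?thesis using path_weight_append[of P "x # Q" w] path_weight_append[of P "[x]" w] by simp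
qed simp

lemma path_weight_nonneg: "(\<And>e. 0 \<le> w e) \<Longrightarrow> 0 \<le> path_weight w P"
  unfolding path_weight_def by (rule sum_nonneg) simp

lemma path_weight_cong:
  assumes "lattice_path d S x y P" "\<And>e. e \<in> lattice_edges d \<Longrightarrow> e \<subseteq> S \<Longrightarrow> w e = w' e"
  shows "path_weight w P = path_weight w' P"
  unfolding path_weight_def
proof (rule sum.cong[OF refl])
  fix k assume "k \<in> {..<length P - 1}"
  then have k: "Suc k < length P" by simp
  have "lattice_adj d (P ! k) (P ! Suc k)"
    using assms(1) k successively_nth[of "lattice_adj d" P k] by (simp add: lattice_path_def)
  then have "{P ! k, P ! Suc k} \<in> lattice_edges d" by (auto simp: lattice_edges_def)
  moreover have "{P ! k, P ! Suc k} \<subseteq> S"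
    using assms(1) k by (auto simp: lattice_path_def)
  ultimately show "w {P ! k, P ! Suc k} = w' {P ! k, P ! Suc k}" by (rule assms(2))
qed

lemma path_weight_mono: "(\<And>e. w e \<le> w' e) \<Longrightarrow> path_weight w P \<le> path_weight w' P"
  unfolding path_weight_def by (rule sum_mono) simp

lemma passage_time_eq_INF: "passage_time d S w x y = (INF P\<in>{P. lattice_path d S x y P}. path_weight w P)"
  unfolding passage_time_def by (rule arg_cong[where f=Inf]) auto

lemma passage_time_cong:
  assumes "\<And>e. e \<in> lattice_edges d \<Longrightarrow> e \<subseteq> S \<Longrightarrow> w e = w' e"
  shows "passage_time d S w x y = passage_time d S w' x y"
  unfolding passage_time_eq_INF using path_weight_cong[of d S x y _ w w'] assms
  by (intro arg_cong[where f=Inf] image_cong refl) auto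

lemma passage_time_le:
  assumes "lattice_path d S x y P" "\<And>e. 0 \<le> w e"
  shows "passage_time d S w x y \<le> path_weight w P"
  unfolding passage_time_eq_INF
  by (rule cINF_lower) (use assms path_weight_nonneg in \<open>auto intro!: bdd_belowI2[where m=0]\<close>)

text \<open>The path \<open>P0\<close> shows that the infimum is not taken over the empty set, where
  \<open>Inf\<close> has no meaning.\<close>

lemma passage_time_ge:
  assumes "lattice_path d S x y P0" "\<And>P. lattice_path d S x y P \<Longrightarrow> c \<le> path_weight w P"
  shows "c \<le> passage_time d S w x y"
  unfolding passage_time_eq_INF by (rule cINF_greatest) (use assms in auto)

lemma passage_time_nonneg:
  assumes "lattice_path d S x y P0" "\<And>e. 0 \<le> w e"
  shows "0 \<le> passage_time d S w x y"
  by (rule passage_time_ge[OF assms(1)]) (rule path_weight_nonneg[OF assms(2)])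

lemma lattice_path_join:
  assumes "lattice_path d S1 x z P" "lattice_path d S2 z y Q" "S1 \<subseteq> S" "S2 \<subseteq> S"
  shows "lattice_path d S x y (P @ tl Q)" "path_weight w (P @ tl Q) = path_weight w P + path_weight w Q"
proof -
  obtain Q' where Q: "Q = z # Q'" using assms(2) by (cases Q) (auto simp: lattice_path_def)
  obtain P' where P: "P = P' @ [z]"
    using assms(1) by (metis append_butlast_last_id lattice_path_def)
  show "path_weight w (P @ tl Q) = path_weight w P + path_weight w Q"
    unfolding P Q using path_weight_join[of w P' z Q'] by simp
  have "successively (lattice_adj d) (P @ Q')"
  proof (cases "Q' = []")
    case False
    then show ?thesis
      using assms(1,2) by (auto simp: lattice_path_def Q P successively_append_iff successively_Cons)
  qed (use assms(1) in \<open>simp add: lattice_path_def\<close>)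
  then show "lattice_path d S x y (P @ tl Q)"
    using assms by (auto simp: lattice_path_def Q last_append split: if_splits)
qed

lemma passage_time_triangle:
  assumes "lattice_path d S1 x z P0" "lattice_path d S2 z y Q0" "S1 \<subseteq> S" "S2 \<subseteq> S" "\<And>e. 0 \<le> w e"
  shows "passage_time d S w x y \<le> passage_time d S1 w x z + passage_time d S2 w z y"
proof -
  have *: "passage_time d S w x y \<le> path_weight w P + path_weight w Q"
    if "lattice_path d S1 x z P" "lattice_path d S2 z y Q" for P Q
    using passage_time_le[where w=w, OF lattice_path_join(1)[OF that assms(3,4)] assms(5)]
      lattice_path_join(2)[OF that assms(3,4), of w] by simp
  have "passage_time d S w x y - passage_time d S1 w x z \<le> passage_time d S2 w z y"
  proof (rule passage_time_ge[OF assms(2)])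
    fix Q assume Q: "lattice_path d S2 z y Q"
    have "passage_time d S w x y - path_weight w Q \<le> passage_time d S1 w x z"
      by (rule passage_time_ge[OF assms(1)]) (use *[OF _ Q] in \<open>simp add: algebra_simps\<close>)
    then show "passage_time d S w x y - passage_time d S1 w x z \<le> path_weight w Q" by simp
  qed
  then show ?thesis by simp
qed

section \<open>Slabs\<close>

text \<open>Half open in the columns, so that adjacent slabs have no point in common; the edges from
  column \<open>b - 1\<close> to column \<open>b\<close> belong to neither of the slabs that meet
  there.\<close>

definition slab :: "nat \<Rightarrow> nat \<Rightarrow> nat \<Rightarrow> nat \<Rightarrow> (nat \<Rightarrow> int) set" where
  "slab d h a b = {x \<in> cylinder d h. int a \<le> x 0 \<and> x 0 < int b}"

lemma slab_mono: "a' \<le> a \<Longrightarrow> b \<le> b' \<Longrightarrow> slab d h a b \<subseteq> slab d h a' b'"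
  by (auto simp: slab_def)

lemma box_eq_slab: "box d n h = slab d h 0 (Suc n)"
  by (auto simp: box_def slab_def)

lemma axis_point_in_slab: "d > 0 \<Longrightarrow> a \<le> n \<Longrightarrow> n < b \<Longrightarrow> axis_point n \<in> slab d h a b"
  by (auto simp: axis_point_def slab_def cylinder_def lattice_points_def)

lemma axis_point_0 [simp]: "axis_point n 0 = int n"
  by (simp add: axis_point_def)

lemma finite_slab: "finite (slab d h a b)"
proof (rule finite_subset)
  let ?B = "{- int h..int h} \<union> {int a..<int b} \<union> {0}"
  show "slab d h a b \<subseteq> {f. \<forall>i. (i \<in> {..<d} \<longrightarrow> f i \<in> ?B) \<and> (i \<notin> {..<d} \<longrightarrow> f i = 0)}"
  proof
    fix x assume x: "x \<in> slab d h a b"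
    have "x i \<in> ?B" if "i < d" for i
      using x that by (cases "i = 0") (auto simp: slab_def cylinder_def)
    then show "x \<in> {f. \<forall>i. (i \<in> {..<d} \<longrightarrow> f i \<in> ?B) \<and> (i \<notin> {..<d} \<longrightarrow> f i = 0)}"
      using x by (auto simp: slab_def cylinder_def lattice_points_def)
  qed
  show "finite {f. \<forall>i. (i \<in> {..<d} \<longrightarrow> f i \<in> ?B) \<and> (i \<notin> {..<d} \<longrightarrow> f i = (0::int))}"
    by (rule finite_set_of_finite_funs) auto
qed

lemma lattice_adj_coord: "d > 0 \<Longrightarrow> lattice_adj d x y \<Longrightarrow> \<bar>x 0 - y 0\<bar> \<le> 1"
proof -
  assume "d > 0" "lattice_adj d x y"
  moreover have "\<bar>x 0 - y 0\<bar> \<le> (\<Sum>i<d. \<bar>x i - y i\<bar>)"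
    by (rule member_le_sum) (use \<open>d > 0\<close> in auto)
  ultimately show ?thesis by (simp add: lattice_adj_def)
qed

lemma lattice_adj_update:
  assumes "x \<in> lattice_points d" "i < d" "\<bar>c\<bar> = 1"
  shows "lattice_adj d x (x(i := x i + c))"
proof -
  have "(\<Sum>j<d. \<bar>x j - (x(i := x i + c)) j\<bar>) = (\<Sum>j<d. if j = i then 1 else 0)"
    by (rule sum.cong) (use assms in auto)
  then show ?thesis using assms by (auto simp: lattice_adj_def lattice_points_def)
qed

lemma lattice_adj_axis: "d > 0 \<Longrightarrow> lattice_adj d (axis_point n) (axis_point (Suc n))"
proof -
  assume d: "d > 0"
  have "axis_point (Suc n) = (axis_point n)(0 := axis_point n 0 + 1)"
    by (auto simp: axis_point_def)
  moreover have "axis_point n \<in> lattice_points d"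
    using d by (auto simp: axis_point_def lattice_points_def)
  ultimately show ?thesis using lattice_adj_update[of "axis_point n" d 0 1] d by simp
qed

text \<open>Moving one coordinate of \<open>x\<close> by one towards \<open>y\<close> decreases the
  l1 distance and keeps the point between \<open>x\<close> and \<open>y\<close> in each coordinate,
  hence in the slab.\<close>

lemma slab_connected:
  assumes "d > 0" "x \<in> slab d h a b" "y \<in> slab d h a b"
  shows "\<exists>P. lattice_path d (slab d h a b) x y P"
  using assms(2)
proof (induction "nat (\<Sum>i<d. \<bar>x i - y i\<bar>)" arbitrary: x rule: less_induct)
  case (less x)
  show ?case
  proof (cases "x = y")
    case True
    then have "lattice_path d (slab d h a b) x y [x]" using less.prems by (simp add: lattice_path_def)
    then show ?thesis by blast
  next
    case False
    have pts: "x \<in> lattice_points d" "y \<in> lattice_points d"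
      using less.prems assms(3) by (auto simp: slab_def cylinder_def)
    obtain i where i: "x i \<noteq> y i" using False by auto
    then have id: "i < d" using pts unfolding lattice_points_def by (metis (mono_tags, lifting) mem_Collect_eq not_le)
    define c where "c = sgn (y i - x i)"
    have c: "\<bar>c\<bar> = 1" using i by (auto simp: c_def sgn_if)
    define x' where "x' = x(i := x i + c)"
    have adj: "lattice_adj d x x'" unfolding x'_def by (rule lattice_adj_update[OF pts(1) id c])
    have dec: "\<bar>x' i - y i\<bar> = \<bar>x i - y i\<bar> - 1" using i by (auto simp: x'_def c_def sgn_if)
    have betw: "x' j \<in> {min (x j) (y j)..max (x j) (y j)}" for j
      using i by (auto simp: x'_def c_def sgn_if min_def max_def)
    have x'S: "x' \<in> slab d h a b"
    proof -
      have "x' \<in> lattice_points d" using adj by (simp add: lattice_adj_def)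
      moreover have "x' j \<in> {- int h..int h}" if "j \<in> {1..<d}" for j
      proof -
        have "x j \<in> {- int h..int h}" "y j \<in> {- int h..int h}"
          using less.prems assms(3) that by (auto simp: slab_def cylinder_def)
        then show ?thesis using betw[of j] by (auto simp: min_def max_def split: if_splits)
      qed
      moreover have "int a \<le> x' 0" "x' 0 < int b"
        using betw[of 0] less.prems assms(3) by (auto simp: slab_def min_def max_def split: if_splits)
      ultimately show ?thesis by (auto simp: slab_def cylinder_def)
    qed
    have "(\<Sum>j<d. \<bar>x' j - y j\<bar>) < (\<Sum>j<d. \<bar>x j - y j\<bar>)"
      by (rule sum_strict_mono_ex1) (use dec id in \<open>auto simp: x'_def\<close>)
    moreover have "0 \<le> (\<Sum>j<d. \<bar>x' j - y j\<bar>)" by (rule sum_nonneg) simp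
    ultimately have "nat (\<Sum>j<d. \<bar>x' j - y j\<bar>) < nat (\<Sum>j<d. \<bar>x j - y j\<bar>)" by linarith
    from less.hyps[OF this x'S] obtain P where P: "lattice_path d (slab d h a b) x' y P" by blast
    have "lattice_path d (slab d h a b) x y (x # P)"
      using P adj less.prems by (auto simp: lattice_path_def successively_Cons)
    then show ?thesis by blast
  qed
qed

text \<open>A discrete intermediate value theorem: one step changes coordinate 0 by at most one, so
  the first point at or beyond column \<open>b\<close> lies in column \<open>b\<close>.\<close>

lemma first_entry:
  assumes "d > 0" "successively (lattice_adj d) Q" "Q \<noteq> []" "hd Q 0 \<le> b" "b \<le> last Q 0"
  obtains Q1 z Q2 where "Q = Q1 @ z # Q2" "z 0 = b" "\<And>x. x \<in> set Q1 \<Longrightarrow> x 0 < b"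
proof -
  have "\<exists>x\<in>set Q. b \<le> x 0" using assms(3,5) by (intro bexI[of _ "last Q"]) auto
  then obtain Q1 z Q2 where Q: "Q = Q1 @ z # Q2" "b \<le> z 0" "\<forall>x\<in>set Q1. \<not> b \<le> x 0"
    using split_list_first_prop[of Q "\<lambda>x. b \<le> x 0"] by blast
  have "z 0 \<le> b"
  proof (cases "Q1 = []")
    case True
    then show ?thesis using Q assms(4) by simp
  next
    case False
    then have "lattice_adj d (last Q1) z" using assms(2) Q(1) by (auto simp: successively_append_iff)
    moreover have "last Q1 0 < b" using bspec[OF Q(3) last_in_set[OF False]] by simp
    ultimately show ?thesis using lattice_adj_coord[OF assms(1)] by fastforce
  qed
  then have zb: "z 0 = b" using Q(2) by simp
  show ?thesis
  proof (rule that[OF Q(1) zb])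
    fix x assume "x \<in> set Q1"
    from bspec[OF Q(3) this] show "x 0 < b" by simp
  qed
qed

text \<open>The same at the last visit: the piece after \<open>z\<close> remains strictly to the
  right of column \<open>b\<close>.\<close>

lemma last_entry:
  assumes "d > 0" "successively (lattice_adj d) Q" "Q \<noteq> []" "hd Q 0 \<le> b" "b \<le> last Q 0"
  obtains Q1 z Q2 where "Q = Q1 @ z # Q2" "z 0 = b" "\<And>x. x \<in> set Q2 \<Longrightarrow> b < x 0"
proof -
  have "\<exists>x\<in>set Q. x 0 \<le> b" using assms(3,4) by (intro bexI[of _ "hd Q"]) auto
  then obtain Q1 z Q2 where Q: "Q = Q1 @ z # Q2" "z 0 \<le> b" "\<forall>x\<in>set Q2. \<not> x 0 \<le> b"
    using split_list_last_prop[of Q "\<lambda>x. x 0 \<le> b"] by blast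
  have "b \<le> z 0"
  proof (cases "Q2 = []")
    case True
    then show ?thesis using Q assms(5) by simp
  next
    case False
    then have "lattice_adj d z (hd Q2)" using assms(2) Q(1) by (auto simp: successively_append_iff successively_Cons)
    moreover have "b < hd Q2 0" using bspec[OF Q(3) hd_in_set[OF False]] by simp
    ultimately show ?thesis using lattice_adj_coord[OF assms(1)] by fastforce
  qed
  then have zb: "z 0 = b" using Q(2) by simp
  show ?thesis
  proof (rule that[OF Q(1) zb])
    fix x assume "x \<in> set Q2"
    from bspec[OF Q(3) this] show "b < x 0" by simp
  qed
qed

text \<open>Both directions are included in \<open>col_cost\<close>, so that reversal of paths is never needed.\<close>

definition col_cost :: "nat \<Rightarrow> nat \<Rightarrow> ((nat \<Rightarrow> int) set \<Rightarrow> real) \<Rightarrow> nat \<Rightarrow> real" where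
  "col_cost d h w a = (\<Sum>u\<in>slab d h a (Suc a). passage_time d (slab d h a (Suc a)) w u (axis_point a)
     + passage_time d (slab d h a (Suc a)) w (axis_point a) u)"

text \<open>The target is in column \<open>b - 1\<close>, the last one of the slab, so the time
  across the box of length \<open>n\<close> is \<open>slab_time d h w 0 (Suc n)\<close>. The value 0
  for an empty slab makes near additivity hold for trivial cuts too.\<close>

definition slab_time :: "nat \<Rightarrow> nat \<Rightarrow> ((nat \<Rightarrow> int) set \<Rightarrow> real) \<Rightarrow> nat \<Rightarrow> nat \<Rightarrow> real" where
  "slab_time d h w a b = (if a < b
     then passage_time d (slab d h a b) w (axis_point a) (axis_point (b - 1)) else 0)"

text \<open>For \<open>b = 0\<close> the pair of axis points would degenerate to a singleton, which is not an edge.\<close>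

definition cut_cost :: "nat \<Rightarrow> nat \<Rightarrow> ((nat \<Rightarrow> int) set \<Rightarrow> real) \<Rightarrow> nat \<Rightarrow> real" where
  "cut_cost d h w b = (if b = 0 then 0
     else col_cost d h w (b - 1) + col_cost d h w b + w {axis_point (b - 1), axis_point b})"

section \<open>Near additivity of slab times\<close>

context
  fixes d h :: nat and w :: "(nat \<Rightarrow> int) set \<Rightarrow> real"
  assumes d: "d > 0" and w: "\<And>e. 0 \<le> w e"
begin

lemma slab_passage_time_nonneg:
  "x \<in> slab d h a b \<Longrightarrow> y \<in> slab d h a b \<Longrightarrow> 0 \<le> passage_time d (slab d h a b) w x y"
  using slab_connected[OF d] passage_time_nonneg w by metis

lemma col_cost_bounds:
  assumes "u \<in> slab d h a (Suc a)"
  shows "passage_time d (slab d h a (Suc a)) w u (axis_point a) \<le> col_cost d h w a"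
    "passage_time d (slab d h a (Suc a)) w (axis_point a) u \<le> col_cost d h w a"
proof -
  let ?f = "\<lambda>u. passage_time d (slab d h a (Suc a)) w u (axis_point a)"
  let ?g = "\<lambda>u. passage_time d (slab d h a (Suc a)) w (axis_point a) u"
  have ax: "axis_point a \<in> slab d h a (Suc a)" using d by (intro axis_point_in_slab) auto
  have nn: "0 \<le> ?f v" "0 \<le> ?g v" if "v \<in> slab d h a (Suc a)" for v
    using that ax by (auto intro: slab_passage_time_nonneg)
  have "?f u + ?g u \<le> col_cost d h w a"
    unfolding col_cost_def by (rule member_le_sum[OF assms _ finite_slab]) (use nn in auto)
  then show "?f u \<le> col_cost d h w a" "?g u \<le> col_cost d h w a"
    using nn[OF assms] by linarith+
qed

lemma col_cost_nonneg: "0 \<le> col_cost d h w a"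
proof -
  have ax: "axis_point a \<in> slab d h a (Suc a)" using d by (intro axis_point_in_slab) auto
  show ?thesis
    unfolding col_cost_def by (intro sum_nonneg add_nonneg_nonneg slab_passage_time_nonneg ax)
qed

lemma cut_cost_nonneg: "0 \<le> cut_cost d h w b"
  unfolding cut_cost_def using col_cost_nonneg w by (simp add: add_nonneg_nonneg)

text \<open>Optimal paths of the two slabs are joined by the axis edge across the cut.\<close>

lemma slab_time_subadditive:
  assumes "a < b" "b < c"
  shows "slab_time d h w a c \<le> slab_time d h w a b + w {axis_point (b - 1), axis_point b} + slab_time d h w b c"
proof -
  have le: "a \<le> b - 1" "b - 1 < b" "b \<le> c - 1" "c - 1 < c" using assms by auto
  obtain P1 where P1: "lattice_path d (slab d h a b) (axis_point a) (axis_point (b - 1)) P1"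
    using slab_connected[OF d axis_point_in_slab[OF d order_refl assms(1)] axis_point_in_slab[OF d le(1,2)]] by blast
  obtain P2 where P2: "lattice_path d (slab d h b c) (axis_point b) (axis_point (c - 1)) P2"
    using slab_connected[OF d axis_point_in_slab[OF d order_refl assms(2)] axis_point_in_slab[OF d le(3,4)]] by blast
  have sub: "slab d h (b - 1) (Suc b) \<subseteq> slab d h (b - 1) c" "slab d h b c \<subseteq> slab d h (b - 1) c"
    "slab d h a b \<subseteq> slab d h a c" "slab d h (b - 1) c \<subseteq> slab d h a c"
    by (rule slab_mono; use assms in simp)+
  let ?S = "slab d h (b - 1) (Suc b)"
  have e: "lattice_path d ?S (axis_point (b - 1)) (axis_point b) [axis_point (b - 1), axis_point b]"
    using lattice_adj_axis[OF d, of "b - 1"] assms axis_point_in_slab[OF d, of "b - 1" "b - 1" "Suc b" h]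
      axis_point_in_slab[OF d, of "b - 1" b "Suc b" h] by (simp add: lattice_path_def)
  have "passage_time d ?S w (axis_point (b - 1)) (axis_point b) \<le> w {axis_point (b - 1), axis_point b}"
    using passage_time_le[OF e w] by (simp add: path_weight_Cons)
  moreover have "passage_time d (slab d h (b - 1) c) w (axis_point (b - 1)) (axis_point (c - 1))
      \<le> passage_time d ?S w (axis_point (b - 1)) (axis_point b) + passage_time d (slab d h b c) w (axis_point b) (axis_point (c - 1))"
    by (rule passage_time_triangle[OF e P2 sub(1,2) w])
  moreover have "passage_time d (slab d h a c) w (axis_point a) (axis_point (c - 1))
      \<le> passage_time d (slab d h a b) w (axis_point a) (axis_point (b - 1))
        + passage_time d (slab d h (b - 1) c) w (axis_point (b - 1)) (axis_point (c - 1))"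
    by (rule passage_time_triangle[OF P1 lattice_path_join(1)[OF e P2 sub(1,2)] sub(3,4) w])
  ultimately show ?thesis using assms by (simp add: slab_time_def)
qed

text \<open>A path may cross the cut many times. Its piece up to the first visit to column
  \<open>b - 1\<close> stays in the left slab, and its piece from the last visit to column
  \<open>b\<close> on stays in the right one; whatever lies between is dropped, as weights are
  nonnegative. The loose ends are led to the axis inside their columns, which is what
  \<open>col_cost\<close> pays for.\<close>

lemma slab_time_superadditive:
  assumes "a < b" "b < c"
  shows "slab_time d h w a b + slab_time d h w b c \<le> slab_time d h w a c + col_cost d h w (b - 1) + col_cost d h w b"
proof -
  have axs: "axis_point a \<in> slab d h a c" "axis_point (c - 1) \<in> slab d h a c"
    using assms by (auto intro!: axis_point_in_slab d)
  obtain P0 where P0: "lattice_path d (slab d h a c) (axis_point a) (axis_point (c - 1)) P0"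
    using slab_connected[OF d axs] by blast
  have "slab_time d h w a b + slab_time d h w b c - col_cost d h w (b - 1) - col_cost d h w b
      \<le> passage_time d (slab d h a c) w (axis_point a) (axis_point (c - 1))"
  proof (rule passage_time_ge[OF P0])
    fix P assume P: "lattice_path d (slab d h a c) (axis_point a) (axis_point (c - 1)) P"
    then have Pp: "P \<noteq> []" "hd P = axis_point a" "last P = axis_point (c - 1)" "set P \<subseteq> slab d h a c"
      "successively (lattice_adj d) P" by (auto simp: lattice_path_def)
    obtain Q1 z R where 1: "P = Q1 @ z # R" "z 0 = int (b - 1)" "\<And>x. x \<in> set Q1 \<Longrightarrow> x 0 < int (b - 1)"
      using first_entry[OF d Pp(5,1), of "int (b - 1)"] Pp(2,3) assms by auto
    have Rne: "R \<noteq> []"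
    proof
      assume "R = []"
      then have "z = axis_point (c - 1)" using Pp(3) 1(1) by simp
      then show False using 1(2) assms by simp
    qed
    have Rs: "successively (lattice_adj d) R" "lattice_adj d z (hd R)" "last R = axis_point (c - 1)"
      using Pp(3,5) 1(1) Rne by (auto simp: successively_append_iff successively_Cons)
    \<comment> \<open>One step after column \<open>b - 1\<close> the path is at most in column
      \<open>b\<close>, so the rest of it does visit column \<open>b\<close>.\<close>
    have "hd R 0 \<le> int b" using lattice_adj_coord[OF d Rs(2)] 1(2) assms by linarith
    then obtain R1 y R2 where 2: "R = R1 @ y # R2" "y 0 = int b" "\<And>x. x \<in> set R2 \<Longrightarrow> int b < x 0"
      using last_entry[OF d Rs(1) Rne, of "int b"] Rs(3) assms by auto
    have A: "lattice_path d (slab d h a b) (axis_point a) z (Q1 @ [z])"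
      unfolding lattice_path_def
    proof (intro conjI)
      show "hd (Q1 @ [z]) = axis_point a" using Pp(2) 1(1) by (cases Q1) auto
      show "set (Q1 @ [z]) \<subseteq> slab d h a b"
        using Pp(4) 1 assms by (fastforce simp: slab_def)
      show "successively (lattice_adj d) (Q1 @ [z])"
        using Pp(5) unfolding 1(1) by (auto simp: successively_append_iff)
    qed auto
    have B: "lattice_path d (slab d h b c) y (axis_point (c - 1)) (y # R2)"
      unfolding lattice_path_def
    proof (intro conjI)
      show "last (y # R2) = axis_point (c - 1)" using Rs(3) 2(1) by simp
      show "set (y # R2) \<subseteq> slab d h b c"
        using Pp(4) 1(1) 2 by (fastforce simp: slab_def)
      show "successively (lattice_adj d) (y # R2)"
        using Rs(1) unfolding 2(1) by (auto simp: successively_append_iff)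
    qed auto
    have zc: "z \<in> slab d h (b - 1) (Suc (b - 1))" using Pp(4) 1 by (auto simp: slab_def)
    have yc: "y \<in> slab d h b (Suc b)" using Pp(4) 1(1) 2 by (auto simp: slab_def)
    have axc: "axis_point k \<in> slab d h k (Suc k)" for k by (auto intro!: axis_point_in_slab d)
    obtain Pz where Pz: "lattice_path d (slab d h (b - 1) (Suc (b - 1))) z (axis_point (b - 1)) Pz"
      using slab_connected[OF d zc axc] by blast
    obtain Py where Py: "lattice_path d (slab d h b (Suc b)) (axis_point b) y Py"
      using slab_connected[OF d axc yc] by blast
    have s1: "slab d h (b - 1) (Suc (b - 1)) \<subseteq> slab d h a b" by (rule slab_mono) (use assms in auto)
    have s2: "slab d h b (Suc b) \<subseteq> slab d h b c" by (rule slab_mono) (use assms in auto)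
    have "slab_time d h w a b \<le> passage_time d (slab d h a b) w (axis_point a) z
        + passage_time d (slab d h (b - 1) (Suc (b - 1))) w z (axis_point (b - 1))"
      using passage_time_triangle[OF A Pz order_refl s1 w] assms by (simp add: slab_time_def)
    also have "\<dots> \<le> path_weight w (Q1 @ [z]) + col_cost d h w (b - 1)"
      by (intro add_mono passage_time_le[OF A w] col_cost_bounds zc)
    finally have TA: "slab_time d h w a b \<le> path_weight w (Q1 @ [z]) + col_cost d h w (b - 1)" .
    have "slab_time d h w b c \<le> passage_time d (slab d h b (Suc b)) w (axis_point b) y
        + passage_time d (slab d h b c) w y (axis_point (c - 1))"
      using passage_time_triangle[OF Py B s2 order_refl w] assms by (simp add: slab_time_def)
    also have "\<dots> \<le> col_cost d h w b + path_weight w (y # R2)"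
      by (intro add_mono passage_time_le[OF B w] col_cost_bounds yc)
    finally have TB: "slab_time d h w b c \<le> col_cost d h w b + path_weight w (y # R2)" .
    have "path_weight w P = path_weight w (Q1 @ [z]) + w {z, hd R} + path_weight w R"
      using path_weight_append[of "Q1 @ [z]" R w] Rne 1(1) by simp
    moreover have "path_weight w R = path_weight w (R1 @ [y]) + path_weight w (y # R2)"
      unfolding 2(1) by (rule path_weight_join)
    ultimately have "path_weight w (Q1 @ [z]) + path_weight w (y # R2) \<le> path_weight w P"
      using w[of "{z, hd R}"] path_weight_nonneg[where w=w and P="R1 @ [y]", OF w] by linarith
    then show "slab_time d h w a b + slab_time d h w b c - col_cost d h w (b - 1) - col_cost d h w b \<le> path_weight w P"
      using TA TB by linarith
  qed
  then show ?thesis using assms by (simp add: slab_time_def)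
qed

lemma slab_time_nearly_additive:
  assumes "a \<le> b" "b \<le> c"
  shows "\<bar>slab_time d h w a c - slab_time d h w a b - slab_time d h w b c\<bar> \<le> cut_cost d h w b"
proof (cases "a < b \<and> b < c")
  case True
  then have "b \<noteq> 0" by auto
  then have C: "cut_cost d h w b = col_cost d h w (b - 1) + col_cost d h w b + w {axis_point (b - 1), axis_point b}"
    by (simp add: cut_cost_def)
  show ?thesis
    unfolding C using slab_time_subadditive[of a b c] slab_time_superadditive[of a b c] True
      w[of "{axis_point (b - 1), axis_point b}"] col_cost_nonneg[of b] col_cost_nonneg[of "b - 1"] by linarith
next
  case False
  then have "a = b \<or> b = c" using assms by auto
  then show ?thesis using cut_cost_nonneg by (auto simp: slab_time_def)
qed

text \<open>A path in the cylinder may leave the columns \<open>0\<close> to \<open>n\<close> on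
  both sides. The piece between the last visit to column 0 and the first visit to column
  \<open>n\<close> does not, and its ends can be led to the axis inside their columns.\<close>

lemma cylinder_time_close:
  "\<bar>passage_time d (cylinder d h) w (axis_point 0) (axis_point n) - slab_time d h w 0 (Suc n)\<bar>
    \<le> col_cost d h w 0 + col_cost d h w n"
proof -
  let ?t = "passage_time d (slab d h 0 (Suc n)) w (axis_point 0) (axis_point n)"
  have t: "slab_time d h w 0 (Suc n) = ?t" by (simp add: slab_time_def)
  have axs: "axis_point 0 \<in> slab d h 0 (Suc n)" "axis_point n \<in> slab d h 0 (Suc n)"
    by (auto intro!: axis_point_in_slab d)
  obtain P0 where P0: "lattice_path d (slab d h 0 (Suc n)) (axis_point 0) (axis_point n) P0"
    using slab_connected[OF d axs] by blast
  have sub: "lattice_path d (cylinder d h) x y P" if "lattice_path d (slab d h a b) x y P" for x y P a b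
    using that by (auto simp: lattice_path_def slab_def)
  have "passage_time d (cylinder d h) w (axis_point 0) (axis_point n) \<le> ?t"
    by (rule passage_time_ge[OF P0]) (rule passage_time_le[OF sub w])
  moreover have "?t - col_cost d h w 0 - col_cost d h w n \<le> passage_time d (cylinder d h) w (axis_point 0) (axis_point n)"
  proof (rule passage_time_ge[OF sub[OF P0]])
    fix P assume P: "lattice_path d (cylinder d h) (axis_point 0) (axis_point n) P"
    then have Pp: "P \<noteq> []" "hd P = axis_point 0" "last P = axis_point n" "set P \<subseteq> cylinder d h"
      "successively (lattice_adj d) P" by (auto simp: lattice_path_def)
    obtain Q1 z Q2 where 1: "P = Q1 @ z # Q2" "z 0 = int n" "\<And>x. x \<in> set Q1 \<Longrightarrow> x 0 < int n"
      using first_entry[OF d Pp(5,1), of "int n"] Pp(2,3) by auto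
    have Rs: "successively (lattice_adj d) (Q1 @ [z])"
      using Pp(5) unfolding 1(1) by (auto simp: successively_append_iff)
    have hdR: "hd (Q1 @ [z]) = axis_point 0" using Pp(2) 1(1) by (cases Q1) auto
    \<comment> \<open>The last visit to column 0 is sought before the first visit to column
      \<open>n\<close>, so that both bounds on the columns hold for the piece.\<close>
    obtain R1 y R2 where 2: "Q1 @ [z] = R1 @ y # R2" "y 0 = 0" "\<And>x. x \<in> set R2 \<Longrightarrow> 0 < x 0"
      using last_entry[OF d Rs, of 0] hdR 1(2) by auto
    have setR: "set (R1 @ y # R2) = set Q1 \<union> {z}" unfolding 2(1)[symmetric] by simp
    have R: "lattice_path d (slab d h 0 (Suc n)) y z (y # R2)"
      unfolding lattice_path_def
    proof (intro conjI)
      have "last (y # R2) = last (R1 @ y # R2)" by simp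
      also have "\<dots> = z" unfolding 2(1)[symmetric] by simp
      finally show "last (y # R2) = z" .
      show "set (y # R2) \<subseteq> slab d h 0 (Suc n)"
      proof
        fix x assume x: "x \<in> set (y # R2)"
        then have "x \<in> set Q1 \<union> {z}" using setR by auto
        then have "x \<in> cylinder d h" "x 0 \<le> int n" using Pp(4) 1 by fastforce+
        moreover have "0 \<le> x 0" using x 2 by fastforce
        ultimately show "x \<in> slab d h 0 (Suc n)" by (simp add: slab_def)
      qed
      show "successively (lattice_adj d) (y # R2)"
        using Rs unfolding 2(1) by (auto simp: successively_append_iff)
    qed auto
    have zc: "z \<in> slab d h n (Suc n)" using Pp(4) 1 by (auto simp: slab_def)
    have "y \<in> set P" using setR 1(1) by auto
    then have yc: "y \<in> slab d h 0 (Suc 0)" using Pp(4) 2(2) by (auto simp: slab_def)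
    have axc: "axis_point k \<in> slab d h k (Suc k)" for k by (auto intro!: axis_point_in_slab d)
    obtain Py where Py: "lattice_path d (slab d h 0 (Suc 0)) (axis_point 0) y Py"
      using slab_connected[OF d axc yc] by blast
    obtain Pz where Pz: "lattice_path d (slab d h n (Suc n)) z (axis_point n) Pz"
      using slab_connected[OF d zc axc] by blast
    have s1: "slab d h n (Suc n) \<subseteq> slab d h 0 (Suc n)" "slab d h 0 (Suc 0) \<subseteq> slab d h 0 (Suc n)"
      by (rule slab_mono; simp)+
    have "passage_time d (slab d h 0 (Suc n)) w y (axis_point n)
        \<le> passage_time d (slab d h 0 (Suc n)) w y z + passage_time d (slab d h n (Suc n)) w z (axis_point n)"
      by (rule passage_time_triangle[OF R Pz _ s1(1) w]) simp
    moreover have "?t \<le> passage_time d (slab d h 0 (Suc 0)) w (axis_point 0) y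
        + passage_time d (slab d h 0 (Suc n)) w y (axis_point n)"
      by (rule passage_time_triangle[OF Py lattice_path_join(1)[OF R Pz _ s1(1)] s1(2) _ w]) auto
    moreover have "passage_time d (slab d h 0 (Suc n)) w y z \<le> path_weight w (y # R2)"
      by (rule passage_time_le[OF R w])
    moreover have "path_weight w (y # R2) \<le> path_weight w P"
    proof -
      have "path_weight w P = path_weight w (Q1 @ [z]) + path_weight w (z # Q2)"
        unfolding 1(1) by (rule path_weight_join)
      moreover have "path_weight w (Q1 @ [z]) = path_weight w (R1 @ [y]) + path_weight w (y # R2)"
        unfolding 2(1) by (rule path_weight_join)
      ultimately show ?thesis
        using path_weight_nonneg[where w=w and P="z # Q2", OF w] path_weight_nonneg[where w=w and P="R1 @ [y]", OF w] by linarith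
    qed
    ultimately show "?t - col_cost d h w 0 - col_cost d h w n \<le> path_weight w P"
      using col_cost_bounds(1)[OF zc] col_cost_bounds(2)[OF yc] by linarith
  qed
  ultimately show ?thesis
    unfolding t using col_cost_nonneg[of 0] col_cost_nonneg[of n] by linarith
qed

end

section \<open>Translations and layers\<close>

definition shift :: "nat \<Rightarrow> (nat \<Rightarrow> int) \<Rightarrow> nat \<Rightarrow> int" where
  "shift k x = x(0 := x 0 + int k)"

lemma shift_apply_0 [simp]: "shift k x 0 = x 0 + int k"
  by (simp add: shift_def)

lemma shift_apply [simp]: "i \<noteq> 0 \<Longrightarrow> shift k x i = x i"
  by (simp add: shift_def)

lemma inj_shift: "inj (shift k)"
proof (rule injI)
  fix x y assume eq: "shift k x = shift k y"
  show "x = y"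
  proof
    fix i
    from fun_cong[OF eq, of i] show "x i = y i" by (cases "i = 0") simp_all
  qed
qed

lemma shift_axis_point: "shift k (axis_point n) = axis_point (n + k)"
  by (auto simp: shift_def axis_point_def)

lemma shift_lattice_points: "d > 0 \<Longrightarrow> shift k x \<in> lattice_points d \<longleftrightarrow> x \<in> lattice_points d"
  by (auto simp: shift_def lattice_points_def)

lemma lattice_adj_shift: "d > 0 \<Longrightarrow> lattice_adj d (shift k x) (shift k y) \<longleftrightarrow> lattice_adj d x y"
proof -
  assume d: "d > 0"
  have "\<bar>shift k x i - shift k y i\<bar> = \<bar>x i - y i\<bar>" for i by (cases "i = 0") simp_all
  then show ?thesis by (simp add: lattice_adj_def shift_lattice_points[OF d])
qed

lemma cylinder_shift: "d > 0 \<Longrightarrow> shift k x \<in> cylinder d h \<longleftrightarrow> x \<in> cylinder d h"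
  by (auto simp: cylinder_def shift_lattice_points)

lemma slab_shift: "d > 0 \<Longrightarrow> slab d h (a + k) (b + k) = shift k ` slab d h a b"
proof (intro set_eqI iffI)
  fix x assume d: "d > 0" and x: "x \<in> slab d h (a + k) (b + k)"
  define y where "y = x(0 := x 0 - int k)"
  have xy: "x = shift k y" by (auto simp: y_def shift_def)
  have "y \<in> slab d h a b"
    using x cylinder_shift[OF d, of k y h] unfolding xy by (auto simp: slab_def)
  then show "x \<in> shift k ` slab d h a b" using xy by blast
next
  fix x assume d: "d > 0" and "x \<in> shift k ` slab d h a b"
  then show "x \<in> slab d h (a + k) (b + k)"
    by (auto simp: slab_def cylinder_shift)
qed

lemma lattice_edges_shift: "d > 0 \<Longrightarrow> e \<in> lattice_edges d \<Longrightarrow> shift k ` e \<in> lattice_edges d"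
proof -
  assume d: "d > 0" and "e \<in> lattice_edges d"
  then obtain x y where "e = {x, y}" "lattice_adj d x y" by (auto simp: lattice_edges_def)
  then show ?thesis
    unfolding lattice_edges_def
    by (intro CollectI exI[of _ "shift k x"] exI[of _ "shift k y"]) (simp add: lattice_adj_shift[OF d])
qed

lemma path_weight_shift: "path_weight w (map (shift k) P) = path_weight (\<lambda>e. w (shift k ` e)) P"
  unfolding path_weight_def by (rule sum.cong) auto

lemma lattice_path_shift:
  "d > 0 \<Longrightarrow> lattice_path d (shift k ` S) (shift k x) (shift k y) (map (shift k) P) \<longleftrightarrow> lattice_path d S x y P"
proof -
  assume d: "d > 0"
  have "successively (lattice_adj d) (map (shift k) P) \<longleftrightarrow> successively (lattice_adj d) P"
    by (simp add: successively_map lattice_adj_shift[OF d])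
  moreover have "set (map (shift k) P) \<subseteq> shift k ` S \<longleftrightarrow> set P \<subseteq> S"
    by (simp add: inj_image_subset_iff[OF inj_shift])
  ultimately show ?thesis
    by (cases "P = []") (simp_all add: lattice_path_def hd_map last_map inj_eq[OF inj_shift])
qed

lemma passage_time_shift:
  assumes d: "d > 0"
  shows "passage_time d (shift k ` S) w (shift k x) (shift k y) = passage_time d S (\<lambda>e. w (shift k ` e)) x y"
proof -
  have "{path_weight w P |P. lattice_path d (shift k ` S) (shift k x) (shift k y) P}
      = {path_weight (\<lambda>e. w (shift k ` e)) P |P. lattice_path d S x y P}" (is "?A = ?B")
  proof (intro set_eqI iffI)
    fix r assume "r \<in> ?A"
    then obtain P where P: "r = path_weight w P" "lattice_path d (shift k ` S) (shift k x) (shift k y) P" by blast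
    then have "set P \<subseteq> shift k ` S" by (simp add: lattice_path_def)
    then have "P \<in> lists (shift k ` S)" by auto
    then obtain Q where Q: "P = map (shift k) Q" unfolding lists_image by blast
    then show "r \<in> ?B"
      using P lattice_path_shift[OF d, of k S x y Q] path_weight_shift[of w k Q] by auto
  next
    fix r assume "r \<in> ?B"
    then obtain P where "r = path_weight (\<lambda>e. w (shift k ` e)) P" "lattice_path d S x y P" by blast
    then have "r = path_weight w (map (shift k) P)"
      "lattice_path d (shift k ` S) (shift k x) (shift k y) (map (shift k) P)"
      by (simp_all add: path_weight_shift lattice_path_shift[OF d])
    then show "r \<in> ?A" by blast
  qed
  then show ?thesis by (simp add: passage_time_def)
qed

lemma slab_time_shift:
  assumes d: "d > 0"
  shows "slab_time d h w (a + k) (b + k) = slab_time d h (\<lambda>e. w (shift k ` e)) a b"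
proof (cases "a < b")
  case True
  then have "axis_point (b + k - 1) = shift k (axis_point (b - 1))" by (simp add: shift_axis_point)
  then show ?thesis
    using True by (simp add: slab_time_def slab_shift[OF d] shift_axis_point[symmetric] passage_time_shift[OF d])
qed (simp add: slab_time_def)

lemma col_cost_shift:
  assumes d: "d > 0"
  shows "col_cost d h w (a + k) = col_cost d h (\<lambda>e. w (shift k ` e)) a"
proof -
  have S: "slab d h (a + k) (Suc (a + k)) = shift k ` slab d h a (Suc a)"
    using slab_shift[OF d, of h a k "Suc a"] by simp
  show ?thesis
    unfolding col_cost_def S shift_axis_point[symmetric]
    by (subst sum.reindex) (auto intro!: sum.cong inj_on_subset[OF inj_shift] simp: passage_time_shift[OF d])
qed

text \<open>The reference cut is the one at 1, because \<open>cut_cost\<close> at 0 is zero by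
  definition.\<close>

lemma cut_cost_shift:
  assumes d: "d > 0"
  shows "cut_cost d h w (Suc k) = cut_cost d h (\<lambda>e. w (shift k ` e)) 1"
proof -
  have "shift k ` {axis_point 0, axis_point 1} = {axis_point k, axis_point (Suc k)}"
    by (simp add: shift_axis_point)
  then show ?thesis
    using col_cost_shift[OF d, of h w 0 k] col_cost_shift[OF d, of h w 1 k] by (simp add: cut_cost_def)
qed

section \<open>Layers of edges between neighbouring columns\<close>

definition layer :: "nat \<Rightarrow> nat \<Rightarrow> nat \<Rightarrow> (nat \<Rightarrow> int) set set" where
  "layer d h i = {{x, y} |x y. lattice_adj d x y \<and> x \<in> cylinder d h \<and> y \<in> cylinder d h \<and> x 0 = int i \<and> y 0 = int i + 1}"

lemma layer_subset: "layer d h i \<subseteq> lattice_edges d"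
  by (auto simp: layer_def lattice_edges_def)

lemma finite_layer: "finite (layer d h i)"
proof (rule finite_subset)
  show "layer d h i \<subseteq> Pow (slab d h i (i + 2))" by (auto simp: layer_def slab_def)
qed (simp add: finite_slab)

lemma layer_nonempty: "d > 0 \<Longrightarrow> layer d h i \<noteq> {}"
proof -
  assume d: "d > 0"
  have "axis_point i \<in> slab d h i (i + 2)" "axis_point (Suc i) \<in> slab d h i (i + 2)"
    by (auto intro!: axis_point_in_slab d)
  then have "{axis_point i, axis_point (Suc i)} \<in> layer d h i"
    using lattice_adj_axis[OF d, of i] unfolding layer_def
    by (intro CollectI exI[of _ "axis_point i"] exI[of _ "axis_point (Suc i)"]) (simp add: slab_def)
  then show ?thesis by blast
qed

lemma layer_disjoint: "i \<noteq> j \<Longrightarrow> layer d h i \<inter> layer d h j = {}"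
  by (auto simp: layer_def doubleton_eq_iff)

lemma layer_shift: "d > 0 \<Longrightarrow> layer d h k = (\<lambda>e. shift k ` e) ` layer d h 0"
proof (intro set_eqI iffI)
  fix e assume d: "d > 0" and "e \<in> layer d h k"
  then obtain x y where e: "e = {x, y}" "lattice_adj d x y" "x \<in> cylinder d h" "y \<in> cylinder d h"
    "x 0 = int k" "y 0 = int k + 1" by (auto simp: layer_def)
  define x' y' where "x' = x(0 := 0)" "y' = y(0 := 1)"
  have xy: "x = shift k x'" "y = shift k y'" using e by (auto simp: x'_y'_def shift_def)
  have "{x', y'} \<in> layer d h 0"
    using e(2-4) unfolding xy lattice_adj_shift[OF d] cylinder_shift[OF d] layer_def
    by (intro CollectI exI[of _ x'] exI[of _ y']) (simp add: x'_y'_def)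
  moreover have "e = shift k ` {x', y'}" unfolding e(1) by (simp add: xy)
  ultimately show "e \<in> (\<lambda>e. shift k ` e) ` layer d h 0" by blast
next
  fix e assume d: "d > 0" and "e \<in> (\<lambda>e. shift k ` e) ` layer d h 0"
  then obtain x y where e: "e = {shift k x, shift k y}" "lattice_adj d x y" "x \<in> cylinder d h" "y \<in> cylinder d h"
    "x 0 = 0" "y 0 = 1" by (auto simp: layer_def)
  then show "e \<in> layer d h k"
    unfolding layer_def by (intro CollectI exI[of _ "shift k x"] exI[of _ "shift k y"])
      (simp add: lattice_adj_shift[OF d] cylinder_shift[OF d])
qed

lemma card_layer: "d > 0 \<Longrightarrow> card (layer d h k) = card (layer d h 0)"
  unfolding layer_shift[of d h k]
  by (intro card_image inj_on_subset[OF inj_image_eq_iff[THEN iffD1, THEN injI, OF inj_shift]]) auto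

text \<open>Every path across a layer uses one of its edges.\<close>

lemma slab_time_layer:
  assumes d: "d > 0" and i: "a \<le> i" "Suc i < c" and w: "\<And>e. 0 \<le> w e"
    and le: "\<And>e. w e \<le> w' e" and gap: "\<And>e. e \<in> layer d h i \<Longrightarrow> w e + \<delta> \<le> w' e"
  shows "slab_time d h w a c + \<delta> \<le> slab_time d h w' a c"
proof -
  have axs: "axis_point a \<in> slab d h a c" "axis_point (c - 1) \<in> slab d h a c"
    using i by (auto intro!: axis_point_in_slab d)
  obtain P0 where P0: "lattice_path d (slab d h a c) (axis_point a) (axis_point (c - 1)) P0"
    using slab_connected[OF d axs] by blast
  have "passage_time d (slab d h a c) w (axis_point a) (axis_point (c - 1)) + \<delta>
      \<le> passage_time d (slab d h a c) w' (axis_point a) (axis_point (c - 1))"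
  proof (rule passage_time_ge[OF P0])
    fix P assume P: "lattice_path d (slab d h a c) (axis_point a) (axis_point (c - 1)) P"
    then have Pp: "P \<noteq> []" "hd P = axis_point a" "last P = axis_point (c - 1)" "set P \<subseteq> slab d h a c"
      "successively (lattice_adj d) P" by (auto simp: lattice_path_def)
    \<comment> \<open>The edge by which the path leaves column \<open>i\<close> for the last time
      belongs to the layer.\<close>
    obtain Q1 z Q2 where 1: "P = Q1 @ z # Q2" "z 0 = int i" "\<And>x. x \<in> set Q2 \<Longrightarrow> int i < x 0"
      using last_entry[OF d Pp(5,1), of "int i"] Pp(2,3) i by auto
    have ne: "Q2 \<noteq> []"
    proof
      assume "Q2 = []"
      then have "z = axis_point (c - 1)" using Pp(3) 1(1) by simp
      then show False using 1(2) i by simp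
    qed
    have adj: "lattice_adj d z (hd Q2)" using Pp(5) 1(1) ne by (auto simp: successively_append_iff successively_Cons)
    have "int i < hd Q2 0" using 1(3) hd_in_set[OF ne] by blast
    then have h0: "hd Q2 0 = int i + 1" using lattice_adj_coord[OF d adj] 1(2) by linarith
    have "{z, hd Q2} \<in> layer d h i"
    proof -
      have "z \<in> cylinder d h" "hd Q2 \<in> cylinder d h"
        using Pp(4) 1(1) hd_in_set[OF ne] by (auto simp: slab_def)
      then show ?thesis using adj h0 1(2) by (auto simp: layer_def)
    qed
    then have g: "w {z, hd Q2} + \<delta> \<le> w' {z, hd Q2}" by (rule gap)
    have split: "path_weight v P = path_weight v (Q1 @ [z]) + v {z, hd Q2} + path_weight v Q2" for v
      using path_weight_append[of "Q1 @ [z]" Q2 v] ne 1(1) by simp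
    have "path_weight w P + \<delta> \<le> path_weight w' P"
      using split[of w] split[of w'] g path_weight_mono[of w w' "Q1 @ [z]", OF le] path_weight_mono[of w w' Q2, OF le]
      by linarith
    then show "passage_time d (slab d h a c) w (axis_point a) (axis_point (c - 1)) + \<delta> \<le> path_weight w' P"
      using passage_time_le[where w=w, OF P w] by linarith
  qed
  then show ?thesis using i by (simp add: slab_time_def)
qed

lemma slab_time_mono:
  assumes d: "d > 0" and w: "\<And>e. 0 \<le> w e" and le: "\<And>e. e \<in> lattice_edges d \<Longrightarrow> w e \<le> w' e"
  shows "slab_time d h w a c \<le> slab_time d h w' a c"
proof (cases "a < c")
  case True
  then have axs: "axis_point a \<in> slab d h a c" "axis_point (c - 1) \<in> slab d h a c"
    by (auto intro!: axis_point_in_slab d)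
  obtain P0 where P0: "lattice_path d (slab d h a c) (axis_point a) (axis_point (c - 1)) P0"
    using slab_connected[OF d axs] by blast
  \<comment> \<open>The comparison is assumed on edges only, while \<open>path_weight_mono\<close>
    asks for it on all sets; off the edges the weights may be changed freely.\<close>
  let ?v = "\<lambda>e. if e \<in> lattice_edges d then w' e else w e"
  have "passage_time d (slab d h a c) w (axis_point a) (axis_point (c - 1))
      \<le> passage_time d (slab d h a c) ?v (axis_point a) (axis_point (c - 1))"
  proof (rule passage_time_ge[OF P0])
    fix P assume P: "lattice_path d (slab d h a c) (axis_point a) (axis_point (c - 1)) P"
    have "path_weight w P \<le> path_weight ?v P" by (rule path_weight_mono) (use le in auto)
    then show "passage_time d (slab d h a c) w (axis_point a) (axis_point (c - 1)) \<le> path_weight ?v P"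
      using passage_time_le[where w=w, OF P w] by linarith
  qed
  also have "\<dots> = passage_time d (slab d h a c) w' (axis_point a) (axis_point (c - 1))"
    by (rule passage_time_cong) simp
  finally show ?thesis using True by (simp add: slab_time_def)
qed (simp add: slab_time_def)

section \<open>Measurability\<close>

lemma countable_lattice_points: "countable (lattice_points d)"
proof (rule countable_image_inj_on)
  show "countable ((\<lambda>x. map x [0..<d]) ` lattice_points d)" by (rule countableI_type)
  show "inj_on (\<lambda>x. map x [0..<d]) (lattice_points d)"
  proof (rule inj_onI)
    fix x y assume xy: "x \<in> lattice_points d" "y \<in> lattice_points d" "map x [0..<d] = map y [0..<d]"
    show "x = y"
    proof
      fix i show "x i = y i"
        using xy by (cases "i < d") (auto simp: lattice_points_def)
    qed
  qed
qed

lemma countable_lattice_edges: "countable (lattice_edges d)"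
proof (rule countable_subset)
  show "lattice_edges d \<subseteq> (\<lambda>(x, y). {x, y}) ` (lattice_points d \<times> lattice_points d)"
    by (auto simp: lattice_edges_def lattice_adj_def)
qed (intro countable_image countable_SIGMA countable_lattice_points)

text \<open>The lattice is countable, hence so is the set of finite paths, and the infimum is a
  countable one.\<close>

lemma passage_time_measurable:
  assumes S: "S \<subseteq> lattice_points d"
    and v: "\<And>e. e \<in> lattice_edges d \<Longrightarrow> e \<subseteq> S \<Longrightarrow> v e \<in> borel_measurable K"
  shows "(\<lambda>\<xi>. passage_time d S (\<lambda>e. v e \<xi>) x y) \<in> borel_measurable K"
  unfolding passage_time_eq_INF
proof (rule borel_measurable_cINF_real)
  show "countable {P. lattice_path d S x y P}"
  proof (rule countable_subset)
    show "{P. lattice_path d S x y P} \<subseteq> lists (lattice_points d)"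
      using S by (auto simp: lattice_path_def)
  qed (intro countable_lists countable_lattice_points)
  fix P assume "P \<in> {P. lattice_path d S x y P}"
  then have P: "lattice_path d S x y P" by simp
  have "v {P ! k, P ! Suc k} \<in> borel_measurable K" if k: "k < length P - 1" for k
  proof (rule v)
    have "lattice_adj d (P ! k) (P ! Suc k)"
      using P k successively_nth[of "lattice_adj d" P k] by (simp add: lattice_path_def)
    then show "{P ! k, P ! Suc k} \<in> lattice_edges d" by (auto simp: lattice_edges_def)
    show "{P ! k, P ! Suc k} \<subseteq> S" using P k by (auto simp: lattice_path_def)
  qed
  then show "(\<lambda>\<xi>. path_weight (\<lambda>e. v e \<xi>) P) \<in> borel_measurable K"
    unfolding path_weight_def by (intro borel_measurable_sum) simp
qed

lemma slab_points: "slab d h a b \<subseteq> lattice_points d" "cylinder d h \<subseteq> lattice_points d"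
  by (auto simp: slab_def cylinder_def)

definition edges_in :: "nat \<Rightarrow> (nat \<Rightarrow> int) set \<Rightarrow> (nat \<Rightarrow> int) set set" where
  "edges_in d S = {e \<in> lattice_edges d. e \<subseteq> S}"

lemma slab_time_measurable:
  assumes "\<And>e. e \<in> edges_in d (slab d h a b) \<Longrightarrow> v e \<in> borel_measurable K"
  shows "(\<lambda>\<xi>. slab_time d h (\<lambda>e. v e \<xi>) a b) \<in> borel_measurable K"
  unfolding slab_time_def using assms
  by (cases "a < b") (auto intro!: passage_time_measurable slab_points simp: edges_in_def)

lemma col_cost_measurable:
  assumes "\<And>e. e \<in> lattice_edges d \<Longrightarrow> v e \<in> borel_measurable K"
  shows "(\<lambda>\<xi>. col_cost d h (\<lambda>e. v e \<xi>) a) \<in> borel_measurable K"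
  unfolding col_cost_def
  by (intro borel_measurable_sum borel_measurable_add passage_time_measurable slab_points assms)

lemma cut_cost_measurable:
  assumes d: "d > 0" and v: "\<And>e. e \<in> lattice_edges d \<Longrightarrow> v e \<in> borel_measurable K"
  shows "(\<lambda>\<xi>. cut_cost d h (\<lambda>e. v e \<xi>) b) \<in> borel_measurable K"
proof (cases "b = 0")
  case False
  then obtain k where "b = Suc k" by (cases b) auto
  moreover have "{axis_point k, axis_point (Suc k)} \<in> lattice_edges d"
    using lattice_adj_axis[OF d, of k] by (auto simp: lattice_edges_def)
  ultimately show ?thesis
    unfolding cut_cost_def by (auto intro!: borel_measurable_add col_cost_measurable v)
qed (simp add: cut_cost_def)

lemma slab_time_cong:
  assumes "\<And>e. e \<in> edges_in d (slab d h a b) \<Longrightarrow> v e = v' e"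
  shows "slab_time d h v a b = slab_time d h v' a b"
  unfolding slab_time_def using passage_time_cong[of d "slab d h a b" v v'] assms by (simp add: edges_in_def)

lemma col_cost_cong:
  assumes "\<And>e. e \<in> lattice_edges d \<Longrightarrow> v e = v' e"
  shows "col_cost d h v a = col_cost d h v' a"
  unfolding col_cost_def using passage_time_cong[of d _ v v'] assms by simp

lemma cut_cost_cong:
  assumes d: "d > 0" and v: "\<And>e. e \<in> lattice_edges d \<Longrightarrow> v e = v' e"
  shows "cut_cost d h v b = cut_cost d h v' b"
proof (cases "b = 0")
  case False
  then obtain k where "b = Suc k" by (cases b) auto
  moreover have "{axis_point k, axis_point (Suc k)} \<in> lattice_edges d"
    using lattice_adj_axis[OF d, of k] by (auto simp: lattice_edges_def)
  ultimately show ?thesis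
    using v col_cost_cong[of d v v' h] by (simp add: cut_cost_def)
qed (simp add: cut_cost_def)

text \<open>The weight of one fixed path, a finite sum of square integrable variables, dominates the
  passage time.\<close>

lemma (in prob_space) L2_passage_time:
  assumes d: "d > 0" and v: "\<And>e. e \<in> lattice_edges d \<Longrightarrow> L2 (v e)" and nn: "\<And>e \<xi>. 0 \<le> v e \<xi>"
    and xy: "x \<in> slab d h a b" "y \<in> slab d h a b" and S: "slab d h a b \<subseteq> S" "S \<subseteq> lattice_points d"
  shows "L2 (\<lambda>\<xi>. passage_time d S (\<lambda>e. v e \<xi>) x y)"
proof -
  obtain P where "lattice_path d (slab d h a b) x y P" using slab_connected[OF d xy] by blast
  then have P: "lattice_path d S x y P" using S(1) by (auto simp: lattice_path_def)
  show ?thesis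
  proof (rule L2_bound)
    show "(\<lambda>\<xi>. passage_time d S (\<lambda>e. v e \<xi>) x y) \<in> borel_measurable M"
      by (intro passage_time_measurable S L2_measurable v)
    have "L2 (v {P ! k, P ! Suc k})" if k: "k < length P - 1" for k
    proof (rule v)
      have "lattice_adj d (P ! k) (P ! Suc k)"
        using P k successively_nth[of "lattice_adj d" P k] by (simp add: lattice_path_def)
      then show "{P ! k, P ! Suc k} \<in> lattice_edges d" by (auto simp: lattice_edges_def)
    qed
    then show "L2 (\<lambda>\<xi>. path_weight (\<lambda>e. v e \<xi>) P)"
      unfolding path_weight_def by (intro L2_sum) simp
    show "\<bar>passage_time d S (\<lambda>e. v e \<xi>) x y\<bar> \<le> \<bar>path_weight (\<lambda>e. v e \<xi>) P\<bar>" for \<xi>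
      using passage_time_le[where w="\<lambda>e. v e \<xi>", OF P nn] passage_time_nonneg[where w="\<lambda>e. v e \<xi>", OF P nn]
      by linarith
  qed
qed

lemma (in prob_space) L2_slab_time:
  assumes d: "d > 0" and v: "\<And>e. e \<in> lattice_edges d \<Longrightarrow> L2 (v e)" and nn: "\<And>e \<xi>. 0 \<le> v e \<xi>"
  shows "L2 (\<lambda>\<xi>. slab_time d h (\<lambda>e. v e \<xi>) a b)"
proof (cases "a < b")
  case True
  then have "axis_point a \<in> slab d h a b" "axis_point (b - 1) \<in> slab d h a b"
    by (auto intro!: axis_point_in_slab d)
  then show ?thesis
    using True L2_passage_time[OF d v nn _ _ order_refl slab_points(1)] by (simp add: slab_time_def)
qed (simp add: slab_time_def L2_const)

lemma (in prob_space) L2_col_cost: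
  assumes d: "d > 0" and v: "\<And>e. e \<in> lattice_edges d \<Longrightarrow> L2 (v e)" and nn: "\<And>e \<xi>. 0 \<le> v e \<xi>"
  shows "L2 (\<lambda>\<xi>. col_cost d h (\<lambda>e. v e \<xi>) a)"
proof -
  have ax: "axis_point a \<in> slab d h a (Suc a)" by (auto intro!: axis_point_in_slab d)
  show ?thesis
    unfolding col_cost_def
    by (intro L2_sum L2_add L2_passage_time[OF d v nn _ _ order_refl slab_points(1)] ax)
qed

lemma (in prob_space) L2_cut_cost:
  assumes d: "d > 0" and v: "\<And>e. e \<in> lattice_edges d \<Longrightarrow> L2 (v e)" and nn: "\<And>e \<xi>. 0 \<le> v e \<xi>"
  shows "L2 (\<lambda>\<xi>. cut_cost d h (\<lambda>e. v e \<xi>) b)"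
proof (cases "b = 0")
  case False
  then obtain k where "b = Suc k" by (cases b) auto
  moreover have "{axis_point k, axis_point (Suc k)} \<in> lattice_edges d"
    using lattice_adj_axis[OF d, of k] by (auto simp: lattice_edges_def)
  ultimately show ?thesis
    unfolding cut_cost_def by (auto intro!: L2_add L2_col_cost[OF d v nn] v)
qed (simp add: cut_cost_def L2_const)

text \<open>Chebyshev's inequality restricted to the tail event: the expression is at most the
  expectation of the square over that event, divided by the square of \<epsilon>, and this vanishes
  by dominated convergence. It improves \<open>O(1)\<close> to \<open>o(1)\<close> and supplies
  \<open>C_tail\<close>.\<close>

lemma (in prob_space) L2_tail:
  assumes X: "L2 X" and \<epsilon>: "\<epsilon> > 0"
  shows "(\<lambda>n. real n * prob {x \<in> space M. X x > \<epsilon> * sqrt (real n)}) \<longlonglongrightarrow> 0"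
proof -
  have [measurable]: "X \<in> borel_measurable M" by (rule L2_measurable[OF X])
  let ?A = "\<lambda>n. {x \<in> space M. X x > \<epsilon> * sqrt (real n)}"
  let ?f = "\<lambda>n x. ((X x)\<^sup>2 / \<epsilon>\<^sup>2) * indicator (?A n) x"
  have int: "integrable M (\<lambda>x. (X x)\<^sup>2 / \<epsilon>\<^sup>2)" using X by (simp add: L2_def)
  have A: "?A n \<in> events" for n by measurable
  have lim: "(\<lambda>n. expectation (?f n)) \<longlonglongrightarrow> expectation (\<lambda>x. 0)"
  proof (rule integral_dominated_convergence[OF _ _ int])
    show "AE x in M. (\<lambda>n. ?f n x) \<longlonglongrightarrow> 0"
    proof (rule AE_I2)
      fix x
      have "filterlim (\<lambda>n. \<epsilon> * sqrt (real n)) at_top sequentially"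
        by (rule filterlim_tendsto_pos_mult_at_top[OF tendsto_const \<epsilon> filterlim_compose[OF sqrt_at_top filterlim_real_sequentially]])
      then have "eventually (\<lambda>n. X x \<le> \<epsilon> * sqrt (real n)) sequentially"
        unfolding filterlim_at_top by (rule spec)
      then have "eventually (\<lambda>n. ?f n x = 0) sequentially"
        by eventually_elim (simp add: indicator_def)
      then show "(\<lambda>n. ?f n x) \<longlonglongrightarrow> 0" by (rule tendsto_eventually)
    qed
    show "AE x in M. norm (?f n x) \<le> (X x)\<^sup>2 / \<epsilon>\<^sup>2" for n
      by (rule AE_I2) (simp add: indicator_def)
  qed measurable
  show ?thesis
  proof (rule Lim_null_comparison[OF always_eventually])
    show "(\<lambda>n. expectation (?f n)) \<longlonglongrightarrow> 0" using lim by simp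
    show "\<forall>n. norm (real n * prob (?A n)) \<le> expectation (?f n)"
    proof
      fix n
      have "real n * prob (?A n) = expectation (\<lambda>x. real n * indicator (?A n) x)"
        using A by simp
      also have "\<dots> \<le> expectation (?f n)"
      proof (rule integral_mono)
        have iA: "integrable M (indicator (?A n) :: 'a \<Rightarrow> real)"
          by (rule integrable_const_bound[where B=1]) (use A in \<open>simp_all add: indicator_le_1\<close>)
        then show "integrable M (\<lambda>x. real n * indicator (?A n) x)" by simp
        show "integrable M (?f n)"
          by (rule Bochner_Integration.integrable_bound[OF int]) (auto simp: indicator_def)
        fix x assume "x \<in> space M"
        show "real n * indicator (?A n) x \<le> ?f n x"
        proof (cases "x \<in> ?A n")
          case True
          then have "(\<epsilon> * sqrt (real n))\<^sup>2 \<le> (X x)\<^sup>2" using \<epsilon> by (intro power_mono) auto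
          then have "real n \<le> (X x)\<^sup>2 / \<epsilon>\<^sup>2" using \<epsilon> by (simp add: power_mult_distrib pos_le_divide_eq mult.commute)
          then show ?thesis using True by (simp only: indicator_simps mult_1_right)
        next
          case False
          then have "indicator (?A n) x = (0::real)" by (rule indicator_simps(2))
          then show ?thesis by (simp only: mult_zero_right order_refl)
        qed
      qed
      finally show "norm (real n * prob (?A n)) \<le> expectation (?f n)" by simp
    qed
  qed
qed

section \<open>Percolation on the cylinder\<close>

text \<open>Nonnegativity is required at every sample point and for every index, so that the
  deterministic lemmas on slabs apply directly; the general case is reduced to it by truncation. The
  numbers \<alpha> and \<beta> express that the law is not a point mass.\<close>

locale percolation = prob_space M for M :: "'a measure" +
  fixes d h :: nat and \<omega> :: "(nat \<Rightarrow> int) set \<Rightarrow> 'a \<Rightarrow> real" and F :: "real measure" and \<alpha> \<beta> :: real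
  assumes d: "d > 0" and nonneg: "\<And>e \<xi>. 0 \<le> \<omega> e \<xi>"
    and indep: "indep_vars (\<lambda>_. borel) \<omega> (lattice_edges d)"
    and identical: "\<And>e. e \<in> lattice_edges d \<Longrightarrow> distr M borel (\<omega> e) = F"
    and F_square: "integrable F (\<lambda>x. x\<^sup>2)"
    and \<alpha>\<beta>: "0 \<le> \<alpha>" "\<alpha> < \<beta>" "measure F {..\<alpha>} > 0" "measure F {\<beta>..} > 0"
begin

abbreviation E :: "(nat \<Rightarrow> int) set set" where "E \<equiv> lattice_edges d"

abbreviation W :: "'a \<Rightarrow> (nat \<Rightarrow> int) set \<Rightarrow> real" where "W \<xi> \<equiv> (\<lambda>e. \<omega> e \<xi>)"

lemma weight_measurable: "e \<in> E \<Longrightarrow> \<omega> e \<in> borel_measurable M"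
  using indep by (auto simp: indep_vars_def2)

lemma L2_weight: "e \<in> E \<Longrightarrow> L2 (\<omega> e)"
proof -
  assume e: "e \<in> E"
  have "integrable (distr M borel (\<omega> e)) (\<lambda>x. x\<^sup>2)" using F_square identical[OF e] by simp
  then have "integrable M (\<lambda>\<xi>. (\<omega> e \<xi>)\<^sup>2)"
    by (subst (asm) integrable_distr_eq) (use weight_measurable[OF e] in auto)
  then show ?thesis using weight_measurable[OF e] by (simp add: L2_def)
qed

lemma E_nonempty: "E \<noteq> {}"
  using layer_nonempty[OF d] layer_subset[of d h] by blast

text \<open>Generated by the restricted field as a single map into the product space, the form in
  which \<open>indep_vars_restrict\<close> provides independence over disjoint edge sets.\<close>

definition \<G> :: "(nat \<Rightarrow> int) set set \<Rightarrow> 'a measure" where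
  "\<G> A = vimage_algebra (space M) (\<lambda>\<xi>. \<lambda>e\<in>A. \<omega> e \<xi>) (PiM A (\<lambda>_. borel))"

lemma \<G>_weight: "e \<in> A \<Longrightarrow> \<omega> e \<in> borel_measurable (\<G> A)"
proof -
  assume e: "e \<in> A"
  have "(\<lambda>\<xi>. \<lambda>e\<in>A. \<omega> e \<xi>) \<in> measurable (\<G> A) (PiM A (\<lambda>_. borel))"
    unfolding \<G>_def by (rule measurable_vimage_algebra1) (auto simp: space_PiM)
  from measurable_compose[OF this measurable_component_singleton[OF e]] e show ?thesis by simp
qed

lemma space_\<G> [simp]: "space (\<G> A) = space M"
  by (simp add: \<G>_def)

lemma \<G>_least:
  assumes "space K = space M" "\<And>e. e \<in> A \<Longrightarrow> \<omega> e \<in> borel_measurable K"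
  shows "sets (\<G> A) \<subseteq> sets K"
  unfolding \<G>_def
  by (rule sets_image_in_sets[OF assms(1)]) (intro measurable_restrict assms(2))

lemma \<G>_mono:
  assumes "A \<subseteq> B"
  shows "sets (\<G> A) \<subseteq> sets (\<G> B)"
  by (rule \<G>_least[OF space_\<G> \<G>_weight[OF subsetD[OF assms]]])

lemma \<G>_subalgebra:
  assumes "A \<subseteq> E"
  shows "subalgebra M (\<G> A)"
  unfolding subalgebra_def
  by (rule conjI[OF space_\<G> \<G>_least[OF refl weight_measurable[OF subsetD[OF assms]]]])

lemma \<G>_indep:
  assumes "\<And>l. A l \<subseteq> E" "disjoint_family A"
  shows "indep_sets (\<lambda>l. sets (\<G> (A l))) (UNIV :: nat set)"
proof -
  have "indep_vars (\<lambda>l. PiM (A l) (\<lambda>_. borel)) (\<lambda>l \<xi>. restrict (\<lambda>e. \<omega> e \<xi>) (A l)) UNIV"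
    by (rule indep_vars_restrict[OF indep]) (use assms in auto)
  then have "indep_sets (\<lambda>l. {(\<lambda>\<xi>. \<lambda>e\<in>A l. \<omega> e \<xi>) -` B \<inter> space M |B. B \<in> sets (PiM (A l) (\<lambda>_. borel))}) UNIV"
    by (simp add: indep_vars_def2)
  moreover have "sets (\<G> (A l)) = {(\<lambda>\<xi>. \<lambda>e\<in>A l. \<omega> e \<xi>) -` B \<inter> space M |B. B \<in> sets (PiM (A l) (\<lambda>_. borel))}" for l
    unfolding \<G>_def by (rule sets_vimage_algebra2) (auto simp: space_PiM)
  ultimately show ?thesis by simp
qed

lemma edges_in_disjoint:
  assumes "mono n"
  shows "disjoint_family (\<lambda>l. edges_in d (slab d h (n l) (n (Suc l))))"
proof -
  have *: "edges_in d (slab d h (n k) (n (Suc k))) \<inter> edges_in d (slab d h (n l) (n (Suc l))) = {}" if "k < l" for k l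
  proof (rule ccontr)
    assume "edges_in d (slab d h (n k) (n (Suc k))) \<inter> edges_in d (slab d h (n l) (n (Suc l))) \<noteq> {}"
    then obtain e where e: "e \<in> E" "e \<subseteq> slab d h (n k) (n (Suc k))" "e \<subseteq> slab d h (n l) (n (Suc l))"
      by (auto simp: edges_in_def)
    then obtain x where "x \<in> e" by (auto simp: lattice_edges_def)
    then have "x 0 < int (n (Suc k))" "int (n l) \<le> x 0" using e(2,3) by (auto simp: slab_def)
    moreover have "n (Suc k) \<le> n l" using assms that by (simp add: monoD)
    ultimately show False by linarith
  qed
  show ?thesis
    unfolding disjoint_family_on_def
  proof (intro ballI impI)
    fix k l :: nat assume "k \<noteq> l"
    then consider "k < l" | "l < k" by linarith
    then show "edges_in d (slab d h (n k) (n (Suc k))) \<inter> edges_in d (slab d h (n l) (n (Suc l))) = {}"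
      by cases (use *[of k l] *[of l k] in auto)
  qed
qed

lemma shifted_field_distr:
  "distr M (PiM E (\<lambda>_. borel)) (\<lambda>\<xi>. \<lambda>e\<in>E. \<omega> (shift k ` e) \<xi>) = distr M (PiM E (\<lambda>_. borel)) (\<lambda>\<xi>. \<lambda>e\<in>E. \<omega> e \<xi>)"
proof -
  have sE: "shift k ` e \<in> E" if "e \<in> E" for e using lattice_edges_shift[OF d that] .
  \<comment> \<open>Reindexing of an independent family along the shift of edges: the singletons of
    shifted edges are disjoint since the shift is injective.\<close>
  have "indep_vars (\<lambda>e. PiM {shift k ` e} (\<lambda>_. borel)) (\<lambda>e \<xi>. restrict (\<lambda>e. \<omega> e \<xi>) {shift k ` e}) E"
  proof (rule indep_vars_restrict[OF indep])
    show "disjoint_family_on (\<lambda>e. {shift k ` e}) E"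
      by (auto simp: disjoint_family_on_def inj_image_eq_iff[OF inj_shift])
  qed (use sE in auto)
  then have "indep_vars (\<lambda>_. borel) (\<lambda>e \<xi>. (restrict (\<lambda>e. \<omega> e \<xi>) {shift k ` e}) (shift k ` e)) E"
    by (rule indep_vars_compose2) (auto intro: measurable_component_singleton)
  then have ind: "indep_vars (\<lambda>_. borel) (\<lambda>e. \<omega> (shift k ` e)) E" by simp
  have "distr M (PiM E (\<lambda>_. borel)) (\<lambda>\<xi>. \<lambda>e\<in>E. \<omega> (shift k ` e) \<xi>) = PiM E (\<lambda>e. distr M borel (\<omega> (shift k ` e)))"
    by (rule indep_vars_iff_distr_eq_PiM'[THEN iffD1, OF E_nonempty _ ind]) (use sE weight_measurable in auto)
  also have "\<dots> = PiM E (\<lambda>e. distr M borel (\<omega> e))"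
    by (rule PiM_cong) (use identical sE in auto)
  also have "\<dots> = distr M (PiM E (\<lambda>_. borel)) (\<lambda>\<xi>. \<lambda>e\<in>E. \<omega> e \<xi>)"
    by (rule indep_vars_iff_distr_eq_PiM'[THEN iffD1, OF E_nonempty _ indep, symmetric]) (use weight_measurable in auto)
  finally show ?thesis .
qed

text \<open>The law of the field lives on functions restricted to the edges. The congruence
  assumption on \<Phi> allows the conclusion to be stated for the unrestricted fields.\<close>

lemma shift_invariance:
  assumes \<Phi>: "\<Phi> \<in> borel_measurable (PiM E (\<lambda>_. borel))" and cong: "\<And>v v'. (\<And>e. e \<in> E \<Longrightarrow> v e = v' e) \<Longrightarrow> \<Phi> v = \<Phi> v'"
  shows "distr M borel (\<lambda>\<xi>. \<Phi> (\<lambda>e. \<omega> (shift k ` e) \<xi>)) = distr M borel (\<lambda>\<xi>. \<Phi> (W \<xi>))"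
proof -
  have m1: "(\<lambda>\<xi>. \<lambda>e\<in>E. \<omega> (shift k ` e) \<xi>) \<in> M \<rightarrow>\<^sub>M PiM E (\<lambda>_. borel)"
    by (intro measurable_restrict weight_measurable lattice_edges_shift d)
  have m2: "(\<lambda>\<xi>. \<lambda>e\<in>E. \<omega> e \<xi>) \<in> M \<rightarrow>\<^sub>M PiM E (\<lambda>_. borel)"
    by (intro measurable_restrict weight_measurable)
  have "distr M borel (\<lambda>\<xi>. \<Phi> (\<lambda>e. \<omega> (shift k ` e) \<xi>)) = distr M borel (\<Phi> \<circ> (\<lambda>\<xi>. \<lambda>e\<in>E. \<omega> (shift k ` e) \<xi>))"
    by (rule arg_cong[where f="distr M borel"]) (auto simp: comp_def intro!: cong)
  also have "\<dots> = distr (distr M (PiM E (\<lambda>_. borel)) (\<lambda>\<xi>. \<lambda>e\<in>E. \<omega> (shift k ` e) \<xi>)) borel \<Phi>"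
    by (rule distr_distr[symmetric, OF \<Phi> m1])
  also have "\<dots> = distr (distr M (PiM E (\<lambda>_. borel)) (\<lambda>\<xi>. \<lambda>e\<in>E. \<omega> e \<xi>)) borel \<Phi>"
    by (simp only: shifted_field_distr)
  also have "\<dots> = distr M borel (\<Phi> \<circ> (\<lambda>\<xi>. \<lambda>e\<in>E. \<omega> e \<xi>))"
    by (rule distr_distr[OF \<Phi> m2])
  also have "\<dots> = distr M borel (\<lambda>\<xi>. \<Phi> (W \<xi>))"
    by (rule arg_cong[where f="distr M borel"]) (auto simp: comp_def intro!: cong)
  finally show ?thesis .
qed

lemma slab_time_stationary:
  assumes "a \<le> b"
  shows "distr M borel (\<lambda>\<xi>. slab_time d h (W \<xi>) a b) = distr M borel (\<lambda>\<xi>. slab_time d h (W \<xi>) 0 (b - a))"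
proof -
  have "slab_time d h (W \<xi>) a b = slab_time d h (\<lambda>e. \<omega> (shift a ` e) \<xi>) 0 (b - a)" for \<xi>
    using slab_time_shift[OF d, of h "W \<xi>" 0 a "b - a"] assms by simp
  moreover have "distr M borel (\<lambda>\<xi>. slab_time d h (\<lambda>e. \<omega> (shift a ` e) \<xi>) 0 (b - a))
      = distr M borel (\<lambda>\<xi>. slab_time d h (W \<xi>) 0 (b - a))"
  proof (rule shift_invariance)
    show "(\<lambda>v. slab_time d h v 0 (b - a)) \<in> borel_measurable (PiM E (\<lambda>_. borel))"
      by (rule slab_time_measurable[where v="\<lambda>e u. u e"], rule measurable_component_singleton)
        (simp add: edges_in_def)
    show "slab_time d h v 0 (b - a) = slab_time d h v' 0 (b - a)" if "\<And>e. e \<in> E \<Longrightarrow> v e = v' e" for v v'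
      by (rule slab_time_cong) (use that in \<open>simp add: edges_in_def\<close>)
  qed
  ultimately show ?thesis by simp
qed

lemma cut_cost_stationary:
  "distr M borel (\<lambda>\<xi>. cut_cost d h (W \<xi>) (Suc k)) = distr M borel (\<lambda>\<xi>. cut_cost d h (W \<xi>) 1)"
proof -
  have "distr M borel (\<lambda>\<xi>. cut_cost d h (\<lambda>e. \<omega> (shift k ` e) \<xi>) 1) = distr M borel (\<lambda>\<xi>. cut_cost d h (W \<xi>) 1)"
  proof (rule shift_invariance)
    show "(\<lambda>v. cut_cost d h v 1) \<in> borel_measurable (PiM E (\<lambda>_. borel))"
      by (rule cut_cost_measurable[where v="\<lambda>e u. u e", OF d]) (rule measurable_component_singleton)
  qed (rule cut_cost_cong[OF d])
  then show ?thesis by (simp only: cut_cost_shift[OF d, of h _ k])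
qed

lemma col_cost_stationary:
  "distr M borel (\<lambda>\<xi>. col_cost d h (W \<xi>) k) = distr M borel (\<lambda>\<xi>. col_cost d h (W \<xi>) 0)"
proof -
  have "distr M borel (\<lambda>\<xi>. col_cost d h (\<lambda>e. \<omega> (shift k ` e) \<xi>) 0) = distr M borel (\<lambda>\<xi>. col_cost d h (W \<xi>) 0)"
  proof (rule shift_invariance)
    show "(\<lambda>v. col_cost d h v 0) \<in> borel_measurable (PiM E (\<lambda>_. borel))"
      by (rule col_cost_measurable[where v="\<lambda>e u. u e"]) (rule measurable_component_singleton)
  qed (rule col_cost_cong)
  moreover have "col_cost d h (W \<xi>) k = col_cost d h (\<lambda>e. \<omega> (shift k ` e) \<xi>) 0" for \<xi>
    using col_cost_shift[OF d, of h "W \<xi>" 0 k] by simp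
  ultimately show ?thesis by (simp only:)
qed

end

section \<open>Lower bound for the variance\<close>

lemma borel_measurable_indicator_component:
  assumes "e \<in> L" "A \<in> sets borel"
  shows "(\<lambda>u. indicator A (u e) :: real) \<in> borel_measurable (PiM L (\<lambda>_. borel :: real measure))"
  by (rule measurable_compose[OF _ borel_measurable_indicator[OF assms(2)], where f="\<lambda>u. u e"])
    (rule measurable_component_singleton[OF assms(1)])

context percolation
begin

definition layer_ind :: "real set \<Rightarrow> nat \<Rightarrow> 'a \<Rightarrow> real" where
  "layer_ind A i \<xi> = (\<Prod>e\<in>layer d h i. indicator A (\<omega> e \<xi>))"

definition layer_prob :: "real set \<Rightarrow> real" where
  "layer_prob A = measure F A ^ card (layer d h 0)"

lemma layer_ind_01: "layer_ind A i \<xi> = (if \<forall>e\<in>layer d h i. \<omega> e \<xi> \<in> A then 1 else 0)"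
proof (cases "\<forall>e\<in>layer d h i. \<omega> e \<xi> \<in> A")
  case False
  then obtain e where "e \<in> layer d h i" "indicator A (\<omega> e \<xi>) = (0::real)" by auto
  then have "(\<Prod>e\<in>layer d h i. indicator A (\<omega> e \<xi>)) = (0::real)"
    by (rule prod_zero[OF finite_layer bexI[rotated]])
  then show ?thesis using False by (simp only: layer_ind_def if_False)
qed (simp add: layer_ind_def)

lemma layer_ind_measurable: "A \<in> sets borel \<Longrightarrow> layer_ind A i \<in> borel_measurable M"
proof -
  assume A: "A \<in> sets borel"
  have "(\<lambda>\<xi>. indicator A (\<omega> e \<xi>) :: real) \<in> borel_measurable M" if "e \<in> layer d h i" for e
    using measurable_compose[OF weight_measurable borel_measurable_indicator[OF A]] that layer_subset[of d h i] by blast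
  then show ?thesis unfolding layer_ind_def[abs_def] by (rule borel_measurable_prod)
qed

lemma L2_layer_ind: "A \<in> sets borel \<Longrightarrow> L2 (layer_ind A i)"
  by (rule L2_bound[OF layer_ind_measurable L2_const[of 1]]) (simp_all add: layer_ind_01)

lemma expectation_layer_ind:
  assumes A: "A \<in> sets borel"
  shows "expectation (layer_ind A i) = layer_prob A"
proof -
  have sub: "layer d h i \<subseteq> E" by (rule layer_subset)
  have "indep_vars (\<lambda>_. borel) \<omega> (layer d h i)" by (rule indep_vars_subset[OF indep sub])
  then have ind: "indep_vars (\<lambda>_. borel) (\<lambda>e \<xi>. indicator A (\<omega> e \<xi>) :: real) (layer d h i)"
    by (rule indep_vars_compose2) (use A in simp)
  have one: "expectation (\<lambda>\<xi>. indicator A (\<omega> e \<xi>)) = measure F A" and int: "integrable M (\<lambda>\<xi>. indicator A (\<omega> e \<xi>) :: real)"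
    if e: "e \<in> layer d h i" for e
  proof -
    have m: "\<omega> e \<in> borel_measurable M" using weight_measurable sub e by blast
    have "expectation (\<lambda>\<xi>. indicator A (\<omega> e \<xi>)) = (\<integral>x. (indicator A x :: real) \<partial>distr M borel (\<omega> e))"
      by (subst integral_distr[OF m]) (use A in simp_all)
    also have "\<dots> = measure (distr M borel (\<omega> e)) A" by simp
    also have "\<dots> = measure F A" using identical[OF subsetD[OF sub e]] by (simp only:)
    finally show "expectation (\<lambda>\<xi>. indicator A (\<omega> e \<xi>)) = measure F A" .
    show "integrable M (\<lambda>\<xi>. indicator A (\<omega> e \<xi>) :: real)"
      by (rule integrable_const_bound[where B=1])
        (use measurable_compose[OF m borel_measurable_indicator[OF A]] in \<open>simp_all add: indicator_le_1\<close>)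
  qed
  have "expectation (layer_ind A i) = (\<Prod>e\<in>layer d h i. expectation (\<lambda>\<xi>. indicator A (\<omega> e \<xi>)))"
    unfolding layer_ind_def[abs_def] by (rule indep_vars_lebesgue_integral[OF finite_layer ind int])
  also have "\<dots> = (\<Prod>e\<in>layer d h i. measure F A)" by (rule prod.cong[OF refl one])
  also have "\<dots> = layer_prob A" by (simp add: layer_prob_def card_layer[OF d, of h i])
  finally show ?thesis .
qed

text \<open>Overwriting a layer by a constant makes the passage time independent of the weights in
  that layer, and on the events of \<open>layer_ind\<close> it remains comparable with the original
  one.\<close>

definition replaced :: "nat \<Rightarrow> real \<Rightarrow> (nat \<Rightarrow> int) set \<Rightarrow> 'a \<Rightarrow> real" where
  "replaced i c e \<xi> = (if e \<in> layer d h i then c else \<omega> e \<xi>)"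

lemma replaced_nonneg: "c \<ge> 0 \<Longrightarrow> 0 \<le> replaced i c e \<xi>"
  by (simp add: replaced_def nonneg)

lemma L2_replaced: "e \<in> E \<Longrightarrow> L2 (replaced i c e)"
  unfolding replaced_def[abs_def] using L2_weight L2_const by (cases "e \<in> layer d h i") simp_all

lemma L2_slab_replaced: "c \<ge> 0 \<Longrightarrow> L2 (\<lambda>\<xi>. slab_time d h (\<lambda>e. replaced i c e \<xi>) a b)"
  by (rule L2_slab_time[OF d L2_replaced replaced_nonneg])

lemma expectation_layer_replaced:
  assumes A: "A \<in> sets borel" and c: "c \<ge> 0"
  shows "expectation (\<lambda>\<xi>. layer_ind A i \<xi> * slab_time d h (\<lambda>e. replaced i c e \<xi>) a b)
    = layer_prob A * expectation (\<lambda>\<xi>. slab_time d h (\<lambda>e. replaced i c e \<xi>) a b)"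
proof -
  let ?L = "layer d h i"
  let ?f = "\<lambda>u. \<Prod>e\<in>?L. indicator A (u e) :: real"
  let ?g = "\<lambda>u. slab_time d h (\<lambda>e. if e \<in> ?L then c else u e) a b"
  have "indep_var (PiM ?L (\<lambda>_. borel)) (\<lambda>\<xi>. restrict (\<lambda>e. \<omega> e \<xi>) ?L)
      (PiM (E - ?L) (\<lambda>_. borel)) (\<lambda>\<xi>. restrict (\<lambda>e. \<omega> e \<xi>) (E - ?L))"
    by (rule indep_var_restrict[OF indep]) (use layer_subset in auto)
  moreover have f: "?f \<in> borel_measurable (PiM ?L (\<lambda>_. borel))"
    by (intro borel_measurable_prod borel_measurable_indicator_component A)
  moreover have g: "?g \<in> borel_measurable (PiM (E - ?L) (\<lambda>_. borel))"
  proof (rule slab_time_measurable[where v="\<lambda>e u. if e \<in> ?L then c else u e"])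
    fix e assume "e \<in> edges_in d (slab d h a b)"
    then show "(\<lambda>u. if e \<in> ?L then c else u e) \<in> borel_measurable (PiM (E - ?L) (\<lambda>_. borel))"
      by (cases "e \<in> ?L") (simp_all add: edges_in_def)
  qed
  ultimately have "indep_var borel (?f \<circ> (\<lambda>\<xi>. restrict (\<lambda>e. \<omega> e \<xi>) ?L)) borel (?g \<circ> (\<lambda>\<xi>. restrict (\<lambda>e. \<omega> e \<xi>) (E - ?L)))"
    by (rule indep_var_compose)
  moreover have "?f \<circ> (\<lambda>\<xi>. restrict (\<lambda>e. \<omega> e \<xi>) ?L) = layer_ind A i"
    by (auto simp: comp_def layer_ind_def intro!: prod.cong)
  moreover have "?g \<circ> (\<lambda>\<xi>. restrict (\<lambda>e. \<omega> e \<xi>) (E - ?L)) = (\<lambda>\<xi>. slab_time d h (\<lambda>e. replaced i c e \<xi>) a b)"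
  proof
    fix \<xi>
    have "?g (restrict (\<lambda>e. \<omega> e \<xi>) (E - ?L)) = slab_time d h (\<lambda>e. replaced i c e \<xi>) a b"
      by (rule slab_time_cong) (auto simp: replaced_def edges_in_def)
    then show "(?g \<circ> (\<lambda>\<xi>. restrict (\<lambda>e. \<omega> e \<xi>) (E - ?L))) \<xi> = slab_time d h (\<lambda>e. replaced i c e \<xi>) a b"
      by (simp only: comp_def)
  qed
  ultimately have "indep_var borel (layer_ind A i) borel (\<lambda>\<xi>. slab_time d h (\<lambda>e. replaced i c e \<xi>) a b)" by simp
  from indep_var_lebesgue_integral[OF this L2_integrable[OF L2_layer_ind[OF A]] L2_integrable[OF L2_slab_replaced[OF c]]]
  show ?thesis unfolding expectation_layer_ind[OF A] .
qed

text \<open>A centred variable that detects whether the \<open>i\<close>-th layer is heavy or light.\<close>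

definition zeta :: "nat \<Rightarrow> 'a \<Rightarrow> real" where
  "zeta i \<xi> = layer_ind {\<beta>..} i \<xi> / layer_prob {\<beta>..} - layer_ind {..\<alpha>} i \<xi> / layer_prob {..\<alpha>}"

definition zeta_bound :: real where
  "zeta_bound = 1 / layer_prob {\<beta>..} + 1 / layer_prob {..\<alpha>}"

lemma layer_prob_pos: "layer_prob {\<beta>..} > 0" "layer_prob {..\<alpha>} > 0"
  using \<alpha>\<beta> by (simp_all add: layer_prob_def)

lemma zeta_bound_pos: "zeta_bound > 0"
  using layer_prob_pos by (simp add: zeta_bound_def add_pos_pos)

lemma zeta_measurable: "zeta i \<in> borel_measurable M"
  unfolding zeta_def[abs_def] by (intro borel_measurable_diff borel_measurable_divide layer_ind_measurable) auto

lemma zeta_le: "\<bar>zeta i \<xi>\<bar> \<le> zeta_bound"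
proof -
  have 1: "0 \<le> layer_ind A i \<xi> / q" "layer_ind A i \<xi> / q \<le> 1 / q" if "q > 0" for A q
    using that by (auto simp: layer_ind_01)
  show ?thesis
    unfolding zeta_def zeta_bound_def using 1[OF layer_prob_pos(1), of "{\<beta>..}"] 1[OF layer_prob_pos(2), of "{..\<alpha>}"]
    by linarith
qed

lemma L2_zeta: "L2 (zeta i)"
  by (rule L2_bound[OF zeta_measurable L2_const[of zeta_bound]]) (use zeta_le zeta_bound_pos in simp)

lemma expectation_zeta: "expectation (zeta i) = 0"
proof -
  have "expectation (zeta i) = expectation (\<lambda>\<xi>. layer_ind {\<beta>..} i \<xi> / layer_prob {\<beta>..})
      - expectation (\<lambda>\<xi>. layer_ind {..\<alpha>} i \<xi> / layer_prob {..\<alpha>})"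
    unfolding zeta_def
    by (rule Bochner_Integration.integral_diff; simp add: L2_integrable[OF L2_layer_ind])
  then show ?thesis using layer_prob_pos by (simp add: expectation_layer_ind)
qed

lemma sd_zeta: "sd (zeta i) \<le> zeta_bound"
proof -
  have "l2norm (zeta i) \<le> l2norm (\<lambda>_. zeta_bound)"
    by (rule l2norm_mono[OF zeta_measurable L2_const]) (use zeta_le zeta_bound_pos in simp)
  also have "\<dots> = zeta_bound" using zeta_bound_pos by (simp add: l2norm_def prob_space)
  finally show ?thesis using sd_le_l2norm[OF L2_zeta, of i] by linarith
qed

lemma zeta_indep: "indep_vars (\<lambda>_. borel) zeta (UNIV :: nat set)"
proof -
  have "indep_vars (\<lambda>i. PiM (layer d h i) (\<lambda>_. borel)) (\<lambda>i \<xi>. restrict (\<lambda>e. \<omega> e \<xi>) (layer d h i)) (UNIV :: nat set)"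
  proof (rule indep_vars_restrict[OF indep layer_subset])
    show "disjoint_family (layer d h)" by (simp add: disjoint_family_on_def layer_disjoint)
  qed
  then have "indep_vars (\<lambda>_. borel) (\<lambda>i \<xi>. (\<lambda>u. (\<Prod>e\<in>layer d h i. indicator {\<beta>..} (u e)) / layer_prob {\<beta>..}
      - (\<Prod>e\<in>layer d h i. indicator {..\<alpha>} (u e)) / layer_prob {..\<alpha>}) (restrict (\<lambda>e. \<omega> e \<xi>) (layer d h i))) UNIV"
    by (rule indep_vars_compose2)
      (intro borel_measurable_diff borel_measurable_divide borel_measurable_prod borel_measurable_const
        borel_measurable_indicator_component; simp)
  then show ?thesis by (simp add: zeta_def[abs_def] layer_ind_def)
qed

text \<open>If the layer is heavy, the passage time is at least the one with the layer set to
  \<beta>; if it is light, at most the one with the layer set to \<alpha>. Both replaced times are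
  independent of the layer, so after division by the probabilities the covariance is at least the
  difference of their means. That difference is at least \<open>\<beta> - \<alpha>\<close>, as every
  crossing uses an edge of the layer.\<close>

lemma covariance_zeta:
  assumes "Suc i < n"
  shows "\<beta> - \<alpha> \<le> expectation (\<lambda>\<xi>. slab_time d h (W \<xi>) 0 n * zeta i \<xi>)"
proof -
  let ?T = "\<lambda>\<xi>. slab_time d h (W \<xi>) 0 n"
  let ?R = "\<lambda>c \<xi>. slab_time d h (\<lambda>e. replaced i c e \<xi>) 0 n"
  have b0: "\<beta> \<ge> 0" using \<alpha>\<beta> by simp
  have L2T: "L2 ?T" by (rule L2_slab_time[OF d L2_weight nonneg])
  have L2R: "L2 (?R c)" if "c \<ge> 0" for c by (rule L2_slab_replaced[OF that])
  have intT: "integrable M (\<lambda>\<xi>. layer_ind A i \<xi> * ?T \<xi>)" if "A \<in> sets borel" for A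
    by (rule L2_mult_integrable[OF L2_layer_ind[OF that] L2T])
  have intR: "integrable M (\<lambda>\<xi>. layer_ind A i \<xi> * ?R c \<xi>)" if "A \<in> sets borel" "c \<ge> 0" for A c
    by (rule L2_mult_integrable[OF L2_layer_ind[OF that(1)] L2R[OF that(2)]])
  have hi: "layer_prob {\<beta>..} * expectation (?R \<beta>) \<le> expectation (\<lambda>\<xi>. layer_ind {\<beta>..} i \<xi> * ?T \<xi>)"
  proof -
    have "layer_prob {\<beta>..} * expectation (?R \<beta>) = expectation (\<lambda>\<xi>. layer_ind {\<beta>..} i \<xi> * ?R \<beta> \<xi>)"
      by (rule expectation_layer_replaced[symmetric]) (use b0 in auto)
    also have "\<dots> \<le> expectation (\<lambda>\<xi>. layer_ind {\<beta>..} i \<xi> * ?T \<xi>)"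
    proof (rule integral_mono[OF intR intT])
      fix \<xi>
      show "layer_ind {\<beta>..} i \<xi> * ?R \<beta> \<xi> \<le> layer_ind {\<beta>..} i \<xi> * ?T \<xi>"
      proof (cases "\<forall>e\<in>layer d h i. \<omega> e \<xi> \<in> {\<beta>..}")
        case True
        have "?R \<beta> \<xi> \<le> ?T \<xi>"
          by (rule slab_time_mono[OF d replaced_nonneg[OF b0]]) (use True in \<open>auto simp: replaced_def\<close>)
        then show ?thesis by (simp add: layer_ind_01)
      next
        case False
        then have "layer_ind {\<beta>..} i \<xi> = 0" unfolding layer_ind_01 by (rule if_not_P)
        then show ?thesis by simp
      qed
    qed (use b0 in auto)
    finally show ?thesis .
  qed
  have lo: "expectation (\<lambda>\<xi>. layer_ind {..\<alpha>} i \<xi> * ?T \<xi>) \<le> layer_prob {..\<alpha>} * expectation (?R \<alpha>)"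
  proof -
    have "expectation (\<lambda>\<xi>. layer_ind {..\<alpha>} i \<xi> * ?T \<xi>) \<le> expectation (\<lambda>\<xi>. layer_ind {..\<alpha>} i \<xi> * ?R \<alpha> \<xi>)"
    proof (rule integral_mono[OF intT intR])
      fix \<xi>
      show "layer_ind {..\<alpha>} i \<xi> * ?T \<xi> \<le> layer_ind {..\<alpha>} i \<xi> * ?R \<alpha> \<xi>"
      proof (cases "\<forall>e\<in>layer d h i. \<omega> e \<xi> \<in> {..\<alpha>}")
        case True
        have "?T \<xi> \<le> ?R \<alpha> \<xi>"
          by (rule slab_time_mono[OF d nonneg]) (use True in \<open>auto simp: replaced_def\<close>)
        then show ?thesis by (simp add: layer_ind_01)
      next
        case False
        then have "layer_ind {..\<alpha>} i \<xi> = 0" unfolding layer_ind_01 by (rule if_not_P)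
        then show ?thesis by simp
      qed
    qed (use \<alpha>\<beta> in auto)
    also have "\<dots> = layer_prob {..\<alpha>} * expectation (?R \<alpha>)"
      by (rule expectation_layer_replaced) (use \<alpha>\<beta> in auto)
    finally show ?thesis .
  qed
  have gap: "expectation (?R \<alpha>) + (\<beta> - \<alpha>) \<le> expectation (?R \<beta>)"
  proof -
    have "?R \<alpha> \<xi> + (\<beta> - \<alpha>) \<le> ?R \<beta> \<xi>" for \<xi>
      by (rule slab_time_layer[OF d _ assms replaced_nonneg[OF \<alpha>\<beta>(1)]]) (use \<alpha>\<beta> in \<open>auto simp: replaced_def\<close>)
    then have "expectation (\<lambda>\<xi>. ?R \<alpha> \<xi> + (\<beta> - \<alpha>)) \<le> expectation (?R \<beta>)"
      using L2_integrable[OF L2R] \<alpha>\<beta>(1) b0 by (intro integral_mono) auto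
    then show ?thesis using L2_integrable[OF L2R[OF \<alpha>\<beta>(1)]] by (simp add: prob_space)
  qed
  have "expectation (\<lambda>\<xi>. ?T \<xi> * zeta i \<xi>)
      = expectation (\<lambda>\<xi>. (layer_ind {\<beta>..} i \<xi> * ?T \<xi>) / layer_prob {\<beta>..} - (layer_ind {..\<alpha>} i \<xi> * ?T \<xi>) / layer_prob {..\<alpha>})"
    by (simp add: zeta_def right_diff_distrib mult.commute)
  also have "\<dots> = expectation (\<lambda>\<xi>. layer_ind {\<beta>..} i \<xi> * ?T \<xi>) / layer_prob {\<beta>..}
      - expectation (\<lambda>\<xi>. layer_ind {..\<alpha>} i \<xi> * ?T \<xi>) / layer_prob {..\<alpha>}"
    using intT by (subst Bochner_Integration.integral_diff) auto
  finally have eq: "expectation (\<lambda>\<xi>. ?T \<xi> * zeta i \<xi>) = expectation (\<lambda>\<xi>. layer_ind {\<beta>..} i \<xi> * ?T \<xi>) / layer_prob {\<beta>..}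
      - expectation (\<lambda>\<xi>. layer_ind {..\<alpha>} i \<xi> * ?T \<xi>) / layer_prob {..\<alpha>}" .
  have "expectation (?R \<beta>) \<le> expectation (\<lambda>\<xi>. layer_ind {\<beta>..} i \<xi> * ?T \<xi>) / layer_prob {\<beta>..}"
    using hi layer_prob_pos by (simp add: pos_le_divide_eq mult.commute)
  moreover have "expectation (\<lambda>\<xi>. layer_ind {..\<alpha>} i \<xi> * ?T \<xi>) / layer_prob {..\<alpha>} \<le> expectation (?R \<alpha>)"
    using lo layer_prob_pos by (simp add: pos_divide_le_eq mult.commute)
  ultimately show ?thesis unfolding eq using gap by linarith
qed

text \<open>The covariances with \<open>n - 1\<close> independent centred variables add up linearly,
  while the standard deviation of their sum is at most \<open>sqrt (n - 1) * zeta_bound\<close>. The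
  Cauchy-Schwarz inequality turns this into linear growth of the variance.\<close>

lemma variance_lower_bound:
  assumes n: "n \<ge> 2"
  shows "(\<beta> - \<alpha>)\<^sup>2 / (2 * zeta_bound\<^sup>2) * real n \<le> variance (\<lambda>\<xi>. slab_time d h (W \<xi>) 0 n)"
proof -
  let ?T = "\<lambda>\<xi>. slab_time d h (W \<xi>) 0 n"
  let ?Z = "\<lambda>\<xi>. \<Sum>i<n - 1. zeta i \<xi>"
  let ?D = "\<beta> - \<alpha>" and ?k = "real (n - 1)"
  have L2T: "L2 ?T" by (rule L2_slab_time[OF d L2_weight nonneg])
  have L2Z: "L2 ?Z" by (intro L2_sum L2_zeta)
  have intTz: "integrable M (\<lambda>\<xi>. ?T \<xi> * zeta i \<xi>)" for i by (rule L2_mult_integrable[OF L2T L2_zeta])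
  have EZ: "expectation ?Z = 0"
    by (simp add: Bochner_Integration.integral_sum L2_integrable L2_zeta expectation_zeta)
  have "?k * ?D = (\<Sum>i<n - 1. ?D)" by simp
  also have "\<dots> \<le> (\<Sum>i<n - 1. expectation (\<lambda>\<xi>. ?T \<xi> * zeta i \<xi>))"
    by (rule sum_mono) (rule covariance_zeta, simp)
  also have "\<dots> = expectation (\<lambda>\<xi>. \<Sum>i<n - 1. ?T \<xi> * zeta i \<xi>)"
    by (rule Bochner_Integration.integral_sum[symmetric]) (rule intTz)
  also have "\<dots> = expectation (\<lambda>\<xi>. ?T \<xi> * ?Z \<xi>)" by (simp add: sum_distrib_left)
  also have "\<dots> = expectation (\<lambda>\<xi>. (?T \<xi> - expectation ?T) * ?Z \<xi>)"
  proof -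
    have "expectation (\<lambda>\<xi>. (?T \<xi> - expectation ?T) * ?Z \<xi>) = expectation (\<lambda>\<xi>. ?T \<xi> * ?Z \<xi> - expectation ?T * ?Z \<xi>)"
      by (simp only: left_diff_distrib)
    also have "\<dots> = expectation (\<lambda>\<xi>. ?T \<xi> * ?Z \<xi>) - expectation (\<lambda>\<xi>. expectation ?T * ?Z \<xi>)"
      by (rule Bochner_Integration.integral_diff[OF L2_mult_integrable[OF L2T L2Z]])
        (rule integrable_mult_right, rule L2_integrable[OF L2Z])
    also have "expectation (\<lambda>\<xi>. expectation ?T * ?Z \<xi>) = 0" using EZ by simp
    finally show ?thesis by simp
  qed
  also have "\<dots> \<le> l2norm (\<lambda>\<xi>. ?T \<xi> - expectation ?T) * l2norm ?Z"
    using Cauchy_Schwarz_expectation[OF L2_diff[OF L2T L2_const[of "expectation ?T"]] L2Z] by linarith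
  also have "\<dots> = sd ?T * l2norm ?Z" by (simp only: sd_eq_l2norm)
  also have "l2norm ?Z = sd ?Z" unfolding sd_eq_l2norm EZ by simp
  also have "sd ?T * sd ?Z \<le> sd ?T * (sqrt ?k * zeta_bound)"
  proof (rule mult_left_mono[OF _ sd_nonneg], rule power2_le_imp_le)
    have "(sd ?Z)\<^sup>2 = (\<Sum>i<n - 1. (sd (zeta i))\<^sup>2)"
      by (rule indep_vars_sd_sum[OF _ indep_vars_subset[OF zeta_indep] L2_zeta]) auto
    also have "\<dots> \<le> (\<Sum>i<n - 1. zeta_bound\<^sup>2)" by (intro sum_mono power_mono sd_zeta sd_nonneg)
    also have "\<dots> = (sqrt ?k * zeta_bound)\<^sup>2" by (simp add: power_mult_distrib)
    finally show "(sd ?Z)\<^sup>2 \<le> (sqrt ?k * zeta_bound)\<^sup>2" .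
  qed (use zeta_bound_pos in simp)
  finally have "?k * ?D \<le> sd ?T * (sqrt ?k * zeta_bound)" .
  then have "(?k * ?D)\<^sup>2 \<le> (sd ?T * (sqrt ?k * zeta_bound))\<^sup>2"
    using \<alpha>\<beta> by (intro power_mono) auto
  moreover have "(?k * ?D)\<^sup>2 = ?k * (?k * ?D\<^sup>2)"
    unfolding power_mult_distrib power2_eq_square[of ?k] by (rule mult.assoc)
  moreover have "(sd ?T * (sqrt ?k * zeta_bound))\<^sup>2 = ?k * (variance ?T * zeta_bound\<^sup>2)"
    unfolding power_mult_distrib sd_sq real_sqrt_pow2[OF of_nat_0_le_iff] by (rule mult.left_commute)
  ultimately have "?k * (?k * ?D\<^sup>2) \<le> ?k * (variance ?T * zeta_bound\<^sup>2)" by (simp only:)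
  moreover have k: "?k > 0" using n by simp
  ultimately have "?k * ?D\<^sup>2 \<le> variance ?T * zeta_bound\<^sup>2" by (simp only: mult_le_cancel_left_pos)
  \<comment> \<open>Here \<open>n - 1 \<ge> n / 2\<close> uses \<open>n \<ge> 2\<close>; it is the
    source of the factor 2 in the denominator.\<close>
  moreover have "real n / 2 * ?D\<^sup>2 \<le> ?k * ?D\<^sup>2"
    using n by (intro mult_right_mono) (simp_all add: of_nat_diff)
  ultimately have "real n / 2 * ?D\<^sup>2 \<le> variance ?T * zeta_bound\<^sup>2" by linarith
  then show ?thesis using zeta_bound_pos by (simp add: divide_le_eq field_simps)
qed

end

text \<open>\<kappa> is the norm of the cut cost at 1, since all cuts at positive columns have the
  same law and the cut at 0 costs nothing. The same comparison makes the tail bound uniform over the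
  cuts.\<close>

sublocale percolation \<subseteq> T: nearly_additive M "\<lambda>a b. \<G> (edges_in d (slab d h a b))"
  "\<lambda>a b \<xi>. slab_time d h (W \<xi>) a b" "\<lambda>b \<xi>. cut_cost d h (W \<xi>) b"
  "l2norm (\<lambda>\<xi>. cut_cost d h (W \<xi>) 1)" "(\<beta> - \<alpha>)\<^sup>2 / (2 * zeta_bound\<^sup>2)"
proof unfold_locales
  have sub: "edges_in d S \<subseteq> E" for S by (auto simp: edges_in_def)
  have cm: "(\<lambda>\<xi>. cut_cost d h (W \<xi>) b) \<in> borel_measurable M" for b
    by (rule cut_cost_measurable[OF d weight_measurable])
  show "subalgebra M (\<G> (edges_in d (slab d h a b)))" for a b by (rule \<G>_subalgebra[OF sub])
  show "sets (\<G> (edges_in d (slab d h a b))) \<subseteq> sets (\<G> (edges_in d (slab d h a' b')))" if "a' \<le> a" "b \<le> b'" for a b a' b'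
    by (rule \<G>_mono) (use slab_mono[OF that, of d h] in \<open>auto simp: edges_in_def\<close>)
  show "indep_sets (\<lambda>l. sets (\<G> (edges_in d (slab d h (n l) (n (Suc l)))))) UNIV" if "mono n" for n
    by (rule \<G>_indep[OF sub edges_in_disjoint[OF that]])
  show "(\<lambda>\<xi>. slab_time d h (W \<xi>) a b) \<in> borel_measurable (\<G> (edges_in d (slab d h a b)))" for a b
    by (rule slab_time_measurable[OF \<G>_weight])
  show "integrable M (\<lambda>\<xi>. (slab_time d h (W \<xi>) a b)\<^sup>2)" for a b
    using L2_slab_time[OF d L2_weight nonneg] by (simp add: L2_def)
  show "distr M borel (\<lambda>\<xi>. slab_time d h (W \<xi>) a b) = distr M borel (\<lambda>\<xi>. slab_time d h (W \<xi>) 0 (b - a))" if "a \<le> b" for a b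
    by (rule slab_time_stationary[OF that])
  show "\<bar>slab_time d h (W \<xi>) a c - slab_time d h (W \<xi>) a b - slab_time d h (W \<xi>) b c\<bar> \<le> cut_cost d h (W \<xi>) b"
    if "a \<le> b" "b \<le> c" for a b c \<xi>
    by (rule slab_time_nearly_additive[OF d nonneg that])
  show "L2 (\<lambda>\<xi>. cut_cost d h (W \<xi>) b)" for b by (rule L2_cut_cost[OF d L2_weight nonneg])
  show "l2norm (\<lambda>\<xi>. cut_cost d h (W \<xi>) b) \<le> l2norm (\<lambda>\<xi>. cut_cost d h (W \<xi>) 1)" for b
  proof (cases b)
    case 0
    then show ?thesis using l2norm_nonneg[of "\<lambda>\<xi>. cut_cost d h (W \<xi>) 1"] by (simp add: cut_cost_def l2norm_def)
  next
    case (Suc k)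
    show ?thesis unfolding Suc using l2norm_distr[OF cm cm cut_cost_stationary[of k]] by (simp only: order_refl)
  qed
  show "\<exists>\<tau>. (\<lambda>n. real n * \<tau> n) \<longlonglongrightarrow> 0 \<and>
      (\<forall>n b. prob {\<xi> \<in> space M. \<epsilon> * sqrt (real n) < cut_cost d h (W \<xi>) b} \<le> \<tau> n)" if "\<epsilon> > 0" for \<epsilon>
  proof (intro exI conjI allI)
    let ?\<tau> = "\<lambda>n. prob {\<xi> \<in> space M. \<epsilon> * sqrt (real n) < cut_cost d h (W \<xi>) 1}"
    show "(\<lambda>n. real n * ?\<tau> n) \<longlonglongrightarrow> 0"
      by (rule L2_tail[OF L2_cut_cost[OF d L2_weight nonneg] that])
    fix n b
    have meas: "prob {\<xi> \<in> space M. \<epsilon> * sqrt (real n) < cut_cost d h (W \<xi>) b'}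
        = measure (distr M borel (\<lambda>\<xi>. cut_cost d h (W \<xi>) b')) {\<epsilon> * sqrt (real n)<..}" for b'
      by (subst measure_distr[OF cm]) (auto intro!: arg_cong[where f=prob])
    show "prob {\<xi> \<in> space M. \<epsilon> * sqrt (real n) < cut_cost d h (W \<xi>) b} \<le> ?\<tau> n"
    proof (cases b)
      case 0
      have "\<not> \<epsilon> * sqrt (real n) < cut_cost d h (W \<xi>) 0" for \<xi>
        using that by (simp add: cut_cost_def not_less)
      then show ?thesis unfolding 0 by simp
    next
      case (Suc k)
      show ?thesis unfolding Suc meas cut_cost_stationary[of k] by (rule order_refl)
    qed
  qed
  show "0 < (\<beta> - \<alpha>)\<^sup>2 / (2 * zeta_bound\<^sup>2)" using \<alpha>\<beta> zeta_bound_pos by simp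
  show "(\<beta> - \<alpha>)\<^sup>2 / (2 * zeta_bound\<^sup>2) * real n \<le> variance (\<lambda>\<xi>. slab_time d h (W \<xi>) 0 n)" if "n \<ge> 2" for n
    by (rule variance_lower_bound[OF that])
qed

lemma ratio_Suc_tendsto_1: "(\<lambda>n. real (Suc n) / real n) \<longlonglongrightarrow> 1"
proof -
  have "(\<lambda>n. 1 + 1 / real n) \<longlonglongrightarrow> 1 + 0" by (intro tendsto_intros lim_const_over_n)
  moreover have "eventually (\<lambda>n. 1 + 1 / real n = real (Suc n) / real n) sequentially"
    using eventually_gt_at_top[of 0] by eventually_elim (simp add: field_simps)
  ultimately show ?thesis using tendsto_cong by force
qed

section \<open>The constants of the cylinder and the scaled process\<close>

context percolation
begin

lemma cylinder_time_L2: "L2 (\<lambda>\<xi>. a_time d \<omega> h n \<xi>)"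
proof -
  have "axis_point 0 \<in> slab d h 0 (Suc n)" "axis_point n \<in> slab d h 0 (Suc n)"
    by (auto intro!: axis_point_in_slab d)
  moreover have "slab d h 0 (Suc n) \<subseteq> cylinder d h" by (auto simp: slab_def)
  ultimately show ?thesis
    unfolding a_time_def by (intro L2_passage_time[OF d L2_weight nonneg _ _ _ slab_points(2)])
qed

text \<open>The bound does not depend on \<open>n\<close>, so cylinder and slab times have the same
  asymptotic mean and variance per unit length.\<close>

lemma l2norm_cylinder_time:
  "l2norm (\<lambda>\<xi>. a_time d \<omega> h n \<xi> - slab_time d h (W \<xi>) 0 (Suc n)) \<le> 2 * l2norm (\<lambda>\<xi>. col_cost d h (W \<xi>) 0)"
proof -
  have L2c: "L2 (\<lambda>\<xi>. col_cost d h (W \<xi>) k)" for k by (rule L2_col_cost[OF d L2_weight nonneg])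
  have "l2norm (\<lambda>\<xi>. a_time d \<omega> h n \<xi> - slab_time d h (W \<xi>) 0 (Suc n))
      \<le> l2norm (\<lambda>\<xi>. col_cost d h (W \<xi>) 0 + col_cost d h (W \<xi>) n)"
  proof (rule l2norm_mono[OF _ L2_add[OF L2c L2c]])
    show "(\<lambda>\<xi>. a_time d \<omega> h n \<xi> - slab_time d h (W \<xi>) 0 (Suc n)) \<in> borel_measurable M"
      by (rule L2_measurable[OF L2_diff[OF cylinder_time_L2 T.L2_T]])
    fix \<xi>
    show "\<bar>a_time d \<omega> h n \<xi> - slab_time d h (W \<xi>) 0 (Suc n)\<bar> \<le> \<bar>col_cost d h (W \<xi>) 0 + col_cost d h (W \<xi>) n\<bar>"
      unfolding a_time_def using cylinder_time_close[where w="W \<xi>", OF d nonneg, of h n] by linarith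
  qed
  also have "\<dots> \<le> l2norm (\<lambda>\<xi>. col_cost d h (W \<xi>) 0) + l2norm (\<lambda>\<xi>. col_cost d h (W \<xi>) n)"
    by (rule l2norm_triangle[OF L2c L2c])
  also have "l2norm (\<lambda>\<xi>. col_cost d h (W \<xi>) n) = l2norm (\<lambda>\<xi>. col_cost d h (W \<xi>) 0)"
    by (rule l2norm_distr[OF L2_measurable[OF L2c] L2_measurable[OF L2c] col_cost_stationary])
  finally show ?thesis by simp
qed

lemma time_const_eq: "time_const M d \<omega> h = T.\<mu>"
proof -
  let ?c = "2 * l2norm (\<lambda>\<xi>. col_cost d h (W \<xi>) 0)"
  have "(\<lambda>n. expectation (a_time d \<omega> h n) / real n - T.m (Suc n) / real n) \<longlonglongrightarrow> 0"
  proof (rule Lim_null_comparison[OF always_eventually])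
    show "(\<lambda>n. ?c / real n) \<longlonglongrightarrow> 0" by (rule lim_const_over_n)
    show "\<forall>n. norm (expectation (a_time d \<omega> h n) / real n - T.m (Suc n) / real n) \<le> ?c / real n"
    proof
      fix n
      have "expectation (a_time d \<omega> h n) - T.m (Suc n)
          = expectation (\<lambda>\<xi>. a_time d \<omega> h n \<xi> - slab_time d h (W \<xi>) 0 (Suc n))"
        unfolding T.m_def
        by (rule Bochner_Integration.integral_diff[symmetric, OF L2_integrable[OF cylinder_time_L2] L2_integrable[OF T.L2_T]])
      then have "\<bar>expectation (a_time d \<omega> h n) - T.m (Suc n)\<bar> \<le> ?c"
        using abs_expectation_le_l2norm(2)[OF L2_diff[OF cylinder_time_L2 T.L2_T], of n 0 "Suc n"] l2norm_cylinder_time[of n]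
        by linarith
      then have "\<bar>expectation (a_time d \<omega> h n) - T.m (Suc n)\<bar> / real n \<le> ?c / real n" by (rule divide_right_mono) simp
      then show "norm (expectation (a_time d \<omega> h n) / real n - T.m (Suc n) / real n) \<le> ?c / real n"
        by (simp only: real_norm_def diff_divide_distrib[symmetric] abs_divide abs_of_nat)
    qed
  qed
  moreover have "(\<lambda>n. T.m (Suc n) / real n) \<longlonglongrightarrow> T.\<mu>"
  proof -
    have "(\<lambda>n. T.m (Suc n) / real (Suc n) * (real (Suc n) / real n)) \<longlonglongrightarrow> T.\<mu> * 1"
      by (rule tendsto_mult[OF LIMSEQ_Suc[OF T.mean_limit] ratio_Suc_tendsto_1])
    then show ?thesis by simp
  qed
  ultimately have "(\<lambda>n. expectation (a_time d \<omega> h n) / real n) \<longlonglongrightarrow> T.\<mu>"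
    by (rule Lim_transform[rotated])
  then show ?thesis unfolding time_const_def by (rule limI)
qed

text \<open>Standard deviations are compared instead of variances: they differ by a bounded amount,
  which the division by \<open>sqrt n\<close> removes.\<close>

lemma var_const_eq: "var_const M d \<omega> h = T.\<sigma>\<^sup>2"
proof -
  let ?c = "2 * l2norm (\<lambda>\<xi>. col_cost d h (W \<xi>) 0)"
  have "(\<lambda>n. sd (a_time d \<omega> h n) / sqrt (real n) - T.s (Suc n) / sqrt (real n)) \<longlonglongrightarrow> 0"
  proof (rule Lim_null_comparison[OF always_eventually])
    show "(\<lambda>n. ?c / sqrt (real n)) \<longlonglongrightarrow> 0" by (rule over_sqrt_tendsto_0)
    show "\<forall>n. norm (sd (a_time d \<omega> h n) / sqrt (real n) - T.s (Suc n) / sqrt (real n)) \<le> ?c / sqrt (real n)"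
    proof
      fix n
      have "\<bar>sd (a_time d \<omega> h n) - T.s (Suc n)\<bar> \<le> sd (\<lambda>\<xi>. a_time d \<omega> h n \<xi> - slab_time d h (W \<xi>) 0 (Suc n))"
        unfolding T.s_def by (rule sd_diff[OF cylinder_time_L2 T.L2_T])
      then have "\<bar>sd (a_time d \<omega> h n) - T.s (Suc n)\<bar> \<le> ?c"
        using sd_le_l2norm[OF L2_diff[OF cylinder_time_L2 T.L2_T], of n 0 "Suc n"] l2norm_cylinder_time[of n] by linarith
      then have "\<bar>sd (a_time d \<omega> h n) - T.s (Suc n)\<bar> / sqrt (real n) \<le> ?c / sqrt (real n)"
        by (rule divide_right_mono) simp
      then show "norm (sd (a_time d \<omega> h n) / sqrt (real n) - T.s (Suc n) / sqrt (real n)) \<le> ?c / sqrt (real n)"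
        by (simp add: diff_divide_distrib[symmetric] abs_divide)
    qed
  qed
  moreover have "(\<lambda>n. T.s (Suc n) / sqrt (real n)) \<longlonglongrightarrow> T.\<sigma>"
  proof -
    have "(\<lambda>n. T.s (Suc n) / sqrt (real (Suc n)) * sqrt (real (Suc n) / real n)) \<longlonglongrightarrow> T.\<sigma> * sqrt 1"
      by (rule tendsto_mult[OF LIMSEQ_Suc[OF T.sd_limit] tendsto_real_sqrt[OF ratio_Suc_tendsto_1]])
    then show ?thesis by (simp add: real_sqrt_divide)
  qed
  ultimately have "(\<lambda>n. sd (a_time d \<omega> h n) / sqrt (real n)) \<longlonglongrightarrow> T.\<sigma>"
    by (rule Lim_transform[rotated])
  then have "(\<lambda>n. (sd (a_time d \<omega> h n) / sqrt (real n))\<^sup>2) \<longlonglongrightarrow> T.\<sigma>\<^sup>2" by (rule tendsto_power)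
  then have "(\<lambda>n. variance (a_time d \<omega> h n) / real n) \<longlonglongrightarrow> T.\<sigma>\<^sup>2"
    by (simp add: power_divide sd_sq)
  then show ?thesis unfolding var_const_def by (rule limI)
qed

lemma scaled_process_eq:
  "(\<lambda>t\<in>{0..}. (real n * var_const M d \<omega> h) powr (-1/2) * X_process M d \<omega> h \<xi> (real n * t)) = T.scaled_path n \<xi>"
proof -
  have c: "(real n * T.\<sigma>\<^sup>2) powr (-1/2) = 1 / (T.\<sigma> * sqrt (real n))"
  \<comment> \<open>For \<open>n = 0\<close> both sides are zero by the conventions for
    \<open>powr\<close> and for division by zero.\<close>
  proof (cases "n = 0")
    case False
    then have "real n * T.\<sigma>\<^sup>2 > 0" using T.\<sigma>_pos by simp
    then have "(real n * T.\<sigma>\<^sup>2) powr (-1/2) = 1 / sqrt (real n * T.\<sigma>\<^sup>2)"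
      by (simp add: powr_minus_divide powr_half_sqrt)
    then show ?thesis using T.\<sigma>_pos by (simp add: real_sqrt_mult mult.commute)
  qed simp
  have t: "t_time d \<omega> h j \<xi> = slab_time d h (W \<xi>) 0 (Suc j)" for j
    by (simp add: t_time_def slab_time_def box_eq_slab)
  show ?thesis
    unfolding T.scaled_path_def lin_path_def var_const_eq X_process_def time_const_eq c t
    by (simp add: linear_interpolation_scale)
qed

theorem invariance_principle:
  fixes N :: "'b measure" and B :: "real \<Rightarrow> 'b \<Rightarrow> real"
  assumes "standard_brownian_motion N B"
  shows "converges_in_distribution ucc_topology
           M (\<lambda>n \<xi>. \<lambda>t\<in>{0..}.
                (real n * var_const M d \<omega> h) powr (-1/2) * X_process M d \<omega> h \<xi> (real n * t))
           N (\<lambda>\<zeta>. \<lambda>t\<in>{0..}. B t \<zeta>)"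
  unfolding scaled_process_eq using T.scaled_path_converges_in_distribution[OF assms] .

end

section \<open>Weights that are nonnegative almost surely\<close>

text \<open>\<beta> is the mean \<open>c\<close>. If there were no mass at or above
  \<open>c\<close>, or none below it, the deviation from \<open>c\<close> would have constant sign
  and integral zero, so the law would be a point mass. Continuity of measure moves the mass below
  \<open>c\<close> to some \<open>\<alpha> = c - 1 / (k + 1)\<close>, which is nonnegative because
  the negative half line has no mass.\<close>

lemma (in real_distribution) nondegenerate_spread:
  assumes nn: "measure M {0..} = 1" and nd: "\<not> (\<exists>c. measure M {c} = 1)" and int: "integrable M (\<lambda>x. x)"
  obtains \<alpha> \<beta> where "0 \<le> \<alpha>" "\<alpha> < \<beta>" "measure M {..\<alpha>} > 0" "measure M {\<beta>..} > 0"
proof -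
  define c where "c = (\<integral>x. x \<partial>M)"
  have AEc: "AE x in M. x = c \<Longrightarrow> False"
  proof -
    assume "AE x in M. x = c"
    then have "prob {x \<in> space M. x = c} = 1" by (subst prob_Collect_eq_1) auto
    moreover have "{x \<in> space M. x = c} = {c}" by auto
    ultimately show False using nd by auto
  qed
  have intc: "(\<integral>x. x - c \<partial>M) = 0" "(\<integral>x. c - x \<partial>M) = 0" using int prob_space[unfolded space_eq_univ] by (simp_all add: c_def)
  have up: "measure M {c..} > 0"
  proof (rule ccontr)
    assume "\<not> measure M {c..} > 0"
    then have "measure M {c..} = 0" using measure_nonneg[of M "{c..}"] by linarith
    then have lt: "AE x in M. x < c"
      by (intro AE_I[of _ _ "{c..}"]) (auto simp: emeasure_eq_measure)
    have "AE x in M. c - x = 0"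
      by (rule integral_nonneg_eq_0_iff_AE[THEN iffD1, OF _ _ intc(2)]) (use int lt in \<open>auto elim: AE_mp\<close>)
    then have "AE x in M. x = c" by eventually_elim simp
    then show False by (rule AEc)
  qed
  have down: "measure M {..<c} > 0"
  proof (rule ccontr)
    assume "\<not> measure M {..<c} > 0"
    then have "measure M {..<c} = 0" using measure_nonneg[of M "{..<c}"] by linarith
    then have ge: "AE x in M. c \<le> x"
      by (intro AE_I[of _ _ "{..<c}"]) (auto simp: emeasure_eq_measure)
    have "AE x in M. x - c = 0"
      by (rule integral_nonneg_eq_0_iff_AE[THEN iffD1, OF _ _ intc(1)]) (use int ge in \<open>auto elim: AE_mp\<close>)
    then have "AE x in M. x = c" by eventually_elim simp
    then show False by (rule AEc)
  qed
  have "\<exists>k::nat. measure M {..c - 1 / real (Suc k)} > 0"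
  proof (rule ccontr)
    assume "\<not> ?thesis"
    then have z: "measure M {..c - 1 / real (Suc k)} = 0" for k
      using measure_nonneg[of M "{..c - 1 / real (Suc k)}"] by (meson not_le order_antisym)
    have "AE x in M. \<forall>k. \<not> x \<le> c - 1 / real (Suc k)"
      unfolding AE_all_countable
      by (intro allI AE_I[of _ _ "{..c - 1 / real (Suc _)}"]) (use z in \<open>auto simp: emeasure_eq_measure\<close>)
    then have "AE x in M. \<not> x < c"
    proof eventually_elim
      case (elim x)
      show ?case
      proof
        assume "x < c"
        then obtain k where "1 / real (Suc k) < c - x" using nat_approx_posE[of "c - x"] by auto
        then show False using elim[rule_format, of k] by simp
      qed
    qed
    then have "prob {x \<in> space M. \<not> x < c} = 1" by (subst prob_Collect_eq_1) auto
    moreover have "{x \<in> space M. \<not> x < c} = space M - {..<c}" by auto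
    ultimately have "prob (space M - {..<c}) = 1" by simp
    then show False using down prob_compl[of "{..<c}"] by simp
  qed
  then obtain k where k: "measure M {..c - 1 / real (Suc k)} > 0" by blast
  let ?\<alpha> = "c - 1 / real (Suc k)"
  have "0 \<le> ?\<alpha>"
  proof (rule ccontr)
    assume "\<not> 0 \<le> ?\<alpha>"
    then have "{..?\<alpha>} \<inter> {0..} = {}" by auto
    then have "measure M ({..?\<alpha>} \<union> {0..}) = measure M {..?\<alpha>} + measure M {0..}"
      by (intro finite_measure_Union) auto
    then show False using k nn prob_le_1[of "{..?\<alpha>} \<union> {0..}"] by linarith
  qed
  moreover have "?\<alpha> < c" by simp
  ultimately show ?thesis using that k up by blast
qed

lemma linear_process_measurable:
  assumes "\<And>j. (\<lambda>\<xi>. f j \<xi>) \<in> borel_measurable M"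
  shows "(\<lambda>\<xi>. \<lambda>t\<in>{0..}. c * linear_interpolation (\<lambda>j. f j \<xi>) (real n * t)) \<in> measurable M (borel_of_topology ucc_topology)"
  using lin_path_measurable[of "\<lambda>\<xi> j. c * f j \<xi>" M "real n"] assms
  by (simp add: lin_path_def linear_interpolation_scale)

theorem proposition1p4:
  fixes d h :: nat
    and F :: "real measure" and p :: real
    and M :: "'a measure" and \<omega> :: "(nat \<Rightarrow> int) set \<Rightarrow> 'a \<Rightarrow> real"
    and N :: "'b measure" and B :: "real \<Rightarrow> 'b \<Rightarrow> real"
  assumes "d \<ge> 2" and "h \<ge> 1"
    and "real_distribution F"
    and "measure F {0..} = 1"
    and "\<not> (\<exists>c. measure F {c} = 1)"
    and "p > 2" and "integrable F (\<lambda>x. x powr p)"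
    and "prob_space M"
    and "prob_space.indep_vars M (\<lambda>_. borel) \<omega> (lattice_edges d)"
    and "\<And>e. e \<in> lattice_edges d \<Longrightarrow> distr M borel (\<omega> e) = F"
    and "standard_brownian_motion N B"
  shows "converges_in_distribution ucc_topology
           M (\<lambda>n \<xi>. \<lambda>t\<in>{0..}.
                (real n * var_const M d \<omega> h) powr (-1/2) * X_process M d \<omega> h \<xi> (real n * t))
           N (\<lambda>\<zeta>. \<lambda>t\<in>{0..}. B t \<zeta>)"
proof -
  interpret F: real_distribution F by (rule assms(3))
  interpret M: prob_space M by (rule assms(8))
  have d: "d > 0" using assms(1) by simp
  \<comment> \<open>Truncation turns almost sure nonnegativity into nonnegativity at every sample
    point, also for indices that are not edges.\<close>
  define \<omega>' where "\<omega>' e \<xi> = max 0 (\<omega> e \<xi>)" for e \<xi>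
  have m: "\<omega> e \<in> borel_measurable M" if "e \<in> lattice_edges d" for e
    using assms(9) that by (auto simp: M.indep_vars_def2)
  have F0: "AE x in F. 0 \<le> x"
  proof (rule F.AE_in_set_eq_1[THEN iffD2, THEN AE_mp, of "{0..}"])
    show "measure F {0..} = 1" by (rule assms(4))
  qed auto
  have ae: "AE \<xi> in M. \<omega> e \<xi> = \<omega>' e \<xi>" if e: "e \<in> lattice_edges d" for e
  proof -
    have "AE x in distr M borel (\<omega> e). 0 \<le> x" by (subst assms(10)[OF e]) (rule F0)
    then have "AE \<xi> in M. 0 \<le> \<omega> e \<xi>" by (subst (asm) AE_distr_iff) (use m[OF e] in auto)
    then show ?thesis by eventually_elim (simp add: \<omega>'_def)
  qed
  \<comment> \<open>A passage time involves infinitely many edges; there are countably many, so one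
    null set serves for all of them.\<close>
  have ae_all: "AE \<xi> in M. \<forall>e\<in>lattice_edges d. \<omega> e \<xi> = \<omega>' e \<xi>"
    by (rule AE_ball_countable[THEN iffD2, OF countable_lattice_edges]) (use ae in blast)
  have F_sq: "integrable F (\<lambda>x. x\<^sup>2)"
  proof (rule Bochner_Integration.integrable_bound)
    \<comment> \<open>The summand 1 dominates the square on the unit interval, where the power with
      exponent \<open>p\<close> is the smaller one.\<close>
    show "integrable F (\<lambda>x. 1 + x powr p)" using assms(7) by simp
    show "AE x in F. norm (x\<^sup>2) \<le> norm (1 + x powr p)"
      using F0
    proof eventually_elim
      case (elim x)
      show ?case
      proof (cases "x \<le> 1")
        case True
        then have "x\<^sup>2 \<le> 1" using elim by (simp add: power_le_one)
        moreover have "0 \<le> x powr p" by simp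
        ultimately show ?thesis using zero_le_power2[of x] unfolding real_norm_def by linarith
      next
        case False
        then have "x\<^sup>2 = x powr 2" using elim by (simp add: powr_numeral)
        also have "\<dots> \<le> x powr p" using False assms(6) by (intro powr_mono) auto
        finally show ?thesis using zero_le_power2[of x] unfolding real_norm_def by linarith
      qed
    qed
  qed simp
  have F_int: "integrable F (\<lambda>x. x)"
    by (rule F.square_integrable_imp_integrable[OF _ F_sq]) simp
  obtain \<alpha> \<beta> where \<alpha>\<beta>: "0 \<le> \<alpha>" "\<alpha> < \<beta>" "measure F {..\<alpha>} > 0" "measure F {\<beta>..} > 0"
    using F.nondegenerate_spread[OF assms(4,5) F_int] by blast
  interpret P: percolation M d h \<omega>' F \<alpha> \<beta>
  proof unfold_locales
    show "d > 0" by (rule d)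
    show "0 \<le> \<omega>' e \<xi>" for e \<xi> by (simp add: \<omega>'_def)
    show "M.indep_vars (\<lambda>_. borel) \<omega>' (lattice_edges d)"
      unfolding \<omega>'_def by (rule M.indep_vars_compose2[OF assms(9)]) simp
    show "distr M borel (\<omega>' e) = F" if e: "e \<in> lattice_edges d" for e
    proof -
      have "distr M borel (\<omega>' e) = distr M borel (\<omega> e)"
        by (rule distr_cong_AE) (use ae[OF e] m[OF e] in \<open>auto simp: \<omega>'_def[abs_def] elim: AE_mp\<close>)
      then show ?thesis using assms(10)[OF e] by simp
    qed
  qed (use F_sq \<alpha>\<beta> in auto)
  have am: "a_time d \<omega> h n \<in> borel_measurable M" "a_time d \<omega>' h n \<in> borel_measurable M" for n
    unfolding a_time_def[abs_def]
    by (rule passage_time_measurable[OF slab_points(2)]; use m P.weight_measurable in blast)+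
  have aeq: "AE \<xi> in M. a_time d \<omega> h n \<xi> = a_time d \<omega>' h n \<xi>" for n
    using ae_all
  proof eventually_elim
    case (elim \<xi>)
    then show ?case unfolding a_time_def by (intro passage_time_cong) simp
  qed
  have Ea: "M.expectation (a_time d \<omega> h n) = M.expectation (a_time d \<omega>' h n)" for n
    by (rule integral_cong_AE[OF am aeq])
  have Va: "M.variance (a_time d \<omega> h n) = M.variance (a_time d \<omega>' h n)" for n
    unfolding Ea
  proof (rule integral_cong_AE)
    show "AE \<xi> in M. (a_time d \<omega> h n \<xi> - M.expectation (a_time d \<omega>' h n))\<^sup>2
        = (a_time d \<omega>' h n \<xi> - M.expectation (a_time d \<omega>' h n))\<^sup>2"
      using aeq[of n] by eventually_elim simp
  qed (use am[of n] in measurable)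
  have tc: "time_const M d \<omega> h = time_const M d \<omega>' h" by (simp only: time_const_def Ea)
  have vc: "var_const M d \<omega> h = var_const M d \<omega>' h" by (simp only: var_const_def Va)
  let ?Y = "\<lambda>\<omega> n \<xi>. \<lambda>t\<in>{0..}. (real n * var_const M d \<omega> h) powr (-1/2) * X_process M d \<omega> h \<xi> (real n * t)"
  \<comment> \<open>\<open>M\<close> need not be complete, so almost sure equality with the
    truncated process does not give measurability; it is derived from the weights directly.\<close>
  have tm: "t_time d \<omega> h n \<in> borel_measurable M" for n
    unfolding t_time_def[abs_def] box_eq_slab
    by (rule passage_time_measurable[OF slab_points(1)]) (rule m)
  have Ym: "?Y \<omega> n \<in> measurable M (borel_of_topology ucc_topology)" for n
    unfolding X_process_def
    by (rule linear_process_measurable) (intro borel_measurable_diff borel_measurable_const tm)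
  have conv: "converges_in_distribution ucc_topology M (?Y \<omega>') N (\<lambda>\<zeta>. \<lambda>t\<in>{0..}. B t \<zeta>)"
    by (rule P.invariance_principle[OF assms(11)])
  have Yeq: "AE \<xi> in M. ?Y \<omega> n \<xi> = ?Y \<omega>' n \<xi>" for n
    using ae_all
  proof eventually_elim
    case (elim \<xi>)
    have "t_time d \<omega> h j \<xi> = t_time d \<omega>' h j \<xi>" for j
      unfolding t_time_def by (intro passage_time_cong) (use elim in simp)
    then show ?case by (simp only: X_process_def tc vc)
  qed
  show ?thesis
    unfolding converges_in_distribution_def
  proof (intro conjI allI impI)
    show "?Y \<omega> n \<in> measurable M (borel_of_topology ucc_topology)" for n by (rule Ym)
    show "(\<lambda>\<zeta>. \<lambda>t\<in>{0..}. B t \<zeta>) \<in> measurable N (borel_of_topology ucc_topology)"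
      using conv by (simp add: converges_in_distribution_def)
    fix g assume g: "continuous_map ucc_topology euclideanreal g \<and> bounded (g ` topspace ucc_topology)"
    have gm: "g \<in> borel_measurable (borel_of_topology ucc_topology)"
      using g continuous_map_measurable by blast
    have Ym': "?Y \<omega>' n \<in> measurable M (borel_of_topology ucc_topology)" for n
      using conv by (simp only: converges_in_distribution_def)
    have "(\<integral>\<xi>. g (?Y \<omega> n \<xi>) \<partial>M) = (\<integral>\<xi>. g (?Y \<omega>' n \<xi>) \<partial>M)" for n
    proof (rule integral_cong_AE)
      show "(\<lambda>\<xi>. g (?Y \<omega> n \<xi>)) \<in> borel_measurable M" by (rule measurable_compose[OF Ym gm])
      show "(\<lambda>\<xi>. g (?Y \<omega>' n \<xi>)) \<in> borel_measurable M" by (rule measurable_compose[OF Ym' gm])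
      show "AE \<xi> in M. g (?Y \<omega> n \<xi>) = g (?Y \<omega>' n \<xi>)" using Yeq[of n] by eventually_elim (rule arg_cong[where f=g])
    qed
    moreover have "(\<lambda>n. \<integral>\<xi>. g (?Y \<omega>' n \<xi>) \<partial>M) \<longlonglongrightarrow> (\<integral>\<zeta>. g (\<lambda>t\<in>{0..}. B t \<zeta>) \<partial>N)"
      using conv g by (simp only: converges_in_distribution_def)
    ultimately show "(\<lambda>n. \<integral>\<xi>. g (?Y \<omega> n \<xi>) \<partial>M) \<longlonglongrightarrow> (\<integral>\<zeta>. g (\<lambda>t\<in>{0..}. B t \<zeta>) \<partial>N)"
      by (simp only:)
  qed
qed

end
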